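(* Let $F$ be the skew product over the three-legged horseshoe with fiber maps $f_0,f_1,f_2$ described in the context, satisfying (F0), (F1), (F2) and (F01), and let $\Lambda$ be its maximal invariant set. Then there exists an ergodic $F$-invariant Borel probability measure $\mu$ on $\Lambda$ satisfying $$h_\mu(F)=\log3\quad\text{and}\quad\chi_c(\mu)\le0 .$$
   Context: **Base.** $\Phi$ is a diffeomorphism of $\mathbb R^2$ having a horseshoe $\Gamma\subset\widehat{\mathbf C}=[0,1]^2$ and a homeomorphism $\varpi:\Gamma\to\Sigma_3=\{0,1,2\}^{\mathbb Z}$ with $\varpi\circ\Phi=\sigma\circ\varpi$, $\sigma$ the full shift. $\widehat{\mathbf C}_0,\widehat{\mathbf C}_1,\widehat{\mathbf C}_2$ are the three associated pairwise disjoint sub-rectangles of $\widehat{\mathbf C}$ ($\Gamma$ is the maximal invariant set of $\Phi$ in their union, and $X\in\Gamma$ lies in $\widehat{\mathbf C}_i$ iff the $0$-th symbol of $\varpi(X)$ is $i$). $\Phi$ is affine on each $\widehat{\mathbf C}_i$, contracting the first coordinate direction and expanding the second. **Skew product.** $\mathbf C=[0,1]^3$ and $F(\widehat x,x)=(\Phi(\widehat x),f_i(x))$ if $(\widehat x,x)\in\widehat{\mathbf C}_i\times[0,1]$, where $f_0,f_1,f_2:[0,1]\to[0,1]$ are $C^1$ injective maps. The expansion (contraction) of $\Phi$ is stronger than any expansion (contraction) of the $f_i$ (in particular $f_i'$ never vanishes), so that the $DF$-invariant splitting $E^{ss}\oplus E^c\oplus E^{uu}$ into the first, third and second coordinate directions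 is dominated. $\Lambda=\bigcap_{i\in\mathbb Z}F^i(\mathbf C)$, the set of points with complete $F$-orbit in $\mathbf C$. (The topological entropy of $F|_\Lambda$ is $\log 3$.) **Fiber maps.** (F0) $f_0$ is increasing with exactly two fixed points, both hyperbolic: $0$ (repelling) and $1$ (attracting); $\beta_0=f_0'(0)>1$, $\lambda_0=f_0'(1)\in(0,1)$, and $\lambda_0\le f_0'(x)$ for all $x\in[0,1]$. (F1) $f_1(x)=\gamma(1-x)$ is a contraction, $\lambda_0\le\gamma<1$. (F2) $f_2$ is increasing and has two hyperbolic fixed points, $0$ (repelling) and a point $p_2\in(0,1)$ (attracting); $\beta_2=f_2'(0)>1$. (F01) $f_0'$ is decreasing on $[0,1]$ and $\gamma\,\frac{\lambda_0^3(1-\lambda_0)}{1-\beta_0^{-1}}>1$. **Notation.** $h_\mu(F)$ is the measure-theoretic entropy and $\chi_c(\mu)=\int\log\lVert dF|_{E^c}\rVert\,d\mu$ the central Lyapunov exponent of $\mu$. *)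

theory Defs
  imports "HOL-Probability.Probability"
begin

section \<open>Smoothness\<close>

definition C1_map :: "('a::real_normed_vector \<Rightarrow> 'b::real_normed_vector) \<Rightarrow> bool" where
  "C1_map g \<longleftrightarrow>
     (\<exists>D. (\<forall>x. (g has_derivative blinfun_apply (D x)) (at x)) \<and> continuous_on UNIV D)"

definition C1_diffeomorphism :: "('a::real_normed_vector \<Rightarrow> 'a) \<Rightarrow> bool" where
  "C1_diffeomorphism \<Phi> \<longleftrightarrow> bij \<Phi> \<and> C1_map \<Phi> \<and> C1_map (inv \<Phi>)"

text \<open>Derivatives of maps of the closed interval are one-sided at the end points; values
  outside the interval play no role.\<close>

definition unit_deriv :: "(real \<Rightarrow> real) \<Rightarrow> real \<Rightarrow> real" where
  "unit_deriv g x = vector_derivative g (at x within {0..1})"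

definition C1_injective_unit_map :: "(real \<Rightarrow> real) \<Rightarrow> bool" where
  "C1_injective_unit_map g \<longleftrightarrow>
     g ` {0..1} \<subseteq> {0..1} \<and> inj_on g {0..1} \<and>
     g differentiable_on {0..1} \<and> continuous_on {0..1} (unit_deriv g)"


section \<open>The base horseshoe\<close>

text \<open>The space of bi-infinite sequences carries the product topology of the discrete topology
  on \<^typ>\<open>nat\<close>.\<close>

definition Sigma3 :: "(int \<Rightarrow> nat) set" where
  "Sigma3 = {s. \<forall>n. s n \<in> {0, 1, 2}}"

definition shift :: "(int \<Rightarrow> 'a) \<Rightarrow> int \<Rightarrow> 'a" where
  "shift s = (\<lambda>n. s (n + 1))"

text \<open>Points of \<open>D\<close> having a complete (two-sided) \<open>T\<close>-orbit in \<open>D\<close>; for a map that is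
  injective on its domain \<open>D\<close> this is the intersection of all \<open>T\<^sup>n(D)\<close>, \<open>n\<close> an integer.\<close>

definition maximal_invariant_set :: "('a \<Rightarrow> 'a) \<Rightarrow> 'a set \<Rightarrow> 'a set" where
  "maximal_invariant_set T D =
     {X. \<exists>Y :: int \<Rightarrow> 'a. Y 0 = X \<and> (\<forall>n. Y n \<in> D \<and> Y (n + 1) = T (Y n))}"

text \<open>\<open>R i\<close> are the three sub-rectangles, \<open>\<pi>\<close> is the coding map, and \<open>s i\<close>, \<open>u i\<close> are the
  (signed) rates of the affine map \<open>\<Phi>\<close> on \<open>R i\<close> in the first and second coordinate direction.\<close>

definition three_legged_horseshoe ::
  "(real \<times> real \<Rightarrow> real \<times> real) \<Rightarrow> (nat \<Rightarrow> (real \<times> real) set) \<Rightarrow> (real \<times> real) set \<Rightarrow>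
   (real \<times> real \<Rightarrow> int \<Rightarrow> nat) \<Rightarrow> (nat \<Rightarrow> real) \<Rightarrow> (nat \<Rightarrow> real) \<Rightarrow> bool" where
  "three_legged_horseshoe \<Phi> R \<Gamma> \<pi> s u \<longleftrightarrow>
     C1_diffeomorphism \<Phi> \<and>
     (\<forall>i\<in>{0, 1, 2}. \<exists>a b. R i = cbox a b \<and> box a b \<noteq> {} \<and> R i \<subseteq> {0..1} \<times> {0..1}) \<and>
     disjoint_family_on R {0, 1, 2} \<and>
     (\<forall>i\<in>{0, 1, 2}. \<bar>s i\<bar> < 1 \<and> 1 < \<bar>u i\<bar> \<and>
        (\<exists>b d. \<forall>(x, y) \<in> R i. \<Phi> (x, y) = (s i * x + b, u i * y + d))) \<and>
     \<Gamma> = maximal_invariant_set \<Phi> (\<Union>i\<in>{0, 1, 2}. R i) \<and>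
     (\<exists>\<pi>'. homeomorphism \<Gamma> Sigma3 \<pi> \<pi>') \<and>
     (\<forall>X\<in>\<Gamma>. \<pi> (\<Phi> X) = shift (\<pi> X)) \<and>
     (\<forall>X\<in>\<Gamma>. \<forall>i\<in>{0, 1, 2}. X \<in> R i \<longleftrightarrow> \<pi> X 0 = i)"


section \<open>The skew product\<close>

text \<open>The skew product is a partial map of \<open>[0,1]\<^sup>3\<close>, defined on \<open>skew_domain R\<close>; its values
  elsewhere are irrelevant.\<close>

definition skew_domain :: "(nat \<Rightarrow> (real \<times> real) set) \<Rightarrow> ((real \<times> real) \<times> real) set" where
  "skew_domain R = (\<Union>i\<in>{0, 1, 2}. R i \<times> {0..1})"

definition skew_product ::
  "(real \<times> real \<Rightarrow> real \<times> real) \<Rightarrow> (nat \<Rightarrow> (real \<times> real) set) \<Rightarrow> (nat \<Rightarrow> real \<Rightarrow> real) \<Rightarrow>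
   (real \<times> real) \<times> real \<Rightarrow> (real \<times> real) \<times> real" where
  "skew_product \<Phi> R f = (\<lambda>(p, x). (\<Phi> p, f (THE i. i \<in> {0, 1, 2} \<and> p \<in> R i) x))"

text \<open>As the \<open>R i\<close> lie in \<open>[0,1]\<^sup>2\<close>, \<open>skew_domain R\<close> is contained in the cube \<open>[0,1]\<^sup>3\<close>, so an
  orbit along which the partial map is defined automatically stays in the cube.\<close>

definition skew_Lambda ::
  "(real \<times> real \<Rightarrow> real \<times> real) \<Rightarrow> (nat \<Rightarrow> (real \<times> real) set) \<Rightarrow> (nat \<Rightarrow> real \<Rightarrow> real) \<Rightarrow>
   ((real \<times> real) \<times> real) set" where
  "skew_Lambda \<Phi> R f = maximal_invariant_set (skew_product \<Phi> R f) (skew_domain R)"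


section \<open>Invariant measures, entropy and the central exponent\<close>

definition borel_probability_on :: "'a::topological_space set \<Rightarrow> 'a measure \<Rightarrow> bool" where
  "borel_probability_on S M \<longleftrightarrow>
     prob_space M \<and> space M = S \<and> sets M = sets (restrict_space borel S)"

definition invariant_measure :: "('a \<Rightarrow> 'a) \<Rightarrow> 'a measure \<Rightarrow> bool" where
  "invariant_measure T M \<longleftrightarrow> T \<in> measurable M M \<and> distr M M T = M"

definition ergodic_measure :: "('a \<Rightarrow> 'a) \<Rightarrow> 'a measure \<Rightarrow> bool" where
  "ergodic_measure T M \<longleftrightarrow>
     invariant_measure T M \<and>
     (\<forall>A\<in>sets M. T -` A \<inter> space M = A \<longrightarrow> measure M A = 0 \<or> measure M A = 1)"

definition finite_partition :: "'a measure \<Rightarrow> 'a set set \<Rightarrow> bool" where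
  "finite_partition M P \<longleftrightarrow> finite P \<and> P \<subseteq> sets M \<and> partition_on (space M) P"

definition partition_join :: "'a set set \<Rightarrow> 'a set set \<Rightarrow> 'a set set" where
  "partition_join P Q = {A \<inter> B | A B. A \<in> P \<and> B \<in> Q} - {{}}"

text \<open>\<open>dynamical_partition M T P n\<close> is the join of \<open>T\<^sup>-\<^sup>kP\<close> over \<open>k < n\<close>.\<close>

primrec dynamical_partition ::
  "'a measure \<Rightarrow> ('a \<Rightarrow> 'a) \<Rightarrow> 'a set set \<Rightarrow> nat \<Rightarrow> 'a set set" where
  "dynamical_partition M T P 0 = {space M}"
| "dynamical_partition M T P (Suc n) =
     partition_join (dynamical_partition M T P n) ((\<lambda>A. (T ^^ n) -` A \<inter> space M) ` P)"

text \<open>Note \<open>0 * ln 0 = 0\<close>.\<close>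

definition partition_entropy :: "'a measure \<Rightarrow> 'a set set \<Rightarrow> real" where
  "partition_entropy M P = - (\<Sum>A\<in>P. measure M A * ln (measure M A))"

text \<open>For an invariant probability measure the limit exists by subadditivity.\<close>

definition entropy_wrt_partition :: "'a measure \<Rightarrow> ('a \<Rightarrow> 'a) \<Rightarrow> 'a set set \<Rightarrow> real" where
  "entropy_wrt_partition M T P =
     lim (\<lambda>n. partition_entropy M (dynamical_partition M T P n) / real n)"

definition measure_entropy :: "'a measure \<Rightarrow> ('a \<Rightarrow> 'a) \<Rightarrow> ereal" where
  "measure_entropy M T =
     (SUP P \<in> {P. finite_partition M P}. ereal (entropy_wrt_partition M T P))"

text \<open>The central bundle is the third coordinate direction, so the restriction of the derivative
  of \<open>F\<close> to it is the derivative of \<open>F\<close> along the fiber \<open>{p} \<times> [0,1]\<close>.\<close>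

definition central_exponent ::
  "((real \<times> real) \<times> real) measure \<Rightarrow> ((real \<times> real) \<times> real \<Rightarrow> (real \<times> real) \<times> real) \<Rightarrow> real" where
  "central_exponent M F =
     (\<integral>(p, x). ln (norm (vector_derivative (\<lambda>t. F (p, t)) (at x within {0..1}))) \<partial>M)"

end

theory Submission
  imports Defs
begin

text \<open>
  Choose the symbols of the skew product independently with probability \<open>1/3\<close> each. A measure \<open>\<nu>\<close>
  on \<open>[0,1]\<close> that is stationary for the resulting random composition of the fiber maps lifts, by the
  natural extension, to an invariant measure on \<open>\<Lambda>\<close> over the Bernoulli measure, and its central
  exponent is the mean of \<open>log \<bar>f\<^sub>i'\<bar>\<close> over \<open>\<nu>\<close> and \<open>i\<close>.

  The composition \<open>h\<close> of the fiber maps along any word is injective into \<open>[0,1]\<close>, so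
  \<open>\<integral> log \<bar>h'\<bar> dx \<le> \<integral> \<bar>h'\<bar> dx - 1 \<le> 0\<close>. Hence every weak limit of the Cesaro means of the transported
  Lebesgue measure is stationary with exponent \<open>\<le> 0\<close>. Among the stationary measures of least
  exponent, one that maximizes the strictly convex functional \<open>\<integral> cdf\<^sup>2 dx\<close> is an extreme point of the
  set of all stationary measures, and the lift of an extreme point is ergodic.

  The symbol partition shows that the entropy is at least \<open>log 3\<close>. For the upper bound, the fiber
  maps are monotone, so over a fixed word of length \<open>n\<close> a finite partition of \<open>[0,1]\<close> into intervals
  is cut into only linearly many pieces, which contributes no entropy.
\<close>

section \<open>Bernoulli sequences and the one-sided skew product\<close>

text \<open>The exponent is an affine function of the stationary measure, so its minimizers form a
  face: if a minimizer is a proper mixture of two stationary measures, both are minimizers. Hence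
  maximizing a strictly convex functional over the minimizers gives extremality among all stationary
  measures, and extremality takes the place of an ergodic decomposition. It has to be extremality
  among all of them: for an invariant set of the lift, the laws of the fiber coordinate conditioned
  on the set and on its complement are stationary, but nothing is known beforehand about their
  exponents. Stationarity of these two laws is the delicate point, since an invariant set may depend
  on the whole past. Approximation within finite time windows shows that conditioning on it does not
  bias the future symbols, so the product structure survives. The natural extension is forced by the
  definition of \<open>\<Lambda>\<close>: a point there needs a complete past, and a stationary
  measure only describes the present fiber coordinate together with future symbols.\<close>

definition bern :: "(nat \<Rightarrow> nat) measure" where
  "bern = (\<Pi>\<^sub>M n\<in>UNIV. measure_pmf (pmf_of_set {0, 1, 2}))"

interpretation bern: sequence_space "measure_pmf (pmf_of_set {0, 1, 2 :: nat})"
  by standard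

interpretation bern_prob: prob_space bern
  unfolding bern_def by (rule prob_space_PiM) (rule prob_space_measure_pmf)

lemma space_bern [simp]: "space bern = UNIV"
  by (auto simp: bern_def space_PiM)

lemma measurable_bern_component [measurable]: "(\<lambda>\<omega>. \<omega> n) \<in> bern \<rightarrow>\<^sub>M count_space UNIV"
proof -
  have "(\<lambda>\<omega>. \<omega> n) \<in> bern \<rightarrow>\<^sub>M measure_pmf (pmf_of_set {0, 1, 2})"
    unfolding bern_def by (rule measurable_component_singleton) simp
  then show ?thesis
    by (simp cong: measurable_cong_sets)
qed

lemma measurable_bernI:
  assumes "\<And>n. (\<lambda>z. F z n) \<in> N \<rightarrow>\<^sub>M count_space UNIV"
  shows "F \<in> N \<rightarrow>\<^sub>M bern"
  unfolding bern_def
  by (rule measurable_PiM_single') (use assms in \<open>auto simp: measurable_def space_PiM\<close>)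

lemma measurable_bern_drop [measurable]: "(\<lambda>\<omega> n. \<omega> (n + r)) \<in> bern \<rightarrow>\<^sub>M bern"
  by (rule measurable_bernI) simp

text \<open>Replacing the tail of a sample from position \<open>r\<close> on by an independent
  sample does not change its law; this is Fubini across the cut at \<open>r\<close>.\<close>

lemma nn_integral_bern_comb_seq:
  assumes [measurable]: "h \<in> borel_measurable bern"
  shows "(\<integral>\<^sup>+\<omega>. h \<omega> \<partial>bern) = (\<integral>\<^sup>+\<omega>. \<integral>\<^sup>+\<omega>'. h (comb_seq r \<omega> \<omega>') \<partial>bern \<partial>bern)"
proof -
  have m [measurable]: "(\<lambda>(\<omega>, \<omega>'). comb_seq r \<omega> \<omega>') \<in> bern \<Otimes>\<^sub>M bern \<rightarrow>\<^sub>M bern"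
    unfolding bern_def by (rule measurable_comb_seq)
  have "(\<integral>\<^sup>+\<omega>. h \<omega> \<partial>bern) = (\<integral>\<^sup>+\<omega>. h \<omega> \<partial>distr (bern \<Otimes>\<^sub>M bern) bern (\<lambda>(\<omega>, \<omega>'). comb_seq r \<omega> \<omega>'))"
    unfolding bern_def by (subst bern.PiM_comb_seq) simp
  also have "\<dots> = (\<integral>\<^sup>+z. h (case z of (\<omega>, \<omega>') \<Rightarrow> comb_seq r \<omega> \<omega>') \<partial>(bern \<Otimes>\<^sub>M bern))"
    by (rule nn_integral_distr) simp_all
  also have "\<dots> = (\<integral>\<^sup>+\<omega>. \<integral>\<^sup>+\<omega>'. h (comb_seq r \<omega> \<omega>') \<partial>bern \<partial>bern)"
    by (subst bern_prob.nn_integral_fst[symmetric]) simp_all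
  finally show ?thesis .
qed

text \<open>\<open>W\<close> sees the fiber coordinate and the first \<open>r\<close> symbols, the
  other event only the symbols from \<open>r\<close> on; after splicing two samples at
  \<open>r\<close> the measure of the slice factors as \<open>w \<omega>\<close> times
  \<open>indicator D \<omega>'\<close>. The case \<open>r = 1\<close> serves for a single step, the
  case of a whole time window for ergodicity.\<close>

lemma bern_indep:
  assumes "prob_space \<rho>" and W: "W \<in> sets (bern \<Otimes>\<^sub>M \<rho>)" and D[measurable]: "D \<in> sets bern"
    and dep: "\<And>\<omega> \<omega>' x. (\<And>j. j < r \<Longrightarrow> \<omega> j = \<omega>' j) \<Longrightarrow> (\<omega>, x) \<in> W \<longleftrightarrow> (\<omega>', x) \<in> W"
  shows "emeasure (bern \<Otimes>\<^sub>M \<rho>) {z \<in> W. (\<lambda>n. fst z (n + r)) \<in> D}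
       = emeasure (bern \<Otimes>\<^sub>M \<rho>) W * emeasure bern D"
proof -
  interpret \<rho>: prob_space \<rho> by fact
  note [measurable] = W
  have WX: "{z \<in> W. (\<lambda>n. fst z (n + r)) \<in> D} = {z \<in> space (bern \<Otimes>\<^sub>M \<rho>). z \<in> W \<and> (\<lambda>n. fst z (n + r)) \<in> D}"
    using sets.sets_into_space[OF W] by auto
  have m: "{z \<in> W. (\<lambda>n. fst z (n + r)) \<in> D} \<in> sets (bern \<Otimes>\<^sub>M \<rho>)"
    unfolding WX by measurable
  define h where "h \<omega> = emeasure \<rho> (Pair \<omega> -` {z \<in> W. (\<lambda>n. fst z (n + r)) \<in> D})" for \<omega>
  define w where "w \<omega> = emeasure \<rho> (Pair \<omega> -` W)" for \<omega>
  have eq: "h (comb_seq r \<omega> \<omega>') = w \<omega> * indicator D \<omega>'" for \<omega> \<omega>'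
  proof -
    have "(\<lambda>n. comb_seq r \<omega> \<omega>' (n + r)) = \<omega>'"
      by (simp add: comb_seq_add)
    moreover have "(comb_seq r \<omega> \<omega>', x) \<in> W \<longleftrightarrow> (\<omega>, x) \<in> W" for x
      by (rule dep) (simp add: comb_seq_less)
    ultimately have "Pair (comb_seq r \<omega> \<omega>') -` {z \<in> W. (\<lambda>n. fst z (n + r)) \<in> D}
        = (if \<omega>' \<in> D then Pair \<omega> -` W else {})"
      by auto
    then show ?thesis by (simp add: h_def w_def)
  qed
  have [measurable]: "h \<in> borel_measurable bern" "w \<in> borel_measurable bern"
    unfolding h_def[abs_def] w_def[abs_def]
    using \<rho>.measurable_emeasure_Pair[OF m] \<rho>.measurable_emeasure_Pair[OF W] by auto
  have "emeasure (bern \<Otimes>\<^sub>M \<rho>) {z \<in> W. (\<lambda>n. fst z (n + r)) \<in> D} = (\<integral>\<^sup>+\<omega>. h \<omega> \<partial>bern)"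
    unfolding h_def by (rule \<rho>.emeasure_pair_measure_alt[OF m])
  also have "\<dots> = (\<integral>\<^sup>+\<omega>. \<integral>\<^sup>+\<omega>'. w \<omega> * indicator D \<omega>' \<partial>bern \<partial>bern)"
    by (subst nn_integral_bern_comb_seq[where r=r]) (simp_all add: eq)
  also have "\<dots> = (\<integral>\<^sup>+\<omega>. w \<omega> \<partial>bern) * emeasure bern D"
    by (simp add: nn_integral_cmult nn_integral_multc)
  also have "(\<integral>\<^sup>+\<omega>. w \<omega> \<partial>bern) = emeasure (bern \<Otimes>\<^sub>M \<rho>) W"
    unfolding w_def by (rule \<rho>.emeasure_pair_measure_alt[OF W, symmetric])
  finally show ?thesis .
qed

lemma AE_bern: "AE \<omega> in bern. \<forall>n. \<omega> n \<in> {0, 1, 2}"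
  unfolding bern_def AE_all_countable
  by (intro allI bern.AE_component) (simp_all add: AE_measure_pmf_iff)

section \<open>The one-sided skew product and its Markov operator\<close>

locale fiber_system =
  fixes g :: "nat \<Rightarrow> real \<Rightarrow> real"
  assumes g_cont: "continuous_on UNIV (g i)" and g_range: "g i x \<in> {0..1}"
begin

definition step :: "(nat \<Rightarrow> nat) \<times> real \<Rightarrow> (nat \<Rightarrow> nat) \<times> real" where
  "step z = ((\<lambda>n. fst z (n + 1)), g (fst z 0) (snd z))"

lemma g_measurable [measurable]: "g i \<in> borel_measurable borel"
  using g_cont by (rule borel_measurable_continuous_onI)

lemma step_measurable [measurable]: "step \<in> bern \<Otimes>\<^sub>M borel \<rightarrow>\<^sub>M bern \<Otimes>\<^sub>M borel"
proof -
  have [measurable]: "(\<lambda>z. g (fst z 0) (snd z)) \<in> borel_measurable (bern \<Otimes>\<^sub>M borel)"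
    by (rule measurable_compose_countable[where f="\<lambda>i z. g i (snd z)" and g="\<lambda>z. fst z 0"]) measurable
  show ?thesis
    unfolding step_def[abs_def] by measurable
qed

text \<open>The Markov operator of the random composition, acting on laws of the fiber coordinate.
  As an image of a product of probabilities it is a probability at once; the average over the three
  maps reappears in \<open>integral_push\<close>.\<close>

definition push :: "real measure \<Rightarrow> real measure" where
  "push \<rho> = distr (bern \<Otimes>\<^sub>M \<rho>) borel (\<lambda>z. snd (step z))"

lemma step_iter_fst: "fst ((step ^^ n) z) = (\<lambda>k. fst z (k + n))"
  by (induction n) (auto simp: step_def)

lemma step_iter_cong:
  assumes "\<And>j. j < n \<Longrightarrow> \<omega> j = \<omega>' j"
  shows "snd ((step ^^ n) (\<omega>, x)) = snd ((step ^^ n) (\<omega>', x))"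
  using assms by (induction n) (auto simp: step_def step_iter_fst)

lemma measurable_step_prod:
  assumes "sets \<rho> = sets borel"
  shows "step \<in> bern \<Otimes>\<^sub>M \<rho> \<rightarrow>\<^sub>M bern \<Otimes>\<^sub>M borel" 
  using assms step_measurable by (simp cong: measurable_cong_sets sets_pair_measure_cong)

lemma real_distribution_push:
  assumes "real_distribution \<rho>"
  shows "real_distribution (push \<rho>)"
proof -
  interpret \<rho>: real_distribution \<rho> by fact
  interpret pair_prob_space bern \<rho> ..
  have [measurable]: "step \<in> bern \<Otimes>\<^sub>M \<rho> \<rightarrow>\<^sub>M bern \<Otimes>\<^sub>M borel"
    by (rule measurable_step_prod) simp
  show ?thesis
    unfolding push_def by (rule real_distribution_distr) measurable
qed

text \<open>The symbol consumed by \<open>step\<close> is independent of the symbols that are left,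
  so the image law is again a product with \<open>bern\<close>. For a stationary
  \<open>\<nu>\<close> the product with \<open>bern\<close> is therefore invariant under
  \<open>step\<close>.\<close>

lemma distr_step:
  assumes "real_distribution \<rho>"
  shows "distr (bern \<Otimes>\<^sub>M \<rho>) (bern \<Otimes>\<^sub>M borel) step = bern \<Otimes>\<^sub>M push \<rho>"
proof -
  interpret \<rho>: real_distribution \<rho> by fact
  interpret p: real_distribution "push \<rho>" by (rule real_distribution_push) fact
  have [measurable]: "step \<in> bern \<Otimes>\<^sub>M \<rho> \<rightarrow>\<^sub>M bern \<Otimes>\<^sub>M borel"
    by (rule measurable_step_prod) simp
  show ?thesis
  proof (rule pair_measure_eqI[symmetric])
    show "sigma_finite_measure bern" "sigma_finite_measure (push \<rho>)" by unfold_locales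
    show "sets (bern \<Otimes>\<^sub>M push \<rho>) = sets (distr (bern \<Otimes>\<^sub>M \<rho>) (bern \<Otimes>\<^sub>M borel) step)"
      by (simp cong: sets_pair_measure_cong add: push_def)
    fix D U assume D[measurable]: "D \<in> sets bern" and "U \<in> sets (push \<rho>)"
    then have [measurable]: "U \<in> sets borel" by (simp add: push_def)
    let ?W = "{z \<in> space (bern \<Otimes>\<^sub>M \<rho>). snd (step z) \<in> U}"
    have "emeasure (distr (bern \<Otimes>\<^sub>M \<rho>) (bern \<Otimes>\<^sub>M borel) step) (D \<times> U)
       = emeasure (bern \<Otimes>\<^sub>M \<rho>) {z \<in> ?W. (\<lambda>n. fst z (n + 1)) \<in> D}"
      by (subst emeasure_distr) (auto simp: step_def intro!: arg_cong[where f="emeasure _"])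
    also have "\<dots> = emeasure (bern \<Otimes>\<^sub>M \<rho>) ?W * emeasure bern D"
    proof (rule bern_indep)
      show "?W \<in> sets (bern \<Otimes>\<^sub>M \<rho>)" by measurable
    qed (auto simp: step_def space_pair_measure, unfold_locales)
    also have "emeasure (bern \<Otimes>\<^sub>M \<rho>) ?W = emeasure (push \<rho>) U"
      unfolding push_def by (subst emeasure_distr) (auto intro!: arg_cong[where f="emeasure _"])
    finally show "emeasure bern D * emeasure (push \<rho>) U 
        = emeasure (distr (bern \<Otimes>\<^sub>M \<rho>) (bern \<Otimes>\<^sub>M borel) step) (D \<times> U)"
      by (simp add: mult.commute)
  qed
qed

end

section \<open>Weak compactness and strict convexity on the unit interval\<close>

text \<open>The direct method: a subsequence of a minimizing sequence converges inside
  \<open>S\<close>, and continuity identifies its value with the infimum, which \<open>B\<close>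
  keeps finite. It is applied twice, to the exponent and to the negative of the integral of the
  squared cdf.\<close>

lemma weak_compact_attains_min:
  fixes J :: "real measure \<Rightarrow> real"
  assumes ne: "S \<noteq> {}"
    and compact: "\<And>\<mu>. (\<And>n. \<mu> n \<in> S) \<Longrightarrow> \<exists>r M. strict_mono (r :: nat \<Rightarrow> nat) \<and> M \<in> S \<and> weak_conv_m (\<mu> \<circ> r) M"
    and cont: "\<And>\<mu> M. (\<And>n. \<mu> n \<in> S) \<Longrightarrow> M \<in> S \<Longrightarrow> weak_conv_m \<mu> M \<Longrightarrow> (\<lambda>n. J (\<mu> n)) \<longlonglongrightarrow> J M"
    and bdd: "\<And>M. M \<in> S \<Longrightarrow> B \<le> J M"
  shows "\<exists>M\<in>S. \<forall>N\<in>S. J M \<le> J N"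
proof -
  have bb: "bdd_below (J ` S)" using bdd by (intro bdd_belowI[of _ B]) auto
  define c where "c = Inf (J ` S)"
  have "\<exists>M\<in>S. J M < c + 1 / Suc n" for n
  proof -
    have "Inf (J ` S) < c + 1 / Suc n" unfolding c_def by simp
    then show ?thesis using cInf_less_iff[of "J ` S"] ne bb by auto
  qed
  then obtain \<mu> where \<mu>: "\<And>n. \<mu> n \<in> S" "\<And>n. J (\<mu> n) < c + 1 / Suc n" by metis
  obtain r M where r: "strict_mono r" and M: "M \<in> S" "weak_conv_m (\<mu> \<circ> r) M"
    using compact[of \<mu>, OF \<mu>(1)] by (elim exE conjE)
  have "(\<lambda>n. J ((\<mu> \<circ> r) n)) \<longlonglongrightarrow> J M"
    by (rule cont[OF _ M]) (simp add: \<mu>(1))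
  moreover have "(\<lambda>n. c + 1 / Suc (r n)) \<longlonglongrightarrow> c + 0"
    using LIMSEQ_subseq_LIMSEQ[OF LIMSEQ_Suc[OF lim_1_over_n] r] by (intro tendsto_add) (auto simp: o_def)
  moreover have "J ((\<mu> \<circ> r) n) \<le> c + 1 / Suc (r n)" for n
    using less_imp_le[OF \<mu>(2)[of "r n"]] by (simp only: o_def)
  ultimately have "J M \<le> c + 0"
    using LIMSEQ_le[of "\<lambda>n. J ((\<mu> \<circ> r) n)" "J M"] by blast
  moreover have "c \<le> J N" if "N \<in> S" for N
    unfolding c_def by (intro cInf_lower[OF _ bb] imageI that)
  ultimately have "\<forall>N\<in>S. J M \<le> J N"
    by force
  then show ?thesis using M(1) by (rule bexI)
qed

lemma tight_unit_interval:
  assumes "\<And>n. real_distribution (\<mu> n)" and "\<And>n. measure (\<mu> n) {0..1} = 1"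
  shows "tight \<mu>"
  unfolding tight_def
proof (intro conjI allI impI exI)
  fix e :: real and n assume "0 < e"
  interpret real_distribution "\<mu> n" by fact
  \<comment> \<open>Tightness is phrased with half-open intervals; starting at -1 keeps a possible
    atom at 0 inside.\<close>
  show "(-1 :: real) < 1" by simp
  have "measure (\<mu> n) {0..1} \<le> measure (\<mu> n) {-1<..1}"
    by (rule finite_measure_mono) auto
  then show "1 - e < measure (\<mu> n) {-1<..1}" using assms(2)[of n] \<open>0 < e\<close> by linarith
qed (use assms in auto)

text \<open>The real and imaginary parts of the characteristic function are integrals of such test
  functions, namely of cosines and sines.\<close>

lemma real_distribution_eqI:
  assumes M: "real_distribution M" and N: "real_distribution N"
    and eq: "\<And>\<phi>. continuous_on UNIV \<phi> \<Longrightarrow> (\<And>x. \<bar>\<phi> x\<bar> \<le> 1) \<Longrightarrow> (LINT x|M. \<phi> x) = (LINT x|N. \<phi> x :: real)"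
  shows "M = N"
proof (rule Levy_uniqueness[OF M N], rule ext)
  fix t
  interpret M: real_distribution M by fact
  interpret N: real_distribution N by fact
  have iM: "integrable M (\<lambda>x. cos (t * x))" "integrable M (\<lambda>x. sin (t * x))"
    by (rule M.integrable_const_bound[where B=1]; simp)+
  have iN: "integrable N (\<lambda>x. cos (t * x))" "integrable N (\<lambda>x. sin (t * x))"
    by (rule N.integrable_const_bound[where B=1]; simp)+
  have "(LINT x|M. cos (t * x)) = (LINT x|N. cos (t * x))"
    "(LINT x|M. sin (t * x)) = (LINT x|N. sin (t * x))"
    by (intro eq continuous_intros; simp)+
  moreover have "char M t = Complex (LINT x|M. cos (t * x)) (LINT x|M. sin (t * x))"
    unfolding char_def
    by (rule complex_eqI; subst integral_Re[symmetric] integral_Im[symmetric])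
       (auto intro!: M.integrable_iexp simp: Re_exp Im_exp)
  moreover have "char N t = Complex (LINT x|N. cos (t * x)) (LINT x|N. sin (t * x))"
    unfolding char_def
    by (rule complex_eqI; subst integral_Re[symmetric] integral_Im[symmetric])
       (auto intro!: N.integrable_iexp simp: Re_exp Im_exp)
  ultimately show "char M t = char N t" by simp
qed

text \<open>Weak convergence gives pointwise convergence of the cdfs away from the atoms of the
  limit. These are countably many, hence Lebesgue null, and dominated convergence applies.\<close>

lemma cdf_square_integral_tendsto:
  assumes \<mu>: "\<And>n. real_distribution (\<mu> n)" and M: "real_distribution M" and w: "weak_conv_m \<mu> M"
  shows "(\<lambda>n. LINT x:{0..1}|lborel. (cdf (\<mu> n) x)\<^sup>2) \<longlonglongrightarrow> (LINT x:{0..1}|lborel. (cdf M x)\<^sup>2)"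
  unfolding set_lebesgue_integral_def
proof (rule integral_dominated_convergence[where w="indicator {0..1}"])
  interpret \<mu>: real_distribution "\<mu> n" for n by fact
  interpret M: real_distribution M by fact
  have [measurable]: "cdf (\<mu> n) \<in> borel_measurable borel" "cdf M \<in> borel_measurable borel" for n
    by (auto intro!: borel_measurable_mono monoI \<mu>.cdf_nondecreasing M.cdf_nondecreasing)
  show "(\<lambda>x. indicator {0..1} x *\<^sub>R (cdf M x)\<^sup>2) \<in> borel_measurable lborel" by measurable
  show "(\<lambda>x. indicator {0..1} x *\<^sub>R (cdf (\<mu> n) x)\<^sup>2) \<in> borel_measurable lborel" for n by measurable
  have "countable {x. measure M {x} \<noteq> 0}" by (rule M.countable_support)
  then have "AE x in lborel. x \<notin> {x. measure M {x} \<noteq> 0}"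
    by (intro AE_not_in countable_imp_null_set_lborel)
  then show "AE x in lborel. (\<lambda>n. indicator {0..1} x *\<^sub>R (cdf (\<mu> n) x)\<^sup>2)
      \<longlonglongrightarrow> indicator {0..1} x *\<^sub>R (cdf M x)\<^sup>2"
    by eventually_elim (use w in \<open>auto simp: weak_conv_m_def weak_conv_def M.isCont_cdf intro!: tendsto_intros\<close>)
  show "AE x in lborel. norm (indicator {0..1} x *\<^sub>R (cdf (\<mu> n) x)\<^sup>2) \<le> indicator {0..1} x" for n
    using \<mu>.cdf_nonneg \<mu>.cdf_bounded_prob
    by (intro AE_I2) (auto simp: indicator_def power_le_one)
qed simp

lemma cdf_eq_outside_unit_interval:
  assumes "real_distribution M" "measure M {0..1} = 1"
  shows "x < 0 \<Longrightarrow> cdf M x = 0" "1 \<le> x \<Longrightarrow> cdf M x = 1"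
proof -
  interpret real_distribution M by fact
  show "cdf M x = 0" if "x < 0"
  proof -
    have "measure M ({..x} \<union> {0..1}) = measure M {..x} + measure M {0..1}"
      using that by (intro finite_measure_Union) auto
    then show ?thesis using assms(2) prob_le_1[of "{..x} \<union> {0..1}"] measure_nonneg[of M "{..x}"]
      by (simp add: cdf_def)
  qed
  show "cdf M x = 1" if "1 \<le> x"
  proof -
    have "measure M {0..1} \<le> measure M {..x}" using that by (intro finite_measure_mono) auto
    then show ?thesis using assms(2) prob_le_1[of "{..x}"] by (simp add: cdf_def)
  qed
qed

text \<open>With cdfs \<open>F1\<close>, \<open>F2\<close> and their mixture \<open>F\<close>, the
  identity \<open>a * F1^2 + (1 - a) * F2^2 - F^2 = a * (1 - a) * (F1 - F2)^2\<close> measures the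
  convexity defect. If neither component exceeds the mixture, the integral of the right-hand side
  vanishes.\<close>

lemma cdf_square_integral_convex:
  assumes M: "real_distribution M" and N1: "real_distribution N1" and N2: "real_distribution N2"
    and supp: "measure N1 {0..1} = 1" "measure N2 {0..1} = 1"
    and a: "0 < a" "a < 1"
    and mix: "\<And>U. U \<in> sets borel \<Longrightarrow> measure M U = a * measure N1 U + (1 - a) * measure N2 U"
    and le: "(LINT x:{0..1}|lborel. (cdf N1 x)\<^sup>2) \<le> (LINT x:{0..1}|lborel. (cdf M x)\<^sup>2)"
      "(LINT x:{0..1}|lborel. (cdf N2 x)\<^sup>2) \<le> (LINT x:{0..1}|lborel. (cdf M x)\<^sup>2)"
  shows "N1 = N2"
proof -
  interpret M: real_distribution M by fact
  interpret N1: real_distribution N1 by fact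
  interpret N2: real_distribution N2 by fact
  have m [measurable]: "cdf M \<in> borel_measurable borel" "cdf N1 \<in> borel_measurable borel"
      "cdf N2 \<in> borel_measurable borel"
    by (auto intro!: borel_measurable_mono monoI M.cdf_nondecreasing N1.cdf_nondecreasing N2.cdf_nondecreasing)
  have int: "set_integrable lborel {0..1} (\<lambda>x. (F x)\<^sup>2)"
    if [measurable]: "F \<in> borel_measurable borel" and "\<And>x. \<bar>F x\<bar> \<le> 1" for F :: "real \<Rightarrow> real"
  proof -
    have sq: "(F x)\<^sup>2 \<le> 1" for x using that(2)[of x] by (simp add: abs_square_le_1)
    show ?thesis unfolding set_integrable_def
      by (rule Bochner_Integration.integrable_bound[of lborel "indicator {0..1::real} :: real \<Rightarrow> real"])
         (auto simp: indicator_def sq)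
  qed
  have cM: "cdf M x = a * cdf N1 x + (1 - a) * cdf N2 x" for x
    unfolding cdf_def by (rule mix) simp
  have bds: "0 \<le> cdf N1 x" "cdf N1 x \<le> 1" "0 \<le> cdf N2 x" "cdf N2 x \<le> 1" "0 \<le> cdf M x" "cdf M x \<le> 1" for x
    by (auto intro: N1.cdf_nonneg N2.cdf_nonneg N1.cdf_bounded_prob N2.cdf_bounded_prob M.cdf_nonneg M.cdf_bounded_prob)
  have i1: "set_integrable lborel {0..1} (\<lambda>x. (cdf N1 x)\<^sup>2)"
    by (rule int[OF m(2)]) (simp add: bds)
  have i2: "set_integrable lborel {0..1} (\<lambda>x. (cdf N2 x)\<^sup>2)"
    by (rule int[OF m(3)]) (simp add: bds)
  have iM: "set_integrable lborel {0..1} (\<lambda>x. (cdf M x)\<^sup>2)"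
    by (rule int[OF m(1)]) (simp add: bds)
  have iD: "set_integrable lborel {0..1} (\<lambda>x. (cdf N1 x - cdf N2 x)\<^sup>2)"
  proof (rule int)
    show "\<bar>cdf N1 x - cdf N2 x\<bar> \<le> 1" for x
      using bds(1-4)[of x] by linarith
  qed measurable
  let ?I = "\<lambda>F. LINT x:{0..1}|lborel. (F x)\<^sup>2"
  have "a * (1 - a) * ?I (\<lambda>x. cdf N1 x - cdf N2 x) = (LINT x:{0..1}|lborel. a * (1 - a) * (cdf N1 x - cdf N2 x)\<^sup>2)"
    by simp
  also have "\<dots> = (LINT x:{0..1}|lborel. (a * (cdf N1 x)\<^sup>2 + (1 - a) * (cdf N2 x)\<^sup>2) - (cdf M x)\<^sup>2)"
    by (intro set_lebesgue_integral_cong) (auto simp: cM power2_eq_square algebra_simps)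
  also have "\<dots> = a * ?I (cdf N1) + (1 - a) * ?I (cdf N2) - ?I (cdf M)"
    using i1 i2 iM by (subst set_integral_diff) (auto intro!: set_integral_add set_integrable_mult_right)
  also have "\<dots> \<le> a * ?I (cdf M) + (1 - a) * ?I (cdf M) - ?I (cdf M)"
    using le a by (intro diff_mono add_mono mult_left_mono) auto
  also have "\<dots> = 0" by (simp add: algebra_simps)
  finally have "?I (\<lambda>x. cdf N1 x - cdf N2 x) \<le> 0"
    using a by (simp add: mult_le_0_iff)
  then have "?I (\<lambda>x. cdf N1 x - cdf N2 x) = 0"
    by (intro antisym) (auto simp: set_lebesgue_integral_def intro!: integral_nonneg_AE)
  then have ae: "AE x in lborel. x \<in> {0..1} \<longrightarrow> cdf N1 x = cdf N2 x"
    using iD unfolding set_lebesgue_integral_def set_integrable_def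
    by (subst (asm) integral_nonneg_eq_0_iff_AE) (auto simp: indicator_def split: if_splits elim!: AE_mp)
  have "cdf N1 x = cdf N2 x" for x
  proof (cases "0 \<le> x \<and> x < 1")
    case True
    show ?thesis
    proof (rule ccontr)
      assume neq: "cdf N1 x \<noteq> cdf N2 x"
      \<comment> \<open>So far the cdfs agree only almost everywhere; by right continuity a
        disagreement at one point would spread to an interval of positive length.\<close>
      have "((\<lambda>y. cdf N1 y - cdf N2 y) \<longlongrightarrow> cdf N1 x - cdf N2 x) (at_right x)"
        using N1.cdf_is_right_cont[of x] N2.cdf_is_right_cont[of x]
        by (intro tendsto_intros) (auto simp: continuous_within)
      then have "eventually (\<lambda>y. cdf N1 y - cdf N2 y \<noteq> 0) (at_right x)"
        using neq by (intro tendsto_imp_eventually_ne) auto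
      then obtain c where c: "x < c" "\<And>y. x < y \<Longrightarrow> y < c \<Longrightarrow> cdf N1 y \<noteq> cdf N2 y"
        by (auto simp: eventually_at_right_field)
      have "AE y in lborel. y \<notin> {x<..<min c 1}"
        using ae by eventually_elim (use c True in auto)
      then have "{x<..<min c 1} \<in> null_sets lborel"
        by (subst AE_iff_null_sets) auto
      then show False using c True by (auto simp: null_sets_def min_def split: if_splits)
    qed
  next
    case False
    then show ?thesis
      using cdf_eq_outside_unit_interval[OF N1 supp(1)] cdf_eq_outside_unit_interval[OF N2 supp(2)] by force
  qed
  then show ?thesis by (intro cdf_unique[OF N1 N2] ext)
qed

section \<open>Extremal stationary measures with non-positive exponent\<close>

abbreviation unit_uniform :: "real measure" where
  "unit_uniform \<equiv> uniform_measure lborel {0..1}"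

lemma real_distribution_unit_uniform: "real_distribution unit_uniform"
proof -
  interpret prob_space unit_uniform
    by (rule prob_space_uniform_measure) simp_all
  show ?thesis by standard simp
qed

lemma abs_average_le:
  fixes a b c :: real
  assumes "\<bar>a\<bar> \<le> B" "\<bar>b\<bar> \<le> B" "\<bar>c\<bar> \<le> B"
  shows "\<bar>(a + b + c) / 3\<bar> \<le> B"
  using assms unfolding abs_le_iff by (simp add: field_simps)

lemma (in prob_space) abs_integral_le:
  assumes m: "f \<in> borel_measurable M" and b: "\<And>x. \<bar>f x\<bar> \<le> (B :: real)"
  shows "\<bar>LINT x|M. f x\<bar> \<le> B"
proof -
  have "integrable M f" by (rule integrable_const_bound[where B=B]) (use m b in auto)
  then show ?thesis
    using integral_le_const[of f B] integral_ge_const[of f "- B"] b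
    by (simp add: abs_le_iff minus_le_iff)
qed

lemma integral_bern_0: "(LINT \<omega>|bern. h (\<omega> 0)) = (h 0 + h 1 + h 2 :: real) / 3"
proof -
  have "(LINT \<omega>|bern. h (\<omega> 0)) = (LINT i|(distr bern (measure_pmf (pmf_of_set {0,1,2})) (\<lambda>\<omega>. \<omega> 0)). h i)"
    by (subst integral_distr) simp_all
  also have "distr bern (measure_pmf (pmf_of_set {0,1,2})) (\<lambda>\<omega>. \<omega> 0) = measure_pmf (pmf_of_set {0,1,2})"
    unfolding bern_def by (rule bern.PiM_component) simp
  also have "(LINT i|(measure_pmf (pmf_of_set {0,1,2})). h i) = (h 0 + h 1 + h 2) / 3"
    by (subst integral_measure_pmf_real[where A="{0,1,2}"]) (auto simp: pmf_of_set field_simps)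
  finally show ?thesis .
qed

lemma integral_bern_first:
  assumes "real_distribution \<rho>" and h: "\<And>i. h i \<in> borel_measurable borel" and B: "\<And>i x. \<bar>h i x\<bar> \<le> (B :: real)"
  shows "(LINT z|(bern \<Otimes>\<^sub>M \<rho>). h (fst z 0) (snd z)) = (LINT x|\<rho>. (h 0 x + h 1 x + h 2 x) / 3)"
proof -
  interpret \<rho>: real_distribution \<rho> by fact
  interpret pair_prob_space bern \<rho> ..
  have [measurable]: "(\<lambda>z. h (fst z 0) (snd z)) \<in> borel_measurable (bern \<Otimes>\<^sub>M \<rho>)"
    by (rule measurable_compose_countable[where f="\<lambda>i z. h i (snd z)" and g="\<lambda>z. fst z 0"])
       (use h in measurable)
  have "integrable (bern \<Otimes>\<^sub>M \<rho>) (\<lambda>z. h (fst z 0) (snd z))"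
    by (rule P.integrable_const_bound[where B=B]) (simp_all add: B)
  then have "(LINT x|\<rho>. LINT \<omega>|bern. h (\<omega> 0) x) = (LINT z|(bern \<Otimes>\<^sub>M \<rho>). h (fst z 0) (snd z))"
    by (rule integral_snd[of "\<lambda>\<omega> x. h (\<omega> 0) x", unfolded case_prod_beta'])
  moreover have "(LINT \<omega>|bern. h (\<omega> 0) x) = (h 0 x + h 1 x + h 2 x) / 3" for x
    by (rule integral_bern_0[of "\<lambda>i. h i x"])
  ultimately show ?thesis
    by (simp only:)
qed

section \<open>Stationary measures, their weak compactness, and Cesaro means\<close>

context fiber_system
begin

lemma integral_push:
  assumes "real_distribution \<rho>" and \<phi>[measurable]: "\<phi> \<in> borel_measurable borel" and B: "\<And>x. \<bar>\<phi> x\<bar> \<le> (B :: real)"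
  shows "(LINT x|(push \<rho>). \<phi> x) = (LINT x|\<rho>. (\<phi> (g 0 x) + \<phi> (g 1 x) + \<phi> (g 2 x)) / 3)"
proof -
  interpret \<rho>: real_distribution \<rho> by fact
  have [measurable]: "step \<in> bern \<Otimes>\<^sub>M \<rho> \<rightarrow>\<^sub>M bern \<Otimes>\<^sub>M borel"
    by (rule measurable_step_prod) simp
  have "(LINT x|(push \<rho>). \<phi> x) = (LINT z|(bern \<Otimes>\<^sub>M \<rho>). \<phi> (snd (step z)))"
    unfolding push_def by (subst integral_distr) measurable
  also have "\<dots> = (LINT z|(bern \<Otimes>\<^sub>M \<rho>). (\<lambda>i x. \<phi> (g i x)) (fst z 0) (snd z))"
    by (simp add: step_def)
  also have "\<dots> = (LINT x|\<rho>. (\<phi> (g 0 x) + \<phi> (g 1 x) + \<phi> (g 2 x)) / 3)"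
    by (rule integral_bern_first[OF assms(1)]) (use B in measurable)
  finally show ?thesis .
qed

lemma real_distribution_push_iter:
  "real_distribution \<rho> \<Longrightarrow> real_distribution ((push ^^ k) \<rho>)"
  by (induction k) (auto intro: real_distribution_push)

lemma step_iter_measurable [measurable]: "step ^^ k \<in> bern \<Otimes>\<^sub>M borel \<rightarrow>\<^sub>M bern \<Otimes>\<^sub>M borel"
  by (induction k) (auto simp: id_def intro: measurable_comp[OF _ step_measurable])

lemma distr_step_iter:
  assumes "real_distribution \<rho>"
  shows "distr (bern \<Otimes>\<^sub>M \<rho>) (bern \<Otimes>\<^sub>M borel) (step ^^ k) = bern \<Otimes>\<^sub>M (push ^^ k) \<rho>"
proof -
  interpret \<rho>: real_distribution \<rho> by fact
  have s: "sets (bern \<Otimes>\<^sub>M \<rho>) = sets (bern \<Otimes>\<^sub>M borel)"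
    by (simp cong: sets_pair_measure_cong)
  show ?thesis
  proof (induction k)
    case 0
    show ?case using s by (simp add: id_def distr_id2)
  next
    case (Suc k)
    have "distr (bern \<Otimes>\<^sub>M \<rho>) (bern \<Otimes>\<^sub>M borel) (step ^^ Suc k)
        = distr (distr (bern \<Otimes>\<^sub>M \<rho>) (bern \<Otimes>\<^sub>M borel) (step ^^ k)) (bern \<Otimes>\<^sub>M borel) step"
      using step_iter_measurable[of k] s
      by (subst distr_distr) (auto cong: measurable_cong_sets)
    also have "\<dots> = bern \<Otimes>\<^sub>M (push ^^ Suc k) \<rho>"
      by (simp add: Suc distr_step real_distribution_push_iter[OF assms])
    finally show ?case .
  qed
qed

lemma integral_step_iter:
  assumes "real_distribution \<rho>" and F[measurable]: "F \<in> borel_measurable (bern \<Otimes>\<^sub>M borel)"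
  shows "(LINT z|(bern \<Otimes>\<^sub>M \<rho>). F ((step ^^ k) z) :: real) = (LINT z|(bern \<Otimes>\<^sub>M (push ^^ k) \<rho>). F z)"
proof -
  interpret \<rho>: real_distribution \<rho> by fact
  have s: "sets (bern \<Otimes>\<^sub>M \<rho>) = sets (bern \<Otimes>\<^sub>M borel)"
    by (simp cong: sets_pair_measure_cong)
  show ?thesis
    unfolding distr_step_iter[OF assms(1), symmetric]
    using step_iter_measurable[of k] s
    by (subst integral_distr) (auto cong: measurable_cong_sets)
qed

definition stationary :: "real measure \<Rightarrow> bool" where
  "stationary \<nu> \<longleftrightarrow> real_distribution \<nu> \<and> push \<nu> = \<nu>"

text \<open>Each \<open>g i\<close> maps the whole line into \<open>[0,1]\<close>, so a single step
  brings all mass there; in particular every stationary measure lives on the unit interval, which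
  gives tightness.\<close>

lemma push_support:
  assumes "real_distribution \<rho>"
  shows "measure (push \<rho>) {0..1} = 1"
proof -
  interpret \<rho>: real_distribution \<rho> by fact
  interpret pair_prob_space bern \<rho> ..
  have [measurable]: "step \<in> bern \<Otimes>\<^sub>M \<rho> \<rightarrow>\<^sub>M bern \<Otimes>\<^sub>M borel"
    by (rule measurable_step_prod) simp
  have "measure (push \<rho>) {0..1} = measure (bern \<Otimes>\<^sub>M \<rho>) (space (bern \<Otimes>\<^sub>M \<rho>))"
    unfolding push_def using g_range
    by (subst measure_distr) (auto simp: step_def intro!: arg_cong[where f="measure _"])
  then show ?thesis by (simp add: P.prob_space)
qed

lemma stationary_support: "stationary \<nu> \<Longrightarrow> measure \<nu> {0..1} = 1"
  using push_support[of \<nu>] by (simp add: stationary_def)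

text \<open>Extremality in the set of all stationary measures, with mixtures expressed set by set.
  The two components will be the conditional laws of the fiber coordinate on an invariant set and on
  its complement.\<close>

definition extremal :: "real measure \<Rightarrow> bool" where
  "extremal \<nu> \<longleftrightarrow> (\<forall>\<nu>1 \<nu>2 a. stationary \<nu>1 \<longrightarrow> stationary \<nu>2 \<longrightarrow> 0 < a \<longrightarrow> a < 1 \<longrightarrow>
     (\<forall>U\<in>sets borel. measure \<nu> U = a * measure \<nu>1 U + (1 - a) * measure \<nu>2 U) \<longrightarrow> \<nu>1 = \<nu>2)"

text \<open>Testing with bounded continuous functions is the form of stationarity that survives weak
  limits.\<close>

lemma stationaryI:
  assumes \<nu>: "real_distribution \<nu>"
    and eq: "\<And>\<phi>. continuous_on UNIV \<phi> \<Longrightarrow> (\<And>x. \<bar>\<phi> x\<bar> \<le> 1) \<Longrightarrow>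
      (LINT x|\<nu>. (\<phi> (g 0 x) + \<phi> (g 1 x) + \<phi> (g 2 x)) / 3) = (LINT x|\<nu>. \<phi> x :: real)"
  shows "stationary \<nu>"
  unfolding stationary_def
proof (intro conjI \<nu> real_distribution_eqI real_distribution_push)
  fix \<phi> :: "real \<Rightarrow> real" assume c: "continuous_on UNIV \<phi>" and b: "\<And>x. \<bar>\<phi> x\<bar> \<le> 1"
  have "(LINT x|(push \<nu>). \<phi> x) = (LINT x|\<nu>. (\<phi> (g 0 x) + \<phi> (g 1 x) + \<phi> (g 2 x)) / 3)"
    by (rule integral_push[OF \<nu> _ b]) (rule borel_measurable_continuous_onI[OF c])
  also have "\<dots> = (LINT x|\<nu>. \<phi> x)" by (rule eq[OF c b])
  finally show "(LINT x|(push \<nu>). \<phi> x) = (LINT x|\<nu>. \<phi> x)" .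
qed

lemma weak_conv_integral:
  assumes "\<And>n. real_distribution (\<mu> n)" "real_distribution M" "weak_conv_m \<mu> M"
    "continuous_on UNIV \<phi>" "\<And>x. \<bar>\<phi> x\<bar> \<le> (B::real)"
  shows "(\<lambda>n. LINT x|(\<mu> n). \<phi> x) \<longlonglongrightarrow> (LINT x|M. \<phi> x)"
  by (rule weak_conv_imp_integral_bdd_continuous_conv[of \<mu> M])
     (use assms in \<open>auto simp: continuous_on_eq_continuous_at\<close>)

lemma continuous_on_average:
  assumes "continuous_on UNIV (\<phi> :: real \<Rightarrow> real)"
  shows "continuous_on UNIV (\<lambda>x. (\<phi> (g 0 x) + \<phi> (g 1 x) + \<phi> (g 2 x)) / 3)"
  using continuous_on_compose2[OF assms g_cont] by (auto intro!: continuous_intros)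

text \<open>All stationary measures live on \<open>[0,1]\<close>, so they are tight. The averaged
  test function \<open>?A\<close> is again bounded and continuous (the Feller property), so the
  stationarity identity passes to the limit.\<close>

lemma stationary_compact:
  assumes "\<And>n. stationary (\<mu> n)"
  shows "\<exists>r M. strict_mono (r :: nat \<Rightarrow> nat) \<and> stationary M \<and> weak_conv_m (\<mu> \<circ> r) M"
proof -
  have rd: "real_distribution (\<mu> n)" for n using assms by (simp add: stationary_def)
  have "tight \<mu>"
    by (rule tight_unit_interval) (use rd assms stationary_support in auto)
  then obtain r M where r: "strict_mono r" "real_distribution M" "weak_conv_m (\<mu> \<circ> id \<circ> r) M"
    using tight_imp_convergent_subsubsequence[of \<mu> id] by (auto simp: strict_mono_id)
  have w: "weak_conv_m (\<mu> \<circ> r) M" using r(3) by simp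
  have rd': "real_distribution ((\<mu> \<circ> r) n)" for n using rd by simp
  have "stationary M"
  proof (rule stationaryI[OF r(2)])
    fix \<phi> :: "real \<Rightarrow> real" assume c: "continuous_on UNIV \<phi>" and b: "\<And>x. \<bar>\<phi> x\<bar> \<le> 1"
    let ?A = "\<lambda>x. (\<phi> (g 0 x) + \<phi> (g 1 x) + \<phi> (g 2 x)) / 3"
    have "\<bar>?A x\<bar> \<le> 1" for x 
      using b[of "g 0 x"] b[of "g 1 x"] b[of "g 2 x"] unfolding abs_le_iff by (auto simp del: One_nat_def)
    then have 1: "(\<lambda>n. LINT x|((\<mu> \<circ> r) n). ?A x) \<longlonglongrightarrow> (LINT x|M. ?A x)"
      by (rule weak_conv_integral[OF rd' r(2) w continuous_on_average[OF c]])
    have 2: "(LINT x|((\<mu> \<circ> r) n). ?A x) = (LINT x|((\<mu> \<circ> r) n). \<phi> x)" for n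
      using integral_push[OF rd borel_measurable_continuous_onI[OF c] b, of "r n"] assms[of "r n"]
      by (simp add: stationary_def)
    have 3: "(\<lambda>n. LINT x|((\<mu> \<circ> r) n). \<phi> x) \<longlonglongrightarrow> (LINT x|M. \<phi> x)"
      by (rule weak_conv_integral[OF rd' r(2) w c b])
    show "(LINT x|M. ?A x) = (LINT x|M. \<phi> x)"
      by (rule LIMSEQ_unique[OF 1[unfolded 2] 3])
  qed
  then show ?thesis using r by auto
qed

text \<open>The mean of the first \<open>Suc n\<close> transports of Lebesgue measure, realized as
  the law of the fiber coordinate at a uniformly random time \<open>k \<le> n\<close>. Being the
  image of a probability, it needs no separate construction of a convex combination of
  measures.\<close>

definition cesaro :: "nat \<Rightarrow> real measure" where
  "cesaro n = distr (measure_pmf (pmf_of_set {..n}) \<Otimes>\<^sub>M (bern \<Otimes>\<^sub>M unit_uniform)) borel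
     (\<lambda>(k, z). snd ((step ^^ k) z))"

lemma cesaro_measurable:
  "(\<lambda>(k, z). snd ((step ^^ k) z)) \<in> measure_pmf p \<Otimes>\<^sub>M (bern \<Otimes>\<^sub>M unit_uniform) \<rightarrow>\<^sub>M borel"
proof -
  have s: "sets (bern \<Otimes>\<^sub>M unit_uniform) = sets (bern \<Otimes>\<^sub>M borel)"
    by (simp cong: sets_pair_measure_cong)
  have "(\<lambda>z. snd ((step ^^ k) z)) \<in> (bern \<Otimes>\<^sub>M unit_uniform) \<rightarrow>\<^sub>M borel" for k
    using measurable_comp[OF step_iter_measurable[of k] measurable_snd] s
    by (simp add: o_def cong: measurable_cong_sets)
  then have "(\<lambda>(k, z). snd ((step ^^ k) z)) \<in> count_space UNIV \<Otimes>\<^sub>M (bern \<Otimes>\<^sub>M unit_uniform) \<rightarrow>\<^sub>M borel"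
    by (intro measurable_pair_measure_countable1) auto
  then show ?thesis by (simp cong: measurable_cong_sets sets_pair_measure_cong)
qed

lemma real_distribution_cesaro: "real_distribution (cesaro n)"
proof -
  interpret U: real_distribution unit_uniform by (rule real_distribution_unit_uniform)
  interpret Q: pair_prob_space bern unit_uniform ..
  interpret R: pair_prob_space "measure_pmf (pmf_of_set {..n})" "bern \<Otimes>\<^sub>M unit_uniform" ..
  show ?thesis unfolding cesaro_def
    by (rule R.P.real_distribution_distr[OF cesaro_measurable])
qed

lemma integral_cesaro:
  assumes [measurable]: "\<phi> \<in> borel_measurable borel" and B: "\<And>x. \<bar>\<phi> x\<bar> \<le> (B :: real)"
  shows "(LINT x|(cesaro n). \<phi> x) = (\<Sum>k\<le>n. LINT x|((push ^^ k) unit_uniform). \<phi> x) / Suc n"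
proof -
  interpret U: real_distribution unit_uniform by (rule real_distribution_unit_uniform)
  interpret Q: pair_prob_space bern unit_uniform ..
  interpret R: pair_prob_space "measure_pmf (pmf_of_set {..n})" "bern \<Otimes>\<^sub>M unit_uniform" ..
  note [measurable] = cesaro_measurable
  have "(LINT x|(cesaro n). \<phi> x) = (LINT y|(measure_pmf (pmf_of_set {..n}) \<Otimes>\<^sub>M (bern \<Otimes>\<^sub>M unit_uniform)).
      \<phi> (case y of (k, z) \<Rightarrow> snd ((step ^^ k) z)))"
    unfolding cesaro_def by (subst integral_distr) simp_all
  also have "\<dots> = (LINT k|(measure_pmf (pmf_of_set {..n})). LINT z|(bern \<Otimes>\<^sub>M unit_uniform). \<phi> (snd ((step ^^ k) z)))"
    by (subst R.integral_fst'[symmetric]) (auto intro!: R.P.integrable_const_bound[where B=B] simp: B)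
  also have "\<dots> = (\<Sum>k\<le>n. (LINT z|(bern \<Otimes>\<^sub>M unit_uniform). \<phi> (snd ((step ^^ k) z))) * (1 / Suc n))"
    by (subst integral_measure_pmf_real[where A="{..n}"]) (auto simp: pmf_of_set)
  also have "\<dots> = (\<Sum>k\<le>n. (LINT x|((push ^^ k) unit_uniform). \<phi> x) * (1 / Suc n))"
  proof (intro sum.cong refl arg_cong2[where f="(*)"])
    fix k
    interpret p: real_distribution "(push ^^ k) unit_uniform"
      by (rule real_distribution_push_iter[OF real_distribution_unit_uniform])
    interpret S: pair_prob_space bern "(push ^^ k) unit_uniform" ..
    have "(LINT z|(bern \<Otimes>\<^sub>M unit_uniform). \<phi> (snd ((step ^^ k) z))) = (LINT z|(bern \<Otimes>\<^sub>M (push ^^ k) unit_uniform). \<phi> (snd z))"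
      by (rule integral_step_iter[OF real_distribution_unit_uniform, of "\<lambda>z. \<phi> (snd z)"]) measurable
    \<comment> \<open>The formula for the first symbol is applied to a function that ignores the
      symbol, whence three equal summands.\<close>
    also have "\<dots> = (LINT x|((push ^^ k) unit_uniform). (\<phi> x + \<phi> x + \<phi> x) / 3)"
      by (rule integral_bern_first[OF p.real_distribution_axioms, where h="\<lambda>_. \<phi>"]) (use B in auto)
    finally show "(LINT z|(bern \<Otimes>\<^sub>M unit_uniform). \<phi> (snd ((step ^^ k) z))) = (LINT x|((push ^^ k) unit_uniform). \<phi> x)"
      by simp
  qed
  finally show ?thesis by (simp add: sum_divide_distrib)
qed

end

lemma inverse_Suc_bounded_tendsto_0:
  assumes "\<And>n. \<bar>a n\<bar> \<le> (B :: real)"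
  shows "(\<lambda>n. a n / Suc n) \<longlonglongrightarrow> 0"
proof (rule Lim_null_comparison)
  show "\<forall>\<^sub>F n in sequentially. norm (a n / Suc n) \<le> B * inverse (Suc n)"
    using assms by (auto simp: divide_inverse abs_mult intro!: mult_right_mono)
  show "(\<lambda>n. B * inverse (real (Suc n))) \<longlonglongrightarrow> 0"
    using tendsto_mult[OF tendsto_const LIMSEQ_inverse_real_of_nat, of B] by simp
qed

text \<open>\<open>l i\<close> stands for the logarithm of the absolute derivative of the
  \<open>i\<close>-th map. By the chain rule the sum in \<open>birkhoff_sum_nonpos\<close> is then
  the logarithm of the absolute derivative of an \<open>n\<close>-fold composition, and the
  assumption bounds its Lebesgue mean word by word.\<close>

locale fiber_exponent = fiber_system +
  fixes l :: "nat \<Rightarrow> real \<Rightarrow> real" and B :: real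
  assumes l_cont: "continuous_on UNIV (l i)" and l_bdd: "\<bar>l i x\<bar> \<le> B"
    and birkhoff_sum_nonpos: "(\<And>n. \<omega> n \<in> {0, 1, 2}) \<Longrightarrow>
      (LINT x|unit_uniform. (\<Sum>k<n. l (\<omega> k) (snd ((step ^^ k) (\<omega>, x))))) \<le> 0"
begin

text \<open>Its integral against a stationary measure is the central exponent of the lifted
  measure.\<close>

definition \<psi> :: "real \<Rightarrow> real" where
  "\<psi> x = (l 0 x + l 1 x + l 2 x) / 3"

lemma \<psi>_cont: "continuous_on UNIV \<psi>"
  unfolding \<psi>_def[abs_def] by (intro continuous_intros l_cont) simp

lemma \<psi>_bdd: "\<bar>\<psi> x\<bar> \<le> B"
  unfolding \<psi>_def by (intro abs_average_le l_bdd)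

text \<open>Up to the factor \<open>1 / Suc n\<close> the integral is the expected Birkhoff sum of
  length \<open>Suc n\<close> under Bernoulli times Lebesgue. By Fubini the bound for a fixed word
  applies to almost every sequence, namely to those with symbols in
  \<open>{0, 1, 2}\<close>.\<close>

lemma integral_\<psi>_cesaro: "(LINT x|(cesaro n). \<psi> x) \<le> 0"
proof -
  interpret U: real_distribution unit_uniform by (rule real_distribution_unit_uniform)
  interpret Q: pair_prob_space bern unit_uniform ..
  have lm: "l i \<in> borel_measurable borel" for i
    using l_cont by (rule borel_measurable_continuous_onI)
  have lM: "(\<lambda>z. l (fst z 0) (snd z)) \<in> borel_measurable (bern \<Otimes>\<^sub>M borel)"
    by (rule measurable_compose_countable[where f="\<lambda>i z. l i (snd z)" and g="\<lambda>z. fst z 0"])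
       (use lm in measurable)
  have s: "sets (bern \<Otimes>\<^sub>M unit_uniform) = sets (bern \<Otimes>\<^sub>M borel)"
    by (simp cong: sets_pair_measure_cong)
  let ?L = "\<lambda>k z. l (fst ((step ^^ k) z) 0) (snd ((step ^^ k) z))"
  have Lm: "?L k \<in> borel_measurable (bern \<Otimes>\<^sub>M unit_uniform)" for k
    using measurable_comp[OF step_iter_measurable[of k] lM] s
    by (simp add: o_def cong: measurable_cong_sets)
  have Li: "integrable (bern \<Otimes>\<^sub>M unit_uniform) (?L k)" for k
    by (rule Q.P.integrable_const_bound[where B=B]) (use Lm l_bdd in auto)
  have "(LINT x|((push ^^ k) unit_uniform). \<psi> x) = (LINT z|(bern \<Otimes>\<^sub>M unit_uniform). ?L k z)" for k
  proof -
    have "(LINT x|((push ^^ k) unit_uniform). \<psi> x) = (LINT z|(bern \<Otimes>\<^sub>M (push ^^ k) unit_uniform). l (fst z 0) (snd z))"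
      unfolding \<psi>_def
      by (rule integral_bern_first[symmetric, where B=B])
         (auto intro: l_bdd lm real_distribution_push_iter real_distribution_unit_uniform)
    also have "\<dots> = (LINT z|(bern \<Otimes>\<^sub>M unit_uniform). ?L k z)"
      by (rule integral_step_iter[symmetric, OF real_distribution_unit_uniform lM])
    finally show ?thesis .
  qed
  then have "(\<Sum>k\<le>n. LINT x|((push ^^ k) unit_uniform). \<psi> x)
      = (LINT z|(bern \<Otimes>\<^sub>M unit_uniform). (\<Sum>k<Suc n. ?L k z))"
    using Li by (simp add: lessThan_Suc_atMost)
  also have "\<dots> = (LINT \<omega>|bern. LINT x|unit_uniform. (\<Sum>k<Suc n. ?L k (\<omega>, x)))"
    by (rule Q.integral_fst'[symmetric]) (intro Bochner_Integration.integrable_sum Li)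
  also have "\<dots> \<le> 0"
  proof -
    have "AE \<omega> in bern. (LINT x|unit_uniform. (\<Sum>k<Suc n. ?L k (\<omega>, x))) \<le> 0"
      using AE_bern
    proof eventually_elim
      case (elim \<omega>)
      then show ?case
        using birkhoff_sum_nonpos[of \<omega> "Suc n"] by (simp only: step_iter_fst fst_conv add_0)
    qed
    then have "0 \<le> (LINT \<omega>|bern. - (LINT x|unit_uniform. (\<Sum>k<Suc n. ?L k (\<omega>, x))))"
      by (intro integral_nonneg_AE) auto
    then show ?thesis by simp
  qed
  finally have "(\<Sum>k\<le>n. LINT x|((push ^^ k) unit_uniform). \<psi> x) \<le> 0" .
  moreover have "(LINT x|(cesaro n). \<psi> x) = (\<Sum>k\<le>n. LINT x|((push ^^ k) unit_uniform). \<psi> x) / Suc n"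
    by (rule integral_cesaro[OF borel_measurable_continuous_onI[OF \<psi>_cont] \<psi>_bdd])
  ultimately show ?thesis
    by (simp add: divide_nonpos_pos)
qed

text \<open>The Krylov-Bogolyubov argument: averaging \<open>\<phi>\<close> over the maps shifts the
  time by one, so the difference of the two sums telescopes to two bounded boundary terms.\<close>

lemma integral_cesaro_average:
  assumes "continuous_on UNIV \<phi>" "\<And>x. \<bar>\<phi> x\<bar> \<le> (1 :: real)"
  shows "(\<lambda>n. (LINT x|(cesaro n). (\<phi> (g 0 x) + \<phi> (g 1 x) + \<phi> (g 2 x)) / 3)
      - (LINT x|(cesaro n). \<phi> x)) \<longlonglongrightarrow> 0"
proof -
  define a where "a k = (LINT x|((push ^^ k) unit_uniform). \<phi> x)" for k
  let ?A = "\<lambda>x. (\<phi> (g 0 x) + \<phi> (g 1 x) + \<phi> (g 2 x)) / 3"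
  have bA: "\<bar>?A x\<bar> \<le> 1" for x
    by (intro abs_average_le assms(2))
  note m = borel_measurable_continuous_onI[OF assms(1)]
  note mA = borel_measurable_continuous_onI[OF continuous_on_average[OF assms(1)]]
  have "(LINT x|((push ^^ k) unit_uniform). ?A x) = a (Suc k)" for k
    unfolding a_def
    using integral_push[OF real_distribution_push_iter[OF real_distribution_unit_uniform] m assms(2)]
    by simp
  moreover have tel: "(\<Sum>k\<le>n. a (Suc k)) - (\<Sum>k\<le>n. a k) = a (Suc n) - a 0" for n
    by (induction n) auto
  ultimately have eq: "(LINT x|(cesaro n). ?A x) - (LINT x|(cesaro n). \<phi> x) = (a (Suc n) - a 0) / Suc n" for n
    unfolding integral_cesaro[OF mA bA] integral_cesaro[OF m assms(2)] a_def[symmetric]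
    by (simp add: diff_divide_distrib[symmetric] tel)
  have "\<bar>a k\<bar> \<le> 1" for k
  proof -
    interpret p: real_distribution "(push ^^ k) unit_uniform"
      by (rule real_distribution_push_iter[OF real_distribution_unit_uniform])
    show ?thesis unfolding a_def by (rule p.abs_integral_le) (use m assms(2) in auto)
  qed
  then have "\<bar>a (Suc n) - a 0\<bar> \<le> 2" for n
    using abs_triangle_ineq4[of "a (Suc n)" "a 0"] \<open>\<And>k. \<bar>a k\<bar> \<le> 1\<close>[of "Suc n"] \<open>\<And>k. \<bar>a k\<bar> \<le> 1\<close>[of 0] by linarith
  then show ?thesis
    unfolding eq by (rule inverse_Suc_bounded_tendsto_0)
qed

lemma cesaro_support: "measure (cesaro n) {0..1} = 1"
proof -
  interpret C: real_distribution "cesaro n" by (rule real_distribution_cesaro)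
  have m: "measure ((push ^^ k) unit_uniform) {0..1} = 1" for k
    by (cases k) (simp_all add: push_support real_distribution_push_iter real_distribution_unit_uniform)
  have i: "(LINT x|((push ^^ k) unit_uniform). indicator {0..1} x :: real) = 1" for k
  proof -
    interpret p: real_distribution "(push ^^ k) unit_uniform"
      by (rule real_distribution_push_iter[OF real_distribution_unit_uniform])
    show ?thesis using m[of k] by simp
  qed
  have "(LINT x|(cesaro n). indicator {0..1} x :: real) = 1"
    by (subst integral_cesaro[where B=1]; (simp only: i)?) (auto simp: indicator_def)
  then show ?thesis by simp
qed

text \<open>Any weak limit point of the Cesaro means serves; the sign of the exponent survives
  because \<open>\<psi>\<close> is bounded and continuous.\<close>

lemma ex_stationary_nonpos: "\<exists>\<nu>. stationary \<nu> \<and> (LINT x|\<nu>. \<psi> x) \<le> 0"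
proof -
  have "tight cesaro"
    by (rule tight_unit_interval) (auto simp: real_distribution_cesaro cesaro_support)
  then obtain r M where r: "strict_mono r" "real_distribution M" "weak_conv_m (cesaro \<circ> id \<circ> r) M"
    using tight_imp_convergent_subsubsequence[of cesaro id] by (auto simp: strict_mono_id)
  have w: "weak_conv_m (\<lambda>n. cesaro (r n)) M" using r(3) by (simp add: o_def)
  have conv: "(\<lambda>n. LINT x|(cesaro (r n)). \<phi> x) \<longlonglongrightarrow> (LINT x|M. \<phi> x)"
    if "continuous_on UNIV \<phi>" "\<And>x. \<bar>\<phi> x\<bar> \<le> C" for \<phi> :: "real \<Rightarrow> real" and C
    by (rule weak_conv_integral[OF real_distribution_cesaro r(2) w that])
  have "stationary M"
  proof (rule stationaryI[OF r(2)])
    fix \<phi> :: "real \<Rightarrow> real" assume c: "continuous_on UNIV \<phi>" and b: "\<And>x. \<bar>\<phi> x\<bar> \<le> 1"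
    let ?A = "\<lambda>x. (\<phi> (g 0 x) + \<phi> (g 1 x) + \<phi> (g 2 x)) / 3"
    have bA: "\<bar>?A x\<bar> \<le> 1" for x
      by (intro abs_average_le b)
    have "(\<lambda>n. (LINT x|(cesaro (r n)). ?A x) - (LINT x|(cesaro (r n)). \<phi> x)) \<longlonglongrightarrow> 0"
      using LIMSEQ_subseq_LIMSEQ[OF integral_cesaro_average[OF c b] r(1)] by (simp add: o_def)
    moreover have "(\<lambda>n. (LINT x|(cesaro (r n)). ?A x) - (LINT x|(cesaro (r n)). \<phi> x))
        \<longlonglongrightarrow> (LINT x|M. ?A x) - (LINT x|M. \<phi> x)"
      by (rule tendsto_diff[OF conv[OF continuous_on_average[OF c] bA] conv[OF c b]])
    ultimately have "(LINT x|M. ?A x) - (LINT x|M. \<phi> x) = 0"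
      by (rule LIMSEQ_unique[symmetric])
    then show "(LINT x|M. ?A x) = (LINT x|M. \<phi> x)" by simp
  qed
  moreover have "(LINT x|M. \<psi> x) \<le> 0"
    by (rule LIMSEQ_le_const2[OF conv[OF \<psi>_cont \<psi>_bdd]]) (simp add: integral_\<psi>_cesaro)
  ultimately show ?thesis by blast
qed

lemma integral_mixture:
  assumes "real_distribution M" "real_distribution N1" "real_distribution N2" "0 < a" "a < 1"
    and mix: "\<And>U. U \<in> sets borel \<Longrightarrow> measure M U = a * measure N1 U + (1 - a) * measure N2 U"
    and \<phi>[measurable]: "\<phi> \<in> borel_measurable borel" and b: "\<And>x. \<bar>\<phi> x\<bar> \<le> C"
  shows "(LINT x|M. \<phi> x :: real) = a * (LINT x|N1. \<phi> x) + (1 - a) * (LINT x|N2. \<phi> x)"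
proof -
  interpret M: real_distribution M by fact
  interpret N1: real_distribution N1 by fact
  interpret N2: real_distribution N2 by fact
  have nn: "(\<integral>\<^sup>+x. f x \<partial>M) = ennreal a * (\<integral>\<^sup>+x. f x \<partial>N1) + ennreal (1 - a) * (\<integral>\<^sup>+x. f x \<partial>N2)"
    if "f \<in> borel_measurable borel" for f
    using that
  proof (induction f rule: borel_measurable_induct)
    case (cong f h)
    then have "f = h" by (auto intro!: ext)
    with cong show ?case by simp
  next
    case (set U)
    then show ?case
      using assms(4,5)
      by (simp add: M.emeasure_eq_measure N1.emeasure_eq_measure N2.emeasure_eq_measure mix
          ennreal_mult ennreal_plus)
  next
    case (mult u c)
    then show ?case by (simp add: nn_integral_cmult distrib_left mult.left_commute)
  next
    case (add u v)
    then show ?case by (simp add: nn_integral_add distrib_left ac_simps)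
  next
    case (seq U)
    have "(SUP i. (\<integral>\<^sup>+x. U i x \<partial>M)) = (SUP i. ennreal a * (\<integral>\<^sup>+x. U i x \<partial>N1) + ennreal (1 - a) * (\<integral>\<^sup>+x. U i x \<partial>N2))"
      using seq by simp
    also have "\<dots> = (SUP i. ennreal a * (\<integral>\<^sup>+x. U i x \<partial>N1)) + (SUP i. ennreal (1 - a) * (\<integral>\<^sup>+x. U i x \<partial>N2))"
      using \<open>incseq U\<close> by (intro ennreal_SUP_add) (auto simp: incseq_def le_fun_def intro!: mult_left_mono nn_integral_mono)
    finally show ?case
      using seq by (simp add: SUP_mult_left_ennreal nn_integral_monotone_convergence_SUP SUP_apply[abs_def])
  qed
  have C0: "0 \<le> C" using b[of 0] by linarith
  \<comment> \<open>Adding \<open>C\<close> makes the integrand nonnegative, so the mixture identity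
    for nonnegative integrals applies; the constant cancels at the end because the weights add up to
    1.\<close>
  have nnC: "0 \<le> \<phi> x + C" for x using b[of x] by linarith
  have ie: "integrable N \<phi>" if "real_distribution N" for N
  proof -
    interpret N: real_distribution N by fact
    show ?thesis by (rule N.integrable_const_bound[where B=C]) (use b in auto)
  qed
  have eq: "ennreal (LINT x|N. \<phi> x + C) = (\<integral>\<^sup>+x. ennreal (\<phi> x + C) \<partial>N)" "(LINT x|N. \<phi> x + C) = (LINT x|N. \<phi> x) + C"
    "0 \<le> (LINT x|N. \<phi> x + C)"
    if "real_distribution N" for N
  proof -
    interpret N: real_distribution N by fact
    show "ennreal (LINT x|N. \<phi> x + C) = (\<integral>\<^sup>+x. ennreal (\<phi> x + C) \<partial>N)"
      by (rule nn_integral_eq_integral[symmetric]) (use ie[OF that] nnC in auto)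
    show "(LINT x|N. \<phi> x + C) = (LINT x|N. \<phi> x) + C"
      using ie[OF that] N.prob_space by simp
    show "0 \<le> (LINT x|N. \<phi> x + C)" using nnC by (intro integral_nonneg_AE) auto
  qed
  have "ennreal (LINT x|M. \<phi> x + C) = ennreal (a * (LINT x|N1. \<phi> x + C) + (1 - a) * (LINT x|N2. \<phi> x + C))"
    unfolding eq(1)[OF assms(1)]
    using assms(4,5) eq(1,3)[OF assms(2)] eq(1,3)[OF assms(3)]
    by (subst nn) (auto simp: ennreal_mult ennreal_plus)
  then have "(LINT x|M. \<phi> x + C) = a * (LINT x|N1. \<phi> x + C) + (1 - a) * (LINT x|N2. \<phi> x + C)"
    using assms(4,5) eq(3)[OF assms(1)] eq(3)[OF assms(2)] eq(3)[OF assms(3)]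
    by (subst (asm) ennreal_inj) auto
  then show ?thesis
    unfolding eq(2)[OF assms(1)] eq(2)[OF assms(2)] eq(2)[OF assms(3)] by (simp add: algebra_simps)
qed

text \<open>If the chosen \<open>M\<close> is a mixture of \<open>N1\<close> and \<open>N2\<close>,
  the excesses of \<open>J\<close> over its minimum are nonnegative and their weighted sum is zero,
  so both components are minimizers of \<open>J\<close> and compete with \<open>M\<close> for the
  maximum of \<open>Q\<close>; strict convexity of \<open>Q\<close> then makes them equal. The
  minimum of \<open>J\<close> is at most 0 since some stationary measure has nonpositive
  exponent.\<close>

lemma ex_extremal_stationary_nonpos:
  "\<exists>\<nu>. stationary \<nu> \<and> extremal \<nu> \<and> (LINT x|\<nu>. \<psi> x) \<le> 0"
proof -
  define J where "J \<nu> = (LINT x|\<nu>. \<psi> x)" for \<nu>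
  define Q where "Q \<nu> = (LINT x:{0..1}|lborel. (cdf \<nu> x)\<^sup>2)" for \<nu>
  have rd: "real_distribution \<nu>" if "stationary \<nu>" for \<nu>
    using that by (simp add: stationary_def)
  have J_cont: "(\<lambda>n. J (\<mu> n)) \<longlonglongrightarrow> J M"
    if "\<And>n. stationary (\<mu> n)" "stationary M" "weak_conv_m \<mu> M" for \<mu> M
    unfolding J_def by (rule weak_conv_integral[OF rd rd _ \<psi>_cont \<psi>_bdd]) (use that in auto)
  have J_bdd: "- B \<le> J M" if "stationary M" for M
  proof -
    interpret M: real_distribution M using that by (rule rd)
    have "\<bar>J M\<bar> \<le> B"
      unfolding J_def
      by (rule M.abs_integral_le) (use \<psi>_bdd borel_measurable_continuous_onI[OF \<psi>_cont] in auto)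
    then show ?thesis by simp
  qed
  have "\<exists>M\<in>Collect stationary. \<forall>N\<in>Collect stationary. J M \<le> J N"
  proof (rule weak_compact_attains_min)
    show "Collect stationary \<noteq> {}" using ex_stationary_nonpos by auto
    show "\<exists>r M. strict_mono (r :: nat \<Rightarrow> nat) \<and> M \<in> Collect stationary \<and> weak_conv_m (\<mu> \<circ> r) M"
      if "\<And>n. \<mu> n \<in> Collect stationary" for \<mu>
      using stationary_compact[of \<mu>] that by simp
    show "(\<lambda>n. J (\<mu> n)) \<longlonglongrightarrow> J M"
      if "\<And>n. \<mu> n \<in> Collect stationary" "M \<in> Collect stationary" "weak_conv_m \<mu> M" for \<mu> M
      using J_cont that by simp
    show "- B \<le> J M" if "M \<in> Collect stationary" for M using J_bdd that by simp
  qed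
  then obtain M0 where M0: "stationary M0" "\<And>N. stationary N \<Longrightarrow> J M0 \<le> J N" by auto
  define S where "S = {\<nu>. stationary \<nu> \<and> J \<nu> = J M0}"
  have "\<exists>M\<in>S. \<forall>N\<in>S. - Q M \<le> - Q N"
  proof (rule weak_compact_attains_min)
    show "S \<noteq> {}" using M0 by (auto simp: S_def)
    show "\<exists>r M. strict_mono (r :: nat \<Rightarrow> nat) \<and> M \<in> S \<and> weak_conv_m (\<mu> \<circ> r) M" if "\<And>n. \<mu> n \<in> S" for \<mu>
    proof -
      have st: "stationary (\<mu> n)" and ch: "J (\<mu> n) = J M0" for n using that[of n] by (auto simp: S_def)
      obtain r M where r: "strict_mono (r :: nat \<Rightarrow> nat)" "stationary M" "weak_conv_m (\<mu> \<circ> r) M"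
        using stationary_compact[of \<mu>] st by auto
      have "(\<lambda>n. J ((\<mu> \<circ> r) n)) \<longlonglongrightarrow> J M" by (rule J_cont[OF _ r(2,3)]) (simp add: st)
      then have "J M = J M0" by (simp add: ch LIMSEQ_const_iff)
      then show ?thesis using r by (auto simp: S_def)
    qed
    show "(\<lambda>n. - Q (\<mu> n)) \<longlonglongrightarrow> - Q M" if "\<And>n. \<mu> n \<in> S" "M \<in> S" "weak_conv_m \<mu> M" for \<mu> M
      unfolding Q_def
      by (intro tendsto_minus cdf_square_integral_tendsto) (use that rd in \<open>auto simp: S_def\<close>)
    show "-1 \<le> - Q M" if "M \<in> S" for M
    proof -
      interpret M: real_distribution M using that by (auto simp: S_def intro: rd)
      have "Q M \<le> (LINT x|lborel. indicator {0..1::real} x)"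
        unfolding Q_def set_lebesgue_integral_def
      proof (rule integral_mono')
        show "integrable lborel (indicator {0..1::real} :: real \<Rightarrow> real)" by simp
      qed (auto simp: indicator_def power_le_one M.cdf_nonneg M.cdf_bounded_prob)
      then show ?thesis by simp
    qed
  qed
  then obtain M where M: "stationary M" "J M = J M0" "\<And>N. stationary N \<Longrightarrow> J N = J M0 \<Longrightarrow> Q N \<le> Q M"
    by (auto simp: S_def)
  have "extremal M"
    unfolding extremal_def
  proof (intro allI impI)
    fix N1 N2 a
    assume N: "stationary N1" "stationary N2" and a: "0 < a" "a < 1"
      and mix: "\<forall>U\<in>sets borel. measure M U = a * measure N1 U + (1 - a) * measure N2 U"
    have "J M = a * J N1 + (1 - a) * J N2"
      unfolding J_def
      by (rule integral_mixture[OF rd[OF M(1)] rd[OF N(1)] rd[OF N(2)] a _ borel_measurable_continuous_onI[OF \<psi>_cont] \<psi>_bdd])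
         (use mix in auto)
    then have "a * (J N1 - J M0) + (1 - a) * (J N2 - J M0) = 0"
      using M(2) by (simp add: algebra_simps)
    moreover have "0 \<le> a * (J N1 - J M0)" "0 \<le> (1 - a) * (J N2 - J M0)"
      using a M0(2)[OF N(1)] M0(2)[OF N(2)] by auto
    ultimately have "a * (J N1 - J M0) = 0" "(1 - a) * (J N2 - J M0) = 0" by linarith+
    then have "J N1 = J M0" "J N2 = J M0" using a by auto
    then have "Q N1 \<le> Q M" "Q N2 \<le> Q M" using M(3) N by auto
    then show "N1 = N2"
      using cdf_square_integral_convex[OF rd[OF M(1)] rd[OF N(1)] rd[OF N(2)]
          stationary_support[OF N(1)] stationary_support[OF N(2)] a] mix
      by (auto simp: Q_def)
  qed
  moreover have "J M \<le> 0"
    using ex_stationary_nonpos M0(2) M(2) unfolding J_def by force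
  ultimately show ?thesis using M(1) unfolding J_def by blast
qed

end

section \<open>The natural extension\<close>

text \<open>A Polish state space lets consistent finite-dimensional marginals be extended to a
  measure on bi-infinite sequences.\<close>

locale measure_preserving_polish = prob_space M
  for M :: "'a :: polish_space measure" +
  fixes T :: "'a \<Rightarrow> 'a"
  assumes sets_M: "sets M = sets borel" and T_measurable: "T \<in> borel \<rightarrow>\<^sub>M borel"
    and T_invariant: "distr M borel T = M"
begin

lemma iter_measurable [measurable]: "T ^^ k \<in> borel \<rightarrow>\<^sub>M borel"
proof (induction k)
  case 0
  show ?case by (simp add: id_def)
next
  case (Suc k)
  show ?case unfolding funpow.simps by (rule measurable_comp[OF Suc T_measurable])
qed

lemma iter_invariant: "distr M borel (T ^^ k) = M"
proof (induction k)
  case 0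
  show ?case using sets_M by (simp add: id_def distr_id2)
next
  case (Suc k)
  have "distr M borel (T ^^ Suc k) = distr (distr M borel (T ^^ k)) borel T"
    using iter_measurable[of k] sets_M T_measurable
    by (subst distr_distr) (auto cong: measurable_cong_sets)
  then show ?case by (simp only: Suc T_invariant)
qed

text \<open>The point \<open>z\<close> is placed at time \<open>N\<close> and its orbit observed at
  the times in \<open>J\<close>. Times before \<open>N\<close> are collapsed to \<open>N\<close> by
  \<open>nat\<close>, so the observation is meaningful only if \<open>N\<close> is a lower bound of
  \<open>J\<close>.\<close>

definition orbit :: "int \<Rightarrow> int set \<Rightarrow> 'a \<Rightarrow> int \<Rightarrow> 'a" where
  "orbit N J z = (\<lambda>j\<in>J. (T ^^ nat (j - N)) z)"

lemma orbit_measurable: "orbit N J \<in> M \<rightarrow>\<^sub>M (\<Pi>\<^sub>M j\<in>J. borel)"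
  unfolding orbit_def[abs_def] using sets_M
  by (intro measurable_restrict) (auto cong: measurable_cong_sets)

lemma orbit_measurable' [measurable]: "orbit N J \<in> borel \<rightarrow>\<^sub>M (\<Pi>\<^sub>M j\<in>J. borel)"
  unfolding orbit_def[abs_def] by (intro measurable_restrict) measurable

text \<open>Starting earlier amounts to replacing \<open>z\<close> by one of its forward iterates,
  which has the same law \<open>M\<close>.\<close>

lemma distr_orbit_eq:
  assumes "N \<le> N'" "\<And>j. j \<in> J \<Longrightarrow> N' \<le> j"
  shows "distr M (\<Pi>\<^sub>M j\<in>J. borel) (orbit N J) = distr M (\<Pi>\<^sub>M j\<in>J. borel) (orbit N' J)"
proof -
  have "orbit N J = orbit N' J \<circ> (T ^^ nat (N' - N))"
  proof (intro ext)
    fix z j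
    have "j \<in> J \<Longrightarrow> nat (j - N) = nat (j - N') + nat (N' - N)"
      using assms(1) assms(2)[of j] by auto
    then show "orbit N J z j = (orbit N' J \<circ> (T ^^ nat (N' - N))) z j"
      by (simp add: orbit_def funpow_add)
  qed
  then have "distr M (\<Pi>\<^sub>M j\<in>J. borel) (orbit N J)
      = distr (distr M borel (T ^^ nat (N' - N))) (\<Pi>\<^sub>M j\<in>J. borel) (orbit N' J)"
    using sets_M by (subst distr_distr) (auto cong: measurable_cong_sets)
  then show ?thesis by (simp add: iter_invariant)
qed

text \<open>The latest start from which all times in \<open>J\<close> can be observed; for empty
  \<open>J\<close> the observation is the same from every start.\<close>

definition base :: "int set \<Rightarrow> int" where
  "base J = (if J = {} then 0 else Min J)"

lemma base_le: "finite J \<Longrightarrow> j \<in> J \<Longrightarrow> base J \<le> j"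
  by (auto simp: base_def)

definition marginal :: "int set \<Rightarrow> (int \<Rightarrow> 'a) measure" where
  "marginal J = distr M (\<Pi>\<^sub>M j\<in>J. borel) (orbit (base J) J)"

lemma marginal_eq:
  assumes J: "finite J" and N: "\<And>j. j \<in> J \<Longrightarrow> N \<le> j"
  shows "marginal J = distr M (\<Pi>\<^sub>M j\<in>J. borel) (orbit N J)"
proof (cases "J = {}")
  case True
  then have "orbit (base J) J = orbit N J" by (simp add: orbit_def fun_eq_iff)
  then show ?thesis by (simp add: marginal_def)
next
  case False
  then have "N \<le> base J" using N J by (simp add: base_def)
  then show ?thesis
    unfolding marginal_def by (rule distr_orbit_eq[symmetric]) (rule base_le[OF J])
qed

text \<open>Consistency holds because both marginals may be computed with the start of the larger
  index set, where one is literally the restriction of the other.\<close>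

sublocale limit: polish_projective UNIV marginal
proof (intro polish_projective.intro projective_family.intro)
  fix J H :: "int set" assume JH: "J \<subseteq> H" and H: "finite H"
  then have J: "finite J" by (rule finite_subset)
  have "marginal J = distr M (\<Pi>\<^sub>M j\<in>J. borel) (orbit (base H) J)"
    by (rule marginal_eq[OF J]) (use base_le[OF H] JH in auto)
  also have "orbit (base H) J = (\<lambda>f. restrict f J) \<circ> orbit (base H) H"
    using JH by (auto simp: orbit_def fun_eq_iff)
  also have "distr M (\<Pi>\<^sub>M j\<in>J. borel) \<dots> = distr (marginal H) (\<Pi>\<^sub>M j\<in>J. borel) (\<lambda>f. restrict f J)"
    unfolding marginal_def
    by (subst distr_distr) (auto intro: orbit_measurable measurable_restrict_subset[OF JH])
  finally show "marginal J = distr (marginal H) (\<Pi>\<^sub>M j\<in>J. borel) (\<lambda>f. restrict f J)" .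
next
  fix J :: "int set" assume "finite J"
  show "prob_space (marginal J)"
    unfolding marginal_def by (rule prob_space_distr[OF orbit_measurable])
qed

abbreviation natext :: "(int \<Rightarrow> 'a) measure" where "natext \<equiv> limit.lim"

lemma sets_natext [simp, measurable_cong]: "sets natext = sets (\<Pi>\<^sub>M j\<in>UNIV. borel)"
  by (rule limit.sets_lim)

lemma space_natext [simp]: "space natext = UNIV"
  by (simp add: limit.space_lim space_PiM)

lemma emeasure_natext:
  assumes J: "finite J" and N: "\<And>j. j \<in> J \<Longrightarrow> N \<le> j" and X: "X \<in> sets (\<Pi>\<^sub>M j\<in>J. borel)"
  shows "emeasure natext {y. restrict y J \<in> X} = emeasure M {z. orbit N J z \<in> X}"
proof -
  have "{y. restrict y J \<in> X} = prod_emb UNIV (\<lambda>_. borel) J X"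
    by (auto simp: prod_emb_def)
  moreover have "emeasure natext (prod_emb UNIV (\<lambda>_. borel) J X) = emeasure (marginal J) X"
    by (rule limit.emeasure_lim_emb) (use J X in auto)
  moreover have "emeasure (marginal J) X = emeasure M {z. orbit N J z \<in> X}"
    using sets_eq_imp_space_eq[OF sets_M] X
    by (subst marginal_eq[OF J N]) (auto simp: emeasure_distr[OF orbit_measurable X] intro!: arg_cong[where f="emeasure M"])
  ultimately show ?thesis by simp
qed

lemma natext_component: "distr natext borel (\<lambda>y. y n) = M"
proof (rule measure_eqI)
  show "sets (distr natext borel (\<lambda>y. y n)) = sets M" by (simp add: sets_M)
  fix A assume "A \<in> sets (distr natext borel (\<lambda>y. y n))"
  then have A[measurable]: "A \<in> sets borel" by simp
  have "emeasure (distr natext borel (\<lambda>y. y n)) A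
      = emeasure natext {y. restrict y {n} \<in> {f \<in> space (\<Pi>\<^sub>M j\<in>{n}. borel). f n \<in> A}}"
    by (subst emeasure_distr) (auto simp: space_PiM intro!: arg_cong[where f="emeasure natext"])
  also have "\<dots> = emeasure M {z. orbit n {n} z \<in> {f \<in> space (\<Pi>\<^sub>M j\<in>{n}. borel). f n \<in> A}}"
    by (rule emeasure_natext) measurable
  also have "{z. orbit n {n} z \<in> {f \<in> space (\<Pi>\<^sub>M j\<in>{n}. borel). f n \<in> A}} = A"
    by (auto simp: orbit_def space_PiM)
  finally show "emeasure (distr natext borel (\<lambda>y. y n)) A = emeasure M A" .
qed

text \<open>Only the times \<open>n\<close> and \<open>n + 1\<close> are involved, and started at
  \<open>n\<close> the relation holds at every point of \<open>M\<close>. The event is measurable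
  because the diagonal is closed.\<close>

lemma natext_AE_orbit: "AE y in natext. y (n + 1) = T (y n)"
proof -
  note [measurable] = T_measurable
  let ?J = "{n, n + 1}"
  let ?X = "{f \<in> space (\<Pi>\<^sub>M j\<in>?J. borel). f (n + 1) = T (f n)}"
  have "(\<lambda>f. (f (n + 1), T (f n))) -` {z. fst z = snd z} \<inter> space (\<Pi>\<^sub>M j\<in>?J. borel) \<in> sets (\<Pi>\<^sub>M j\<in>?J. borel)"
  proof (rule measurable_sets[where A=borel])
    show "(\<lambda>f. (f (n + 1), T (f n))) \<in> (\<Pi>\<^sub>M j\<in>?J. borel) \<rightarrow>\<^sub>M borel"
      unfolding borel_prod[symmetric] by measurable
    have "closed {z :: 'a \<times> 'a. fst z = snd z}"
      by (intro closed_Collect_eq continuous_intros)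
    then show "{z :: 'a \<times> 'a. fst z = snd z} \<in> sets borel" by simp
  qed
  then have X: "?X \<in> sets (\<Pi>\<^sub>M j\<in>?J. borel)"
    by (rule back_subst[where P="\<lambda>S. S \<in> _"]) auto
  have "emeasure natext {y. restrict y ?J \<in> ?X} = emeasure M {z. orbit n ?J z \<in> ?X}"
    by (rule emeasure_natext) (use X in auto)
  also have "{z. orbit n ?J z \<in> ?X} = space M"
    using sets_eq_imp_space_eq[OF sets_M] by (auto simp: orbit_def space_PiM)
  finally have 1: "emeasure natext {y. restrict y ?J \<in> ?X} = 1"
    unfolding emeasure_space_1 .
  have eq: "{y. restrict y ?J \<in> ?X} = {y. y (n + 1) = T (y n)}"
    by (auto simp: space_PiM)
  have "{y \<in> space natext. y (n + 1) = T (y n)}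
      = (\<lambda>y. restrict y ?J) -` ?X \<inter> space (\<Pi>\<^sub>M j\<in>UNIV. borel)"
    by (auto simp: space_PiM)
  also have "\<dots> \<in> sets (\<Pi>\<^sub>M j\<in>UNIV. borel)"
    by (rule measurable_sets[OF measurable_restrict_subset X]) simp
  finally have "{y \<in> space natext. y (n + 1) = T (y n)} \<in> sets natext"
    by (simp only: sets_natext)
  then have "AE y in natext. y \<in> {y \<in> space natext. y (n + 1) = T (y n)}"
    using 1[unfolded eq] by (subst limit.P.AE_in_set_eq_1) (simp_all add: measure_def space_PiM)
  then show ?thesis by simp
qed

text \<open>It suffices to compare boxes over finite \<open>J\<close>. The shifted event is a box
  over \<open>J + 1\<close>, and moving the start by one as well gives the same event under
  \<open>M\<close>.\<close>

lemma natext_shift: "distr natext natext (\<lambda>y n. y (n + 1)) = natext"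
proof (rule measure_eqI_PiM_infinite[symmetric, where I=UNIV and M="\<lambda>_. borel"])
  have m: "(\<lambda>y n. y (n + 1)) \<in> natext \<rightarrow>\<^sub>M natext"
    by (simp cong: measurable_cong_sets) (intro measurable_PiM_single' ; simp)
  show "finite_measure natext" by unfold_locales
  show "sets natext = sets (\<Pi>\<^sub>M j\<in>UNIV. borel)" by simp
  then show "sets (distr natext natext (\<lambda>y n. y (n + 1))) = sets (\<Pi>\<^sub>M j\<in>UNIV. borel)" by simp
  fix A :: "int \<Rightarrow> 'a set" and J :: "int set"
  assume J: "finite J" and A: "\<And>i. i \<in> J \<Longrightarrow> A i \<in> sets borel"
  let ?K = "(\<lambda>j. j + 1) ` J"
  have emb: "prod_emb UNIV (\<lambda>_. borel) J (Pi\<^sub>E J A) = {y. restrict y J \<in> Pi\<^sub>E J A}"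
    by (auto simp: prod_emb_def)
  have X: "Pi\<^sub>E J A \<in> sets (\<Pi>\<^sub>M j\<in>J. borel)"
    using J A by (intro sets_PiM_I_finite) auto
  have X': "Pi\<^sub>E ?K (\<lambda>j. A (j - 1)) \<in> sets (\<Pi>\<^sub>M j\<in>?K. borel)"
    using J A by (intro sets_PiM_I_finite) auto
  have "emeasure (distr natext natext (\<lambda>y n. y (n + 1))) {y. restrict y J \<in> Pi\<^sub>E J A}
      = emeasure natext {y. restrict y ?K \<in> Pi\<^sub>E ?K (\<lambda>j. A (j - 1))}"
  proof (subst emeasure_distr[OF m])
    show "{y. restrict y J \<in> Pi\<^sub>E J A} \<in> sets natext"
      unfolding emb[symmetric] using J X by (simp add: measurable_prod_emb)
  qed (auto simp: PiE_iff extensional_def restrict_def space_PiM intro!: arg_cong[where f="emeasure natext"])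
  also have "\<dots> = emeasure M {z. orbit (base J + 1) ?K z \<in> Pi\<^sub>E ?K (\<lambda>j. A (j - 1))}"
    by (rule emeasure_natext[OF _ _ X']) (use J base_le[OF J] in auto)
  also have "{z. orbit (base J + 1) ?K z \<in> Pi\<^sub>E ?K (\<lambda>j. A (j - 1))} = {z. orbit (base J) J z \<in> Pi\<^sub>E J A}"
    by (auto simp: orbit_def PiE_iff extensional_def)
  also have "emeasure M \<dots> = emeasure natext {y. restrict y J \<in> Pi\<^sub>E J A}"
    by (rule emeasure_natext[symmetric, OF J _ X]) (rule base_le[OF J])
  finally show "emeasure natext (prod_emb UNIV (\<lambda>_. borel) J (Pi\<^sub>E J A))
      = emeasure (distr natext natext (\<lambda>y n. y (n + 1))) (prod_emb UNIV (\<lambda>_. borel) J (Pi\<^sub>E J A))"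
    unfolding emb ..
qed

end

text \<open>States are separated by countably many real-valued coordinates, so their diagonal is
  measurable. This is needed for the event that a sequence of states is an orbit.\<close>

lemma sets_Collect_eq_bern_real:
  assumes f [measurable]: "f \<in> N \<rightarrow>\<^sub>M bern \<Otimes>\<^sub>M (borel :: real measure)"
    and h [measurable]: "h \<in> N \<rightarrow>\<^sub>M bern \<Otimes>\<^sub>M borel"
  shows "{y \<in> space N. f y = h y} \<in> sets N"
proof -
  have "{y \<in> space N. f y = h y} = {y \<in> space N. (\<forall>k. real (fst (f y) k) = real (fst (h y) k)) \<and> snd (f y) = snd (h y)}"
    by (auto simp: prod_eq_iff)
  also have "\<dots> \<in> sets N"
  proof (intro sets.sets_Collect_conj sets.sets_Collect_countable_All borel_measurable_eq)
    have 1: "(\<lambda>\<omega>. real (\<omega> k)) \<in> borel_measurable bern" for k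
      by (rule measurable_compose[OF measurable_bern_component]) simp
    show "(\<lambda>y. real (fst (f y) k)) \<in> borel_measurable N" "(\<lambda>y. real (fst (h y) k)) \<in> borel_measurable N" for k
      by (rule measurable_compose[OF measurable_compose[OF f measurable_fst] 1],
          rule measurable_compose[OF measurable_compose[OF h measurable_fst] 1])
    show "(\<lambda>y. snd (f y)) \<in> borel_measurable N" "(\<lambda>y. snd (h y)) \<in> borel_measurable N"
      by (rule measurable_compose[OF f measurable_snd], rule measurable_compose[OF h measurable_snd])
  qed
  finally show ?thesis .
qed

section \<open>The natural extension of the one-sided skew product\<close>

context fiber_system
begin

text \<open>The extension is built for the conjugate map \<open>e \<circ> step \<circ> d\<close> on
  encoded states and decoded coordinate by coordinate; all five properties are transported along
  \<open>D\<close>.\<close>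

lemma ex_natural_extension:
  assumes "stationary \<nu>"
  obtains L :: "(int \<Rightarrow> (nat \<Rightarrow> nat) \<times> real) measure"
  where "prob_space L" "sets L = sets (\<Pi>\<^sub>M j\<in>UNIV. bern \<Otimes>\<^sub>M borel)"
    "\<And>n. distr L (bern \<Otimes>\<^sub>M borel) (\<lambda>y. y n) = bern \<Otimes>\<^sub>M \<nu>"
    "\<And>n. AE y in L. y (n + 1) = step (y n)"
    "distr L L (\<lambda>y n. y (n + 1)) = L"
proof -
  interpret \<nu>: real_distribution \<nu> using assms by (simp add: stationary_def)
  interpret pair_prob_space bern \<nu> ..
  \<comment> \<open>\<^typ>\<open>nat\<close> is not an instance of \<^class>\<open>polish_space\<close>, so states are encoded as real sequences.\<close>
  define e :: "(nat \<Rightarrow> nat) \<times> real \<Rightarrow> nat \<Rightarrow> real" where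
    "e z = case_nat (snd z) (\<lambda>n. real (fst z n))" for z
  \<comment> \<open>\<open>d\<close> has to be a measurable left inverse of \<open>e\<close>; the
    floor makes it total on real sequences.\<close>
  define d :: "(nat \<Rightarrow> real) \<Rightarrow> (nat \<Rightarrow> nat) \<times> real" where
    "d h = ((\<lambda>n. nat \<lfloor>h (Suc n)\<rfloor>), h 0)" for h
  have de: "d (e z) = z" for z by (simp add: e_def d_def)
  have s: "sets (bern \<Otimes>\<^sub>M \<nu>) = sets (bern \<Otimes>\<^sub>M borel)"
    by (simp cong: sets_pair_measure_cong)
  have e_m [measurable]: "e \<in> bern \<Otimes>\<^sub>M borel \<rightarrow>\<^sub>M borel"
    unfolding e_def[abs_def] measurable_cong_sets[OF refl sets_PiM_equal_borel[symmetric]]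
  proof (rule measurable_PiM_single')
    show "(\<lambda>z. case_nat (snd z) (\<lambda>n. real (fst z n)) i) \<in> borel_measurable (bern \<Otimes>\<^sub>M borel)" for i
      by (cases i) simp_all
  qed (auto simp: space_PiM)
  have c: "(\<lambda>h. h n) \<in> borel_measurable (borel :: (nat \<Rightarrow> real) measure)" for n :: nat
    by (rule measurable_product_coordinates)
  have fl: "(\<lambda>x :: real. nat \<lfloor>x\<rfloor>) \<in> borel \<rightarrow>\<^sub>M count_space UNIV"
    by (rule measurable_compose[OF measurable_real_floor]) simp
  have d1: "(\<lambda>h :: nat \<Rightarrow> real. (\<lambda>n. nat \<lfloor>h (Suc n)\<rfloor>)) \<in> borel \<rightarrow>\<^sub>M bern"
    by (rule measurable_bernI) (rule measurable_compose[OF c fl])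
  have d_m [measurable]: "d \<in> borel \<rightarrow>\<^sub>M bern \<Otimes>\<^sub>M borel"
    unfolding d_def[abs_def] by (rule measurable_Pair[OF d1 c])
  define M where "M = distr (bern \<Otimes>\<^sub>M \<nu>) borel e"
  define T where "T = e \<circ> step \<circ> d"
  have em': "e \<in> bern \<Otimes>\<^sub>M \<nu> \<rightarrow>\<^sub>M borel" using e_m s by (simp cong: measurable_cong_sets)
  have st': "step \<in> bern \<Otimes>\<^sub>M \<nu> \<rightarrow>\<^sub>M bern \<Otimes>\<^sub>M borel" by (rule measurable_step_prod) simp
  have T_m [measurable]: "T \<in> borel \<rightarrow>\<^sub>M borel" unfolding T_def by measurable
  have dst: "distr (bern \<Otimes>\<^sub>M \<nu>) (bern \<Otimes>\<^sub>M borel) step = bern \<Otimes>\<^sub>M \<nu>"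
    using distr_step[of \<nu>] assms by (simp add: stationary_def)
  interpret ext: measure_preserving_polish M T
  proof (intro measure_preserving_polish.intro measure_preserving_polish_axioms.intro)
    show "prob_space M" unfolding M_def by (rule P.prob_space_distr[OF em'])
    show "distr M borel T = M"
    proof -
      have "distr M borel T = distr (bern \<Otimes>\<^sub>M \<nu>) borel (e \<circ> step)"
        unfolding M_def using em' by (subst distr_distr) (auto simp: T_def o_def de)
      also have "\<dots> = distr (distr (bern \<Otimes>\<^sub>M \<nu>) (bern \<Otimes>\<^sub>M borel) step) borel e"
        using st' by (subst distr_distr) auto
      also have "\<dots> = M" unfolding dst M_def ..
      finally show ?thesis .
    qed
    show "sets M = sets borel" unfolding M_def by (rule sets_distr)
    show "T \<in> borel \<rightarrow>\<^sub>M borel" by (rule T_m)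
  qed
  define D where "D y = (\<lambda>n::int. d (y n))" for y
  let ?P = "\<Pi>\<^sub>M j\<in>UNIV. bern \<Otimes>\<^sub>M borel :: ((nat \<Rightarrow> nat) \<times> real) measure"
  have D_m [measurable]: "D \<in> ext.natext \<rightarrow>\<^sub>M ?P"
    unfolding D_def[abs_def] by (rule measurable_PiM_single') (auto simp: space_PiM space_pair_measure)
  define L where "L = distr ext.natext ?P D"
  have sL: "sets L = sets ?P" by (simp add: L_def)
  have shL: "(\<lambda>y n. y (n + 1)) \<in> ?P \<rightarrow>\<^sub>M ?P"
    by (rule measurable_PiM_single') (auto simp: space_PiM)
  have shN: "(\<lambda>y n. y (n + 1)) \<in> ext.natext \<rightarrow>\<^sub>M ext.natext"
    by (simp cong: measurable_cong_sets) (intro measurable_PiM_single' ; simp)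
  show ?thesis
  proof (rule that[of L])
    show "prob_space L" unfolding L_def by (rule ext.limit.P.prob_space_distr[OF D_m])
    show "sets L = sets ?P" by (rule sL)
    show "distr L (bern \<Otimes>\<^sub>M borel) (\<lambda>y. y n) = bern \<Otimes>\<^sub>M \<nu>" for n
    proof -
      have cn: "(\<lambda>y. y n) \<in> ext.natext \<rightarrow>\<^sub>M borel"
        by (simp cong: measurable_cong_sets)
      have "distr L (bern \<Otimes>\<^sub>M borel) (\<lambda>y. y n) = distr ext.natext (bern \<Otimes>\<^sub>M borel) ((\<lambda>y. y n) \<circ> D)"
        unfolding L_def by (rule distr_distr[OF _ D_m]) simp
      also have "(\<lambda>y. y n) \<circ> D = d \<circ> (\<lambda>y. y n)"
        by (auto simp: D_def)
      also have "distr ext.natext (bern \<Otimes>\<^sub>M borel) \<dots> = distr (distr ext.natext borel (\<lambda>y. y n)) (bern \<Otimes>\<^sub>M borel) d"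
        by (rule distr_distr[symmetric, OF d_m cn])
      also have "\<dots> = distr M (bern \<Otimes>\<^sub>M borel) d"
        by (simp only: ext.natext_component)
      also have "\<dots> = distr (bern \<Otimes>\<^sub>M \<nu>) (bern \<Otimes>\<^sub>M borel) (d \<circ> e)"
        unfolding M_def by (rule distr_distr[OF d_m em'])
      also have "\<dots> = bern \<Otimes>\<^sub>M \<nu>"
        using distr_id2[OF s[symmetric]] by (simp add: o_def de)
      finally show ?thesis .
    qed
    show "AE y in L. y (n + 1) = step (y n)" for n
    proof -
      have "AE y in ext.natext. D y (n + 1) = step (D y n)"
        using ext.natext_AE_orbit[of n] by eventually_elim (simp add: D_def T_def de)
      moreover have "(\<lambda>y. y m) \<in> ?P \<rightarrow>\<^sub>M bern \<Otimes>\<^sub>M borel" for m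
        by (rule measurable_component_singleton) simp
      then have "{y \<in> space ?P. y (n + 1) = step (y n)} \<in> sets ?P"
        by (intro sets_Collect_eq_bern_real measurable_compose[OF _ step_measurable])
      ultimately show ?thesis unfolding L_def by (subst AE_distr_iff[OF D_m]) simp_all
    qed
    show "distr L L (\<lambda>y n. y (n + 1)) = L"
    proof -
      have "distr L L (\<lambda>y n. y (n + 1)) = distr L ?P (\<lambda>y n. y (n + 1))"
        by (intro distr_cong sL refl)
      also have "\<dots> = distr ext.natext ?P ((\<lambda>y n. y (n + 1)) \<circ> D)"
        unfolding L_def by (rule distr_distr[OF shL D_m])
      also have "(\<lambda>y n. y (n + 1)) \<circ> D = D \<circ> (\<lambda>y n. y (n + 1))"
        by (auto simp: D_def)
      also have "distr ext.natext ?P \<dots> = distr (distr ext.natext ext.natext (\<lambda>y n. y (n + 1))) ?P D"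
        by (rule distr_distr[symmetric, OF D_m shN])
      also have "\<dots> = L" unfolding L_def by (simp only: ext.natext_shift)
      finally show ?thesis .
    qed
  qed
qed

end

section \<open>Ergodicity\<close>

text \<open>The approximable sets are closed under complements and countable unions. For a union,
  half of \<open>e\<close> pays for truncating it and the other half is shared among the finitely
  many remaining sets.\<close>

lemma (in finite_measure) algebra_approximation:
  assumes alg: "algebra (space M) \<A>" and sub: "\<A> \<subseteq> sets M"
    and A: "A \<in> sigma_sets (space M) \<A>" and e: "0 < e"
  shows "\<exists>B\<in>\<A>. measure M (sym_diff A B) < e"
  using A e
proof (induction arbitrary: e)
  case (Basic a)
  then show ?case by (intro bexI[of _ a]) auto
next
  case Empty
  then show ?case using alg by (intro bexI[of _ "{}"]) (auto simp: algebra_iff_Un)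
next
  case (Compl a)
  then obtain B where B: "B \<in> \<A>" "measure M (sym_diff a B) < e" by blast
  have "a \<subseteq> space M" using Compl.hyps sub sigma_sets_into_sp[of \<A> "space M" a] sets.space_closed by blast
  moreover have "B \<subseteq> space M" using B(1) sub sets.sets_into_space by auto
  ultimately have "sym_diff (space M - a) (space M - B) = sym_diff a B" by auto
  then show ?case using B alg by (intro bexI[of _ "space M - B"]) (auto simp: algebra_iff_Un)
next
  case (Union a)
  have am: "a i \<in> sets M" for i
    using Union.hyps(1)[of i] sets.sigma_sets_subset[OF sub] by blast
  have "(\<lambda>n. measure M (\<Union>i<n. a i)) \<longlonglongrightarrow> measure M (\<Union>n. \<Union>i<n. a i)"
  proof (intro finite_Lim_measure_incseq)
    show "range (\<lambda>n. \<Union>i<n. a i) \<subseteq> sets M" using am by auto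
    show "incseq (\<lambda>n. \<Union>i<n. a i)" unfolding incseq_def by (meson UN_mono lessThan_subset_iff order_refl)
  qed
  moreover have "(\<Union>n. \<Union>i<n. a i) = (\<Union>i. a i)" by auto
  ultimately have "(\<lambda>n. measure M (\<Union>i<n. a i)) \<longlonglongrightarrow> measure M (\<Union>i. a i)" by simp
  then have "\<forall>\<^sub>F n in sequentially. measure M (\<Union>i. a i) - e / 2 < measure M (\<Union>i<n. a i)"
    using Union.prems by (intro order_tendstoD) auto
  then obtain n where n: "measure M (\<Union>i. a i) - e / 2 < measure M (\<Union>i<n. a i)"
    by (auto simp: eventually_sequentially)
  \<comment> \<open>\<open>Suc n\<close> instead of \<open>n\<close> keeps the tolerance positive
    when the truncated union is empty.\<close>
  have "\<exists>B\<in>\<A>. measure M (sym_diff (a i) B) < e / (2 * Suc n)" for i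
    using Union.prems by (intro Union.IH) auto
  then obtain B where B: "\<And>i. B i \<in> \<A>" "\<And>i. measure M (sym_diff (a i) (B i)) < e / (2 * Suc n)" by metis
  have Bm: "B i \<in> sets M" for i using B(1) sub by auto
  interpret algebra "space M" \<A> by fact
  have "sym_diff (\<Union>i. a i) (\<Union>i<n. B i) \<subseteq> ((\<Union>i. a i) - (\<Union>i<n. a i)) \<union> (\<Union>i<n. sym_diff (a i) (B i))"
    by auto
  then have "measure M (sym_diff (\<Union>i. a i) (\<Union>i<n. B i))
      \<le> measure M (((\<Union>i. a i) - (\<Union>i<n. a i)) \<union> (\<Union>i<n. sym_diff (a i) (B i)))"
    using am Bm by (intro finite_measure_mono) auto
  also have "\<dots> \<le> measure M ((\<Union>i. a i) - (\<Union>i<n. a i)) + measure M (\<Union>i<n. sym_diff (a i) (B i))"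
    using am Bm by (intro measure_Un_le) auto
  also have "measure M ((\<Union>i. a i) - (\<Union>i<n. a i)) = measure M (\<Union>i. a i) - measure M (\<Union>i<n. a i)"
    using am by (intro finite_measure_Diff) auto
  also have "measure M (\<Union>i<n. sym_diff (a i) (B i)) \<le> (\<Sum>i<n. measure M (sym_diff (a i) (B i)))"
    using am Bm by (intro finite_measure_subadditive_finite) auto
  also have "\<dots> \<le> (\<Sum>i<n. e / (2 * Suc n))"
    using B(2) by (intro sum_mono less_imp_le) auto
  also have "\<dots> = e / 2 * (n / Suc n)" by (simp add: field_simps)
  also have "\<dots> \<le> e / 2" using Union.prems by (intro mult_left_le) auto
  finally have "measure M (sym_diff (\<Union>i. a i) (\<Union>i<n. B i)) < e" using n by linarith
  moreover have "(\<Union>i<n. B i) \<in> \<A>" using B(1) by (intro finite_UN) auto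
  ultimately show ?case by blast
qed

lemma (in finite_measure) abs_measure_diff_le_sym_diff:
  assumes [measurable]: "A \<in> sets M" "B \<in> sets M" "C \<in> sets M"
  shows "\<bar>measure M (A \<inter> C) - measure M (B \<inter> C)\<bar> \<le> measure M (sym_diff A B)"
proof -
  have "measure M (A \<inter> C) \<le> measure M ((B \<inter> C) \<union> sym_diff A B)"
    by (intro finite_measure_mono) auto
  also have "\<dots> \<le> measure M (B \<inter> C) + measure M (sym_diff A B)"
    by (intro measure_Un_le) auto
  finally have 1: "measure M (A \<inter> C) \<le> measure M (B \<inter> C) + measure M (sym_diff A B)" .
  have "measure M (B \<inter> C) \<le> measure M ((A \<inter> C) \<union> sym_diff A B)"
    by (intro finite_measure_mono) auto
  also have "\<dots> \<le> measure M (A \<inter> C) + measure M (sym_diff A B)"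
    by (intro measure_Un_le) auto
  finally show ?thesis using 1 by linarith
qed

section \<open>Sets determined by a finite window of symbols and finitely many thresholds\<close>

text \<open>The second clause says that \<open>S \<omega>\<close> is a union of cells of the partition of the line cut by \<open>E\<close>.\<close>

definition cylindrical :: "nat \<Rightarrow> real set \<Rightarrow> ((int \<Rightarrow> nat) \<Rightarrow> real set) \<Rightarrow> bool" where
  "cylindrical m E S \<longleftrightarrow>
     (\<forall>\<omega> \<omega>'. (\<forall>j. \<bar>j\<bar> \<le> int m \<longrightarrow> \<omega> j = \<omega>' j) \<longrightarrow> S \<omega> = S \<omega>') \<and>
     (\<forall>\<omega> s t. (\<forall>q\<in>E. s \<le> q \<longleftrightarrow> t \<le> q) \<longrightarrow> (s \<in> S \<omega> \<longleftrightarrow> t \<in> S \<omega>))"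

lemma cylindricalD:
  assumes "cylindrical m E S"
  shows "(\<And>j. \<bar>j\<bar> \<le> int m \<Longrightarrow> \<omega> j = \<omega>' j) \<Longrightarrow> S \<omega> = S \<omega>'"
    "(\<And>q. q \<in> E \<Longrightarrow> s \<le> q \<longleftrightarrow> t \<le> q) \<Longrightarrow> s \<in> S \<omega> \<longleftrightarrow> t \<in> S \<omega>"
  using assms unfolding cylindrical_def by (blast, blast)

lemma cylindrical_mono:
  "cylindrical m E S \<Longrightarrow> m \<le> m' \<Longrightarrow> E \<subseteq> E' \<Longrightarrow> cylindrical m' E' S"
  unfolding cylindrical_def by (intro conjI allI impI) (force, blast)

lemma cylindrical_Compl: "cylindrical m E S \<Longrightarrow> cylindrical m E (\<lambda>\<omega>. - S \<omega>)"
  unfolding cylindrical_def by simp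

lemma cylindrical_Un: "cylindrical m E S \<Longrightarrow> cylindrical m E S' \<Longrightarrow> cylindrical m E (\<lambda>\<omega>. S \<omega> \<union> S' \<omega>)"
  unfolding cylindrical_def Un_iff by blast

text \<open>There are only finitely many cells, one for each subset of \<open>E\<close> that can be
  the set of thresholds above a point.\<close>

lemma cylindrical_borel:
  assumes "cylindrical m E S" "finite E"
  shows "S \<omega> \<in> sets borel"
proof -
  let ?c = "\<lambda>s :: real. {q \<in> E. s \<le> q}"
  have "S \<omega> = (\<Union>c\<in>?c ` S \<omega>. {s. \<forall>q\<in>E. s \<le> q \<longleftrightarrow> q \<in> c})"
  proof (intro set_eqI iffI)
    fix s assume "s \<in> (\<Union>c\<in>?c ` S \<omega>. {s. \<forall>q\<in>E. s \<le> q \<longleftrightarrow> q \<in> c})"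
    then obtain t where "t \<in> S \<omega>" "\<forall>q\<in>E. s \<le> q \<longleftrightarrow> t \<le> q" by auto
    then show "s \<in> S \<omega>" using cylindricalD(2)[OF assms(1), of s t] by blast
  qed auto
  also have "\<dots> \<in> sets borel"
  proof (intro sets.finite_UN)
    have "?c ` S \<omega> \<subseteq> Pow E" by auto
    then show "finite (?c ` S \<omega>)" using assms(2) finite_subset by blast
    fix c
    have "{s \<in> space borel. \<forall>q\<in>E. s \<le> q \<longleftrightarrow> q \<in> c} \<in> sets borel"
      by (intro sets.sets_Collect_finite_All assms(2)) measurable
    then show "{s. \<forall>q\<in>E. s \<le> q \<longleftrightarrow> q \<in> c} \<in> sets borel" by simp
  qed
  finally show ?thesis .
qed

text \<open>Time \<open>j\<close> of the two-sided window is stored at position \<open>j + m\<close>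
  of the one-sided sequence \<open>u z\<close>. Only the first \<open>2 * m + 1\<close> entries
  matter, so the set is a countable union over finite words, and for each word a fixed Borel set
  remains.\<close>

lemma cylindrical_measurable:
  assumes S: "cylindrical m E S" "finite E"
    and u: "\<And>k :: nat. (\<lambda>z. u z k) \<in> N \<rightarrow>\<^sub>M count_space UNIV" and y: "y \<in> borel_measurable N"
  shows "{z \<in> space N. y z \<in> S (\<lambda>j. u z (nat (j + int m)))} \<in> sets N"
proof -
  let ?L = "\<lambda>z. map (u z) [0..<2 * m + 1]"
  \<comment> \<open>Indices outside the window give a repeated or undefined entry here;
    \<open>S\<close> ignores them.\<close>
  have eq: "S (\<lambda>j. u z (nat (j + int m))) = S (\<lambda>j. ?L z ! nat (j + int m))" for z
    by (rule cylindricalD(1)[OF S(1)]) (subst nth_map_upt; auto)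
  have "{z \<in> space N. ?L z = l \<and> y z \<in> S (\<lambda>j. l ! nat (j + int m))} \<in> sets N" for l
  proof (cases "length l = 2 * m + 1")
    case True
    have "{z \<in> space N. ?L z = l \<and> y z \<in> S (\<lambda>j. l ! nat (j + int m))}
        = {z \<in> space N. \<forall>k\<in>{0..<2 * m + 1}. u z k = l ! k} \<inter> (y -` S (\<lambda>j. l ! nat (j + int m)) \<inter> space N)"
      using True by (auto simp: list_eq_iff_nth_eq simp del: upt_Suc)
    also have "\<dots> \<in> sets N"
    proof (rule sets.Int[OF sets.sets_Collect_finite_All measurable_sets[OF y cylindrical_borel[OF S]]])
      fix k
      have "{z \<in> space N. u z k = l ! k} = (\<lambda>z. u z k) -` {l ! k} \<inter> space N" by auto
      also have "\<dots> \<in> sets N" by (rule measurable_sets[OF u]) simp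
      finally show "{z \<in> space N. u z k = l ! k} \<in> sets N" .
    qed simp
    finally show ?thesis .
  next
    case False
    then have "{z \<in> space N. ?L z = l \<and> y z \<in> S (\<lambda>j. l ! nat (j + int m))} = {}" by auto
    then show ?thesis by (simp only: sets.empty_sets)
  qed
  then have "(\<Union>l. {z \<in> space N. ?L z = l \<and> y z \<in> S (\<lambda>j. l ! nat (j + int m))}) \<in> sets N"
    by (rule sets.countable_UN''[OF countableI_type])
  also have "(\<Union>l. {z \<in> space N. ?L z = l \<and> y z \<in> S (\<lambda>j. l ! nat (j + int m))})
      = {z \<in> space N. y z \<in> S (\<lambda>j. u z (nat (j + int m)))}"
    unfolding eq by blast
  finally show ?thesis .
qed

section \<open>Invariant measures coded by symbols and a fiber coordinate\<close>

locale invariant_system = prob_space M for M :: "'a measure" +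
  fixes T :: "'a \<Rightarrow> 'a"
  assumes T_measurable [measurable]: "T \<in> M \<rightarrow>\<^sub>M M" and T_invariant: "distr M M T = M"
begin

lemma T_space: "z \<in> space M \<Longrightarrow> T z \<in> space M"
  using measurable_space[OF T_measurable] .

lemma T_iter_measurable [measurable]: "T ^^ k \<in> M \<rightarrow>\<^sub>M M"
proof (induction k)
  case 0
  show ?case by (simp add: id_def)
next
  case (Suc k)
  show ?case unfolding funpow.simps by (rule measurable_comp[OF Suc T_measurable])
qed

lemma T_iter_space: "z \<in> space M \<Longrightarrow> (T ^^ k) z \<in> space M"
  using measurable_space[OF T_iter_measurable] .

lemma measure_T_vimage:
  assumes "A \<in> sets M"
  shows "prob ((T ^^ k) -` A \<inter> space M) = prob A"
proof (induction k)
  case 0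
  show ?case using sets.sets_into_space[OF assms] by (simp add: Int_absorb2)
next
  case (Suc k)
  have "prob ((T ^^ Suc k) -` A \<inter> space M) = prob (T -` ((T ^^ k) -` A \<inter> space M) \<inter> space M)"
    by (rule arg_cong[where f=prob]) (auto simp: funpow_swap1 T_space)
  also have "\<dots> = measure (distr M M T) ((T ^^ k) -` A \<inter> space M)"
    by (subst measure_distr) (auto intro: measurable_sets[OF T_iter_measurable assms])
  finally show ?case by (simp only: T_invariant Suc)
qed

end

text \<open>An abstract form of the lifted measure, without the geometry of the horseshoe. By
  \<open>law\<close> the present fiber coordinate is independent of the present and future symbols,
  while it may depend on the past ones. \<open>sets_generated\<close> is what allows approximation
  by cylinders.\<close>

locale coded_system = fiber_system g + invariant_system M T
  for g :: "nat \<Rightarrow> real \<Rightarrow> real" and M :: "'a measure" and T +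
  fixes w :: "'a \<Rightarrow> int \<Rightarrow> nat" and x :: "'a \<Rightarrow> real" and \<nu> :: "real measure"
  assumes w_shift: "z \<in> space M \<Longrightarrow> w (T z) n = w z (n + 1)"
    and x_step: "z \<in> space M \<Longrightarrow> x (T z) = g (w z 0) (x z)"
    and w_range: "z \<in> space M \<Longrightarrow> w z n \<in> {0, 1, 2}"
    and x_range: "z \<in> space M \<Longrightarrow> x z \<in> {0..1}"
    and w_measurable [measurable]: "(\<lambda>z. w z n) \<in> M \<rightarrow>\<^sub>M count_space UNIV"
    and x_measurable [measurable]: "x \<in> borel_measurable M"
    and sets_generated: "sets M \<subseteq> sigma_sets (space M)
      ({{z \<in> space M. w z n = i} |n i. True} \<union> {{z \<in> space M. x z \<le> q} |q. True})"
    and stationary_\<nu>: "stationary \<nu>"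
    and law: "distr M (bern \<Otimes>\<^sub>M borel) (\<lambda>z. (\<lambda>n. w z (int n), x z)) = bern \<Otimes>\<^sub>M \<nu>"
begin

lemma real_distribution_\<nu>: "real_distribution \<nu>"
  using stationary_\<nu> by (simp add: stationary_def)

lemma w_iter: "z \<in> space M \<Longrightarrow> w ((T ^^ k) z) n = w z (n + int k)"
proof (induction k arbitrary: n)
  case (Suc k)
  then show ?case by (simp add: w_shift T_iter_space ac_simps)
qed simp

text \<open>The factor map onto the one-sided skew product, which forgets the past and intertwines
  \<open>T\<close> with \<open>step\<close>.\<close>

definition fut :: "'a \<Rightarrow> (nat \<Rightarrow> nat) \<times> real" where
  "fut z = (\<lambda>n. w z (int n), x z)"

lemma fut_measurable [measurable]: "fut \<in> M \<rightarrow>\<^sub>M bern \<Otimes>\<^sub>M borel"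
  unfolding fut_def[abs_def] by (intro measurable_Pair measurable_bernI x_measurable w_measurable)

lemma distr_fut: "distr M (bern \<Otimes>\<^sub>M borel) fut = bern \<Otimes>\<^sub>M \<nu>"
  using law unfolding fut_def[abs_def] .

lemma fut_iter: "z \<in> space M \<Longrightarrow> fut ((T ^^ k) z) = (step ^^ k) (fut z)"
proof (induction k)
  case (Suc k)
  have "fut (T y) = step (fut y)" if "y \<in> space M" for y
    using that by (auto simp: fut_def step_def w_shift x_step algebra_simps)
  then show ?case using Suc T_iter_space by simp
qed simp

lemma x_iter: "z \<in> space M \<Longrightarrow> x ((T ^^ k) z) = snd ((step ^^ k) (fut z))"
  by (subst fut_iter[symmetric]) (simp_all add: fut_def)

lemma fst_fut_iter: "z \<in> space M \<Longrightarrow> fst (fut ((T ^^ k) z)) = (\<lambda>n. fst (fut z) (n + k))"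
  by (simp add: fut_iter step_iter_fst)

lemma measure_fut:
  assumes "W \<in> sets (bern \<Otimes>\<^sub>M borel)"
  shows "prob {z \<in> space M. fut z \<in> W} = measure (bern \<Otimes>\<^sub>M \<nu>) W"
  unfolding distr_fut[symmetric]
  by (subst measure_distr[OF fut_measurable assms]) (auto intro!: arg_cong[where f=prob])

text \<open>The set of admissible cells may vary with the symbols in the window; this is what makes
  the family closed under complements and unions.\<close>

definition cylinders :: "nat \<Rightarrow> real set \<Rightarrow> 'a set set" where
  "cylinders m E = {{z \<in> space M. x z \<in> S (w z)} |S. cylindrical m E S}"

definition cylinder_algebra :: "'a set set" where
  "cylinder_algebra = (\<Union>m. \<Union>E\<in>{E. finite E}. cylinders m E)"

lemma cylinder_algebraI:
  assumes "finite E" "cylindrical m E S" "A = {z \<in> space M. x z \<in> S (w z)}"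
  shows "A \<in> cylinder_algebra"
proof -
  have "A \<in> cylinders m E" unfolding cylinders_def mem_Collect_eq using assms(2,3) by metis
  then show ?thesis unfolding cylinder_algebra_def using assms(1) by auto
qed

lemma cylinders_mono: "m \<le> m' \<Longrightarrow> E \<subseteq> E' \<Longrightarrow> cylinders m E \<subseteq> cylinders m' E'"
  unfolding cylinders_def using cylindrical_mono by blast

lemma cylinders_sets:
  assumes "B \<in> cylinders m E" "finite E"
  shows "B \<in> sets M"
proof -
  obtain S where S: "cylindrical m E S" and B: "B = {z \<in> space M. x z \<in> S (w z)}"
    using assms(1) by (auto simp: cylinders_def)
  have "S (w z) = S (\<lambda>j. w z (int (nat (j + int m)) - int m))" for z
    by (rule cylindricalD(1)[OF S]) auto
  then have "B = {z \<in> space M. x z \<in> S (\<lambda>j. w z (int (nat (j + int m)) - int m))}"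
    by (simp add: B)
  also have "\<dots> \<in> sets M"
    by (rule cylindrical_measurable[OF S assms(2), of "\<lambda>z k. w z (int k - int m)" M x, OF w_measurable x_measurable])
  finally show ?thesis .
qed

lemma algebra_cylinder_algebra: "algebra (space M) cylinder_algebra"
  unfolding algebra_iff_Un
proof (intro conjI ballI)
  show "cylinder_algebra \<subseteq> Pow (space M)"
    by (auto simp: cylinder_algebra_def cylinders_def)
  have "cylindrical 0 {} (\<lambda>_. {})" by (simp add: cylindrical_def)
  then show "{} \<in> cylinder_algebra"
    by (rule cylinder_algebraI[rotated]) auto
next
  fix A assume "A \<in> cylinder_algebra"
  then obtain m E S where E: "finite E" and S: "cylindrical m E S" and A: "A = {z \<in> space M. x z \<in> S (w z)}"
    by (auto simp: cylinder_algebra_def cylinders_def)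
  have "space M - A = {z \<in> space M. x z \<in> - S (w z)}" using A by auto
  then show "space M - A \<in> cylinder_algebra"
    by (rule cylinder_algebraI[OF E cylindrical_Compl[OF S]])
next
  fix A B assume "A \<in> cylinder_algebra" "B \<in> cylinder_algebra"
  then obtain m E S m' E' S' where E: "finite E" "finite E'"
    and S: "cylindrical m E S" "cylindrical m' E' S'"
    and A: "A = {z \<in> space M. x z \<in> S (w z)}" "B = {z \<in> space M. x z \<in> S' (w z)}"
    by (auto simp: cylinder_algebra_def cylinders_def)
  have 1: "cylindrical (max m m') (E \<union> E') (\<lambda>\<omega>. S \<omega> \<union> S' \<omega>)"
    by (intro cylindrical_Un cylindrical_mono[OF S(1)] cylindrical_mono[OF S(2)]) auto
  have "A \<union> B = {z \<in> space M. x z \<in> S (w z) \<union> S' (w z)}" using A by auto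
  then show "A \<union> B \<in> cylinder_algebra"
    by (rule cylinder_algebraI[OF finite_UnI[OF E] 1])
qed

lemma cylinder_algebra_sets: "cylinder_algebra \<subseteq> sets M"
  using cylinders_sets by (auto simp: cylinder_algebra_def)

lemma sets_subset_sigma_cylinders: "sets M \<subseteq> sigma_sets (space M) cylinder_algebra"
proof (rule order_trans[OF sets_generated], rule sigma_sets_mono', rule subsetI)
  fix A assume "A \<in> {{z \<in> space M. w z n = i} |n i. True} \<union> {{z \<in> space M. x z \<le> q} |q. True}"
  then consider n i where "A = {z \<in> space M. w z n = i}" | q where "A = {z \<in> space M. x z \<le> q}" by auto
  then show "A \<in> cylinder_algebra"
  proof cases
    case 1
    have c: "cylindrical (nat \<bar>n\<bar>) {} (\<lambda>\<omega>. if \<omega> n = i then UNIV else {})"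
      by (auto simp: cylindrical_def)
    show ?thesis
      by (rule cylinder_algebraI[OF _ c]) (use 1 in auto)
  next
    case 2
    have c: "cylindrical 0 {q} (\<lambda>\<omega>. {..q})" by (auto simp: cylindrical_def)
    show ?thesis
      by (rule cylinder_algebraI[OF _ c]) (use 2 in auto)
  qed
qed

lemma cylinder_approximation:
  assumes "A \<in> sets M" "0 < e"
  obtains m E B where "finite E" "B \<in> cylinders m E" "prob (sym_diff A B) < e"
  using algebra_approximation[OF algebra_cylinder_algebra cylinder_algebra_sets _ assms(2), of A]
    sets_subset_sigma_cylinders assms(1)
  by (auto simp: cylinder_algebra_def)

text \<open>Pulling back by \<open>m\<close> steps moves the window from \<open>-m..m\<close> to
  \<open>0..2m\<close>, so the preimage depends on the present fiber coordinate and on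
  \<open>2 * m + 1\<close> future symbols only.\<close>

lemma cylinder_future:
  assumes "B \<in> cylinders m E" "finite E"
  obtains W where "W \<in> sets (bern \<Otimes>\<^sub>M borel)"
    "\<forall>\<omega> \<omega>' t. (\<forall>j<2 * m + 1. \<omega> j = \<omega>' j) \<longrightarrow> (\<omega>, t) \<in> W \<longleftrightarrow> (\<omega>', t) \<in> W"
    "(T ^^ m) -` B \<inter> space M = {z \<in> space M. fut z \<in> W}"
proof -
  obtain S where S: "cylindrical m E S" and B: "B = {z \<in> space M. x z \<in> S (w z)}"
    using assms(1) by (auto simp: cylinders_def)
  let ?W = "{p \<in> space (bern \<Otimes>\<^sub>M borel). snd ((step ^^ m) p) \<in> S (\<lambda>j. fst p (nat (j + int m)))}"
  show thesis
  proof (rule that[of ?W])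
    show "?W \<in> sets (bern \<Otimes>\<^sub>M borel)"
    proof (rule cylindrical_measurable[OF S assms(2)])
      show "(\<lambda>p. fst p k) \<in> bern \<Otimes>\<^sub>M borel \<rightarrow>\<^sub>M count_space UNIV" for k
        by (rule measurable_compose[OF measurable_fst measurable_bern_component])
      show "(\<lambda>p. snd ((step ^^ m) p)) \<in> borel_measurable (bern \<Otimes>\<^sub>M borel)"
        by (rule measurable_compose[OF step_iter_measurable measurable_snd])
    qed
    show "\<forall>\<omega> \<omega>' t. (\<forall>j<2 * m + 1. \<omega> j = \<omega>' j) \<longrightarrow> (\<omega>, t) \<in> ?W \<longleftrightarrow> (\<omega>', t) \<in> ?W"
    proof (intro allI impI)
      fix \<omega> \<omega>' :: "nat \<Rightarrow> nat" and t assume that: "\<forall>j<2 * m + 1. \<omega> j = \<omega>' j"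
      have "snd ((step ^^ m) (\<omega>, t)) = snd ((step ^^ m) (\<omega>', t))"
        by (rule step_iter_cong) (use that in simp)
      moreover have "S (\<lambda>j. \<omega> (nat (j + int m))) = S (\<lambda>j. \<omega>' (nat (j + int m)))"
        by (rule cylindricalD(1)[OF S]) (use that in auto)
      ultimately show "(\<omega>, t) \<in> ?W \<longleftrightarrow> (\<omega>', t) \<in> ?W" by (simp add: space_pair_measure)
    qed
    have "x ((T ^^ m) z) \<in> S (w ((T ^^ m) z)) \<longleftrightarrow> fut z \<in> ?W" if z: "z \<in> space M" for z
    proof -
      have "x ((T ^^ m) z) = snd ((step ^^ m) (fut z))"
        by (rule x_iter[OF z])
      moreover have "S (w ((T ^^ m) z)) = S (\<lambda>j. fst (fut z) (nat (j + int m)))"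
        by (rule cylindricalD(1)[OF S]) (auto simp: w_iter[OF z] fut_def)
      ultimately show ?thesis by (simp add: space_pair_measure)
    qed
    then show "(T ^^ m) -` B \<inter> space M = {z \<in> space M. fut z \<in> ?W}"
      using T_iter_space by (auto simp: B)
  qed
qed

lemma invariant_vimage_iter:
  assumes A: "A \<in> sets M" "T -` A \<inter> space M = A"
  shows "(T ^^ k) -` A \<inter> space M = A"
proof (induction k)
  case 0
  show ?case using sets.sets_into_space[OF A(1)] by auto
next
  case (Suc k)
  have "(T ^^ Suc k) -` A \<inter> space M = T -` ((T ^^ k) -` A \<inter> space M) \<inter> space M"
    by (auto simp: funpow_swap1 T_space)
  then show ?case by (simp only: Suc A(2))
qed

text \<open>An approximation of \<open>A\<close> involves symbols up to a time \<open>m\<close> only; by invariance of \<open>A\<close> the future may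
  be read off from time \<open>m + 1\<close> on instead.\<close>

lemma invariant_indep_future:
  assumes A: "A \<in> sets M" "T -` A \<inter> space M = A"
    and V [measurable]: "V \<in> sets borel" and D [measurable]: "D \<in> sets bern"
  shows "prob {z \<in> A. x z \<in> V \<and> fst (fut z) \<in> D} = prob {z \<in> A. x z \<in> V} * measure bern D"
proof -
  interpret \<nu>: real_distribution \<nu> by (rule real_distribution_\<nu>)
  have sN: "sets (bern \<Otimes>\<^sub>M \<nu>) = sets (bern \<Otimes>\<^sub>M borel)"
    by (simp cong: sets_pair_measure_cong)
  define C where "C = {z \<in> space M. x z \<in> V \<and> fst (fut z) \<in> D}"
  define C' where "C' = {z \<in> space M. x z \<in> V}"
  have fm: "(\<lambda>z. fst (fut z)) \<in> M \<rightarrow>\<^sub>M bern"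
    by (rule measurable_compose[OF fut_measurable measurable_fst])
  have C [measurable]: "C \<in> sets M" "C' \<in> sets M"
    unfolding C_def C'_def using fm by measurable
  have "\<bar>prob (A \<inter> C) - prob (A \<inter> C') * measure bern D\<bar> \<le> 2 * e" if "0 < e" for e
  proof -
    obtain m E B where B: "finite E" "B \<in> cylinders m E" "prob (sym_diff A B) < e"
      using cylinder_approximation[OF A(1) \<open>0 < e\<close>] .
    have Bm [measurable]: "B \<in> sets M" by (rule cylinders_sets[OF B(2,1)])
    obtain W where W [measurable]: "W \<in> sets (bern \<Otimes>\<^sub>M borel)"
      and Wd: "\<forall>\<omega> \<omega>' t. (\<forall>j<2 * m + 1. \<omega> j = \<omega>' j) \<longrightarrow> (\<omega>, t) \<in> W \<longleftrightarrow> (\<omega>', t) \<in> W"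
      and TW: "(T ^^ m) -` B \<inter> space M = {z \<in> space M. fut z \<in> W}"
      using cylinder_future[OF B(2,1)] .
    let ?N = "m + 1"
    have TC: "(T ^^ ?N) -` C \<inter> space M \<in> sets M" "(T ^^ ?N) -` C' \<inter> space M \<in> sets M"
      using C by (auto intro: measurable_sets[OF T_iter_measurable])
    \<comment> \<open>Invariance of \<open>A\<close> lets any event be moved to a later time without
      changing its joint probability with \<open>A\<close>.\<close>
    have shiftA: "prob (A \<inter> ((T ^^ ?N) -` K \<inter> space M)) = prob (A \<inter> K)" if "K \<in> sets M" for K
    proof -
      have "A \<inter> ((T ^^ ?N) -` K \<inter> space M) = (T ^^ ?N) -` (A \<inter> K) \<inter> space M"
        using invariant_vimage_iter[OF A, of ?N] by blast
      then show ?thesis using measure_T_vimage[of "A \<inter> K" ?N] A(1) that by simp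
    qed
    \<comment> \<open>The fiber value at time \<open>2 * m + 1\<close> is produced by the symbols
      \<open>0..2m\<close>, the same ones that \<open>W\<close> uses, so \<open>U\<close> is
      independent of the tail from \<open>2 * m + 1\<close> on.\<close>
    define U where "U = {p \<in> W. snd ((step ^^ (2 * m + 1)) p) \<in> V}"
    have U_eq: "U = {p \<in> space (bern \<Otimes>\<^sub>M borel). p \<in> W \<and> snd ((step ^^ (2 * m + 1)) p) \<in> V}"
      using sets.sets_into_space[OF W] by (auto simp: U_def)
    have sm: "(\<lambda>p. snd ((step ^^ (2 * m + 1)) p)) \<in> borel_measurable (bern \<Otimes>\<^sub>M borel)"
      by (rule measurable_compose[OF step_iter_measurable measurable_snd])
    have Um [measurable]: "U \<in> sets (bern \<Otimes>\<^sub>M borel)"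
      unfolding U_eq using sm by measurable
    have Ud: "(\<omega>, t) \<in> U \<longleftrightarrow> (\<omega>', t) \<in> U" if "\<And>j. j < 2 * m + 1 \<Longrightarrow> \<omega> j = \<omega>' j" for \<omega> \<omega>' t
    proof -
      have "(\<omega>, t) \<in> W \<longleftrightarrow> (\<omega>', t) \<in> W" using Wd that by blast
      moreover have "snd ((step ^^ (2 * m + 1)) (\<omega>, t)) = snd ((step ^^ (2 * m + 1)) (\<omega>', t))"
        by (rule step_iter_cong) (rule that)
      ultimately show ?thesis unfolding U_def by (simp only: mem_Collect_eq)
    qed
    have dm: "(\<lambda>p. (\<lambda>n. fst p (n + (2 * m + 1)))) \<in> bern \<Otimes>\<^sub>M borel \<rightarrow>\<^sub>M bern"
      by (rule measurable_compose[OF measurable_fst measurable_bern_drop])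
    have UDm: "{p \<in> U. (\<lambda>n. fst p (n + (2 * m + 1))) \<in> D} \<in> sets (bern \<Otimes>\<^sub>M borel)"
    proof -
      have "{p \<in> U. (\<lambda>n. fst p (n + (2 * m + 1))) \<in> D}
          = U \<inter> ((\<lambda>p. (\<lambda>n. fst p (n + (2 * m + 1)))) -` D \<inter> space (bern \<Otimes>\<^sub>M borel))"
        using sets.sets_into_space[OF Um] by auto
      also have "\<dots> \<in> sets (bern \<Otimes>\<^sub>M borel)" by (rule sets.Int[OF Um measurable_sets[OF dm D]])
      finally show ?thesis .
    qed
    have "measure (bern \<Otimes>\<^sub>M \<nu>) {p \<in> U. (\<lambda>n. fst p (n + (2 * m + 1))) \<in> D}
        = measure (bern \<Otimes>\<^sub>M \<nu>) U * measure bern D"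
    proof -
      have "emeasure (bern \<Otimes>\<^sub>M \<nu>) {p \<in> U. (\<lambda>n. fst p (n + (2 * m + 1))) \<in> D}
          = emeasure (bern \<Otimes>\<^sub>M \<nu>) U * emeasure bern D"
        by (rule bern_indep[OF \<nu>.prob_space_axioms _ D]) (use Um sN Ud in \<open>blast+\<close>)
      then show ?thesis by (simp only: measure_def enn2real_mult)
    qed
    moreover have "prob (B \<inter> ((T ^^ ?N) -` C \<inter> space M))
        = prob {z \<in> space M. fut z \<in> {p \<in> U. (\<lambda>n. fst p (n + (2 * m + 1))) \<in> D}}"
    proof -
      have "z \<in> (T ^^ m) -` (B \<inter> ((T ^^ ?N) -` C \<inter> space M)) \<longleftrightarrow>
          fut z \<in> {p \<in> U. (\<lambda>n. fst p (n + (2 * m + 1))) \<in> D}" if z: "z \<in> space M" for z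
      proof -
        have "(T ^^ ?N) ((T ^^ m) z) = (T ^^ (2 * m + 1)) z"
          by (simp add: funpow_add[symmetric, THEN fun_cong, unfolded o_def] mult_2)
        moreover have "x ((T ^^ (2 * m + 1)) z) = snd ((step ^^ (2 * m + 1)) (fut z))"
          by (rule x_iter[OF z])
        moreover have "fst (fut ((T ^^ (2 * m + 1)) z)) = (\<lambda>n. fst (fut z) (n + (2 * m + 1)))"
          by (rule fst_fut_iter[OF z])
        ultimately show ?thesis
          using TW z T_iter_space[OF z] by (auto simp: C_def U_def simp del: funpow.simps)
      qed
      then have "(T ^^ m) -` (B \<inter> ((T ^^ ?N) -` C \<inter> space M)) \<inter> space M
          = {z \<in> space M. fut z \<in> {p \<in> U. (\<lambda>n. fst p (n + (2 * m + 1))) \<in> D}}" by blast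
      then show ?thesis
        using measure_T_vimage[of "B \<inter> ((T ^^ ?N) -` C \<inter> space M)" m] Bm TC by simp
    qed
    moreover have "prob (B \<inter> ((T ^^ ?N) -` C' \<inter> space M)) = prob {z \<in> space M. fut z \<in> U}"
    proof -
      have "z \<in> (T ^^ m) -` (B \<inter> ((T ^^ ?N) -` C' \<inter> space M)) \<longleftrightarrow> fut z \<in> U" if z: "z \<in> space M" for z
      proof -
        have "(T ^^ ?N) ((T ^^ m) z) = (T ^^ (2 * m + 1)) z"
          by (simp add: funpow_add[symmetric, THEN fun_cong, unfolded o_def] mult_2)
        moreover have "x ((T ^^ (2 * m + 1)) z) = snd ((step ^^ (2 * m + 1)) (fut z))"
          by (rule x_iter[OF z])
        ultimately show ?thesis
          using TW z T_iter_space[OF z] by (auto simp: C'_def U_def simp del: funpow.simps)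
      qed
      then have "(T ^^ m) -` (B \<inter> ((T ^^ ?N) -` C' \<inter> space M)) \<inter> space M = {z \<in> space M. fut z \<in> U}" by blast
      then show ?thesis
        using measure_T_vimage[of "B \<inter> ((T ^^ ?N) -` C' \<inter> space M)" m] Bm TC by simp
    qed
    ultimately have indep: "prob (B \<inter> ((T ^^ ?N) -` C \<inter> space M)) = prob (B \<inter> ((T ^^ ?N) -` C' \<inter> space M)) * measure bern D"
      by (simp only: measure_fut[OF UDm] measure_fut[OF Um])
    have 1: "\<bar>prob (A \<inter> C) - prob (B \<inter> ((T ^^ ?N) -` C \<inter> space M))\<bar> \<le> e"
      using abs_measure_diff_le_sym_diff[OF A(1) Bm TC(1)] B(3) shiftA[OF C(1)] by simp
    have 2: "\<bar>prob (A \<inter> C') - prob (B \<inter> ((T ^^ ?N) -` C' \<inter> space M))\<bar> \<le> e"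
      using abs_measure_diff_le_sym_diff[OF A(1) Bm TC(2)] B(3) shiftA[OF C(2)] by simp
    have "\<bar>prob (A \<inter> C') * measure bern D - prob (B \<inter> ((T ^^ ?N) -` C' \<inter> space M)) * measure bern D\<bar>
        \<le> \<bar>prob (A \<inter> C') - prob (B \<inter> ((T ^^ ?N) -` C' \<inter> space M))\<bar>"
      unfolding left_diff_distrib[symmetric] abs_mult
      by (rule mult_left_le) auto
    then show ?thesis using 1 2 indep by linarith
  qed
  note approx = this
  have "\<bar>prob (A \<inter> C) - prob (A \<inter> C') * measure bern D\<bar> \<le> 0 + e" if "0 < e" for e
    using approx[of "e / 2"] that by simp
  then have "\<bar>prob (A \<inter> C) - prob (A \<inter> C') * measure bern D\<bar> \<le> 0"
    by (rule field_le_epsilon)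
  moreover have "A \<inter> C = {z \<in> A. x z \<in> V \<and> fst (fut z) \<in> D}" "A \<inter> C' = {z \<in> A. x z \<in> V}"
    using sets.sets_into_space[OF A(1)] by (auto simp: C_def C'_def)
  ultimately show ?thesis by simp
qed

definition cond_law :: "'a set \<Rightarrow> real measure" where
  "cond_law A = distr (uniform_measure M A) borel x"

text \<open>Since \<open>A\<close> does not bias the future, the law of \<open>fut\<close>
  conditioned on \<open>A\<close> is the product of \<open>bern\<close> with the conditional law of
  the fiber coordinate. As \<open>A\<close> is invariant, conditioning on it commutes with
  \<open>T\<close>, and comparing the fiber coordinate before and after one step gives
  stationarity.\<close>

lemma
  assumes A: "A \<in> sets M" "T -` A \<inter> space M = A" and pos: "0 < prob A"
  shows stationary_cond_law: "stationary (cond_law A)"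
    and measure_cond_law: "U \<in> sets borel \<Longrightarrow> measure (cond_law A) U = prob {z \<in> A. x z \<in> U} / prob A"
    and prob_invariant_fut: "W \<in> sets (bern \<Otimes>\<^sub>M borel) \<Longrightarrow>
      prob {z \<in> A. fut z \<in> W} = prob A * measure (bern \<Otimes>\<^sub>M cond_law A) W"
proof -
  let ?U = "uniform_measure M A"
  have U: "prob_space ?U"
    by (rule prob_space_uniform_measure) (use pos in \<open>auto simp: emeasure_eq_measure\<close>)
  interpret U: prob_space ?U by (rule U)
  have mU: "measure ?U C = prob (A \<inter> C) / prob A" if "C \<in> sets M" for C
    using A(1) that pos by (intro measure_uniform_measure) (auto simp: emeasure_eq_measure)
  have Asp: "A \<subseteq> space M" by (rule sets.sets_into_space[OF A(1)])
  have xU: "x \<in> borel_measurable ?U" and futU: "fut \<in> ?U \<rightarrow>\<^sub>M bern \<Otimes>\<^sub>M borel"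
    by (simp_all cong: measurable_cong_sets)
  interpret N: real_distribution "cond_law A"
    unfolding cond_law_def by (rule U.real_distribution_distr[OF xU])
  show m: "measure (cond_law A) U = prob {z \<in> A. x z \<in> U} / prob A" if "U \<in> sets borel" for U
  proof -
    have "measure (cond_law A) U = measure ?U (x -` U \<inter> space M)"
      unfolding cond_law_def by (subst measure_distr[OF xU that]) simp
    also have "\<dots> = prob (A \<inter> (x -` U \<inter> space M)) / prob A"
      by (rule mU[OF measurable_sets[OF x_measurable that]])
    also have "A \<inter> (x -` U \<inter> space M) = {z \<in> A. x z \<in> U}" using Asp by auto
    finally show ?thesis .
  qed
  have dfut: "distr ?U (bern \<Otimes>\<^sub>M borel) fut = bern \<Otimes>\<^sub>M cond_law A"
  proof (rule pair_measure_eqI[symmetric])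
    interpret d: prob_space "distr ?U (bern \<Otimes>\<^sub>M borel) fut" by (rule U.prob_space_distr[OF futU])
    show "sigma_finite_measure bern" "sigma_finite_measure (cond_law A)" by unfold_locales
    show "sets (bern \<Otimes>\<^sub>M cond_law A) = sets (distr ?U (bern \<Otimes>\<^sub>M borel) fut)"
      by (simp cong: sets_pair_measure_cong add: cond_law_def)
    fix D V assume D: "D \<in> sets bern" and "V \<in> sets (cond_law A)"
    then have V: "V \<in> sets borel" by (simp add: cond_law_def)
    have DV: "D \<times> V \<in> sets (bern \<Otimes>\<^sub>M borel)" using D V by simp
    have "measure (distr ?U (bern \<Otimes>\<^sub>M borel) fut) (D \<times> V) = measure ?U (fut -` (D \<times> V) \<inter> space M)"
      by (subst measure_distr[OF futU DV]) simp
    also have "\<dots> = prob (A \<inter> (fut -` (D \<times> V) \<inter> space M)) / prob A"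
      by (rule mU[OF measurable_sets[OF fut_measurable DV]])
    also have "A \<inter> (fut -` (D \<times> V) \<inter> space M) = {z \<in> A. x z \<in> V \<and> fst (fut z) \<in> D}"
      using Asp by (auto simp: fut_def)
    also have "prob \<dots> / prob A = measure (cond_law A) V * measure bern D"
      by (simp add: invariant_indep_future[OF A V D] m[OF V])
    finally show "emeasure bern D * emeasure (cond_law A) V = emeasure (distr ?U (bern \<Otimes>\<^sub>M borel) fut) (D \<times> V)"
      by (simp add: d.emeasure_eq_measure N.emeasure_eq_measure bern_prob.emeasure_eq_measure ennreal_mult mult.commute)
  qed
  show "prob {z \<in> A. fut z \<in> W} = prob A * measure (bern \<Otimes>\<^sub>M cond_law A) W"
    if W: "W \<in> sets (bern \<Otimes>\<^sub>M borel)" for W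
  proof -
    have "measure (bern \<Otimes>\<^sub>M cond_law A) W = measure ?U (fut -` W \<inter> space M)"
      unfolding dfut[symmetric] by (subst measure_distr[OF futU W]) simp
    also have "\<dots> = prob (A \<inter> (fut -` W \<inter> space M)) / prob A"
      by (rule mU[OF measurable_sets[OF fut_measurable W]])
    also have "A \<inter> (fut -` W \<inter> space M) = {z \<in> A. fut z \<in> W}" using Asp by auto
    finally show ?thesis using pos by simp
  qed
  have "push (cond_law A) = cond_law A"
  proof (rule measure_eqI)
    show "sets (push (cond_law A)) = sets (cond_law A)" by (simp add: push_def cond_law_def)
    fix V assume "V \<in> sets (push (cond_law A))"
    then have V: "V \<in> sets borel" by (simp add: push_def)
    interpret P: real_distribution "push (cond_law A)"
      by (rule real_distribution_push[OF N.real_distribution_axioms])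
    have sm: "(\<lambda>p. snd (step p)) \<in> borel_measurable (bern \<Otimes>\<^sub>M borel)"
      by (rule measurable_compose[OF step_measurable measurable_snd])
    have "push (cond_law A) = distr (distr ?U (bern \<Otimes>\<^sub>M borel) fut) borel (\<lambda>p. snd (step p))"
      unfolding push_def dfut ..
    also have "\<dots> = distr ?U borel ((\<lambda>p. snd (step p)) \<circ> fut)"
      by (rule distr_distr[OF sm futU])
    finally have "measure (push (cond_law A)) V = measure ?U (((\<lambda>p. snd (step p)) \<circ> fut) -` V \<inter> space M)"
      by (simp only: measure_distr[OF measurable_comp[OF futU sm] V]) simp
    also have "((\<lambda>p. snd (step p)) \<circ> fut) -` V \<inter> space M = T -` (x -` V \<inter> space M) \<inter> space M"
      using x_iter[of _ 1] T_space by auto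
    also have "measure ?U \<dots> = prob (A \<inter> (T -` (x -` V \<inter> space M) \<inter> space M)) / prob A"
      by (rule mU) (intro measurable_sets[OF T_measurable] measurable_sets[OF x_measurable] V)
    \<comment> \<open>Invariance turns the intersection with \<open>A\<close> into a full preimage,
      to which preservation of measure applies.\<close>
    also have "A \<inter> (T -` (x -` V \<inter> space M) \<inter> space M) = (T ^^ 1) -` (A \<inter> (x -` V \<inter> space M)) \<inter> space M"
      using A(2) by auto
    also have "prob \<dots> = prob (A \<inter> (x -` V \<inter> space M))"
      by (rule measure_T_vimage) (intro sets.Int A measurable_sets[OF x_measurable] V)
    also have "A \<inter> (x -` V \<inter> space M) = {z \<in> A. x z \<in> V}" using Asp by auto
    finally show "emeasure (push (cond_law A)) V = emeasure (cond_law A) V"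
      by (simp add: P.emeasure_eq_measure N.emeasure_eq_measure m[OF V])
  qed
  then show "stationary (cond_law A)"
    by (simp add: stationary_def N.real_distribution_axioms)
qed

text \<open>\<open>A\<close> and its complement exhibit \<open>\<nu>\<close> as a proper mixture of
  two stationary laws. Extremality makes both equal to \<open>\<nu>\<close>, so \<open>A\<close> is
  independent of \<open>fut\<close>, then of every cylinder, and by approximation of itself:
  \<open>prob A = prob A * prob A\<close>.\<close>

lemma ergodic_of_extremal:
  assumes ext: "extremal \<nu>" and A: "A \<in> sets M" "T -` A \<inter> space M = A"
  shows "prob A = 0 \<or> prob A = 1"
proof (rule ccontr)
  assume "\<not> (prob A = 0 \<or> prob A = 1)"
  then have a: "0 < prob A" "prob A < 1"
    using prob_le_1[of A] by (auto simp: less_le)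
  let ?A' = "space M - A"
  have A': "?A' \<in> sets M" "T -` ?A' \<inter> space M = ?A'" using A T_space by auto
  have a': "prob ?A' = 1 - prob A" by (rule prob_compl[OF A(1)])
  then have pos': "0 < prob ?A'" using a by simp
  interpret \<nu>: real_distribution \<nu> by (rule real_distribution_\<nu>)
  interpret N: real_distribution "cond_law A" using stationary_cond_law[OF A a(1)] by (simp add: stationary_def)
  have mix: "measure \<nu> U = prob A * measure (cond_law A) U + (1 - prob A) * measure (cond_law ?A') U"
    if U: "U \<in> sets borel" for U
  proof -
    have "measure \<nu> U = measure (bern \<Otimes>\<^sub>M \<nu>) (space bern \<times> U)"
      using U by (simp add: measure_def \<nu>.emeasure_pair_measure_Times bern_prob.emeasure_space_1 del: space_bern)
    also have "\<dots> = prob {z \<in> space M. fut z \<in> space bern \<times> U}"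
      by (rule measure_fut[symmetric]) (use U in \<open>intro pair_measureI sets.top\<close>)
    also have "{z \<in> space M. fut z \<in> space bern \<times> U} = {z \<in> A. x z \<in> U} \<union> {z \<in> ?A'. x z \<in> U}"
      using sets.sets_into_space[OF A(1)] by (auto simp: fut_def)
    also have "prob \<dots> = prob {z \<in> A. x z \<in> U} + prob {z \<in> ?A'. x z \<in> U}"
    proof (rule finite_measure_Union)
      have xm: "x -` U \<inter> space M \<in> sets M" by (rule measurable_sets[OF x_measurable U])
      have "{z \<in> A. x z \<in> U} = A \<inter> (x -` U \<inter> space M)" "{z \<in> ?A'. x z \<in> U} = ?A' \<inter> (x -` U \<inter> space M)"
        using sets.sets_into_space[OF A(1)] by auto
      then show "{z \<in> A. x z \<in> U} \<in> sets M" "{z \<in> ?A'. x z \<in> U} \<in> sets M"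
        using xm A(1) A'(1) by (simp_all only: sets.Int)
    qed auto
    finally show ?thesis
      using a pos' by (simp add: measure_cond_law[OF A a(1) U] measure_cond_law[OF A' pos' U] a')
  qed
  have eq: "cond_law A = cond_law ?A'"
    using ext stationary_cond_law[OF A a(1)] stationary_cond_law[OF A' pos'] a mix
    unfolding extremal_def by blast
  have "cond_law A = \<nu>"
  proof (rule measure_eqI)
    fix U assume "U \<in> sets (cond_law A)"
    then have "U \<in> sets borel" by simp
    then have "measure \<nu> U = measure (cond_law A) U"
      by (simp add: mix eq[symmetric] algebra_simps)
    then show "emeasure (cond_law A) U = emeasure \<nu> U"
      by (simp add: N.emeasure_eq_measure \<nu>.emeasure_eq_measure)
  qed simp
  then have fut_indep: "prob {z \<in> A. fut z \<in> W} = prob A * prob {z \<in> space M. fut z \<in> W}"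
    if "W \<in> sets (bern \<Otimes>\<^sub>M borel)" for W
    using prob_invariant_fut[OF A a(1) that] measure_fut[OF that] by simp
  have "\<bar>prob A - prob A * prob A\<bar> \<le> 0 + e" if "0 < e" for e
  proof -
    have e: "0 < e / 2" using that by simp
    obtain m E B where B: "finite E" "B \<in> cylinders m E" "prob (sym_diff A B) < e / 2"
      using cylinder_approximation[OF A(1) e] .
    have Bm: "B \<in> sets M" by (rule cylinders_sets[OF B(2,1)])
    obtain W where W: "W \<in> sets (bern \<Otimes>\<^sub>M borel)"
      and TW: "(T ^^ m) -` B \<inter> space M = {z \<in> space M. fut z \<in> W}"
      by (rule cylinder_future[OF B(2,1)])
    \<comment> \<open>\<open>B\<close> involves past symbols, but its preimage under
      \<open>T ^^ m\<close> does not, and \<open>A\<close> is unchanged by taking this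
      preimage.\<close>
    have "prob (A \<inter> B) = prob ((T ^^ m) -` (A \<inter> B) \<inter> space M)"
      by (rule measure_T_vimage[symmetric]) (use A Bm in auto)
    also have "(T ^^ m) -` (A \<inter> B) \<inter> space M = {z \<in> A. fut z \<in> W}"
      using invariant_vimage_iter[OF A, of m] TW by blast
    also have "prob \<dots> = prob A * prob {z \<in> space M. fut z \<in> W}" by (rule fut_indep[OF W])
    also have "prob {z \<in> space M. fut z \<in> W} = prob B"
      unfolding TW[symmetric] by (rule measure_T_vimage[OF Bm])
    finally have AB: "prob (A \<inter> B) = prob A * prob B" .
    have "\<bar>prob (A \<inter> A) - prob (B \<inter> A)\<bar> \<le> e / 2" "\<bar>prob (A \<inter> space M) - prob (B \<inter> space M)\<bar> \<le> e / 2"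
      using abs_measure_diff_le_sym_diff[OF A(1) Bm A(1)] abs_measure_diff_le_sym_diff[OF A(1) Bm sets.top] B(3) by simp_all
    then have 1: "\<bar>prob A - prob (A \<inter> B)\<bar> \<le> e / 2" and 2: "\<bar>prob A - prob B\<bar> \<le> e / 2"
      using A(1) Bm by (simp_all add: Int_commute)
    have "\<bar>prob A * prob A - prob A * prob B\<bar> \<le> \<bar>prob A - prob B\<bar>"
      unfolding right_diff_distrib[symmetric] abs_mult by (rule mult_left_le_one_le) auto
    then show ?thesis using 1 2 AB by linarith
  qed
  then have "\<bar>prob A - prob A * prob A\<bar> \<le> 0" by (rule field_le_epsilon)
  then have "prob A * (1 - prob A) = 0" by (simp add: algebra_simps)
  then show False using a by simp
qed

end

section \<open>Entropy\<close>

text \<open>Fekete's argument: divide \<open>n\<close> by a \<open>k\<close> at which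
  \<open>a k / k\<close> is close to the infimum. The remainders are bounded by the constant
  \<open>C\<close>, which disappears after division by \<open>n\<close>.\<close>

lemma subadditive_convergent:
  fixes a :: "nat \<Rightarrow> real"
  assumes sub: "\<And>m n. a (m + n) \<le> a m + a n" and nonneg: "\<And>n. 0 \<le> a n"
  shows "convergent (\<lambda>n. a n / real n)"
proof -
  define c where "c = (INF n\<in>{1..}. a n / real n)"
  have bb: "bdd_below ((\<lambda>n. a n / real n) ` {1..})"
    by (rule bdd_belowI[of _ 0]) (auto intro: divide_nonneg_nonneg nonneg)
  have ge: "c \<le> a n / real n" if "1 \<le> n" for n
    unfolding c_def by (rule cINF_lower[OF bb]) (use that in simp)
  have mult: "a (q * k + r) \<le> real q * a k + a r" for q k r
  proof (induction q)
    case (Suc q)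
    have "a (Suc q * k + r) \<le> a k + a (q * k + r)"
      using sub[of k "q * k + r"] by (simp add: ac_simps)
    with Suc show ?case by (simp add: algebra_simps)
  qed simp
  have "(\<lambda>n. a n / real n) \<longlonglongrightarrow> c"
  proof (rule LIMSEQ_I)
    fix e :: real assume e: "0 < e"
    have "c < c + e / 2" using e by simp
    then obtain k where k: "1 \<le> k" "a k / real k < c + e / 2"
      unfolding c_def by (subst (asm) cINF_less_iff[OF _ bb]) auto
    define C where "C = (\<Sum>r<k. a r)"
    have C: "a r \<le> C" if "r < k" for r
      unfolding C_def using that nonneg by (intro member_le_sum) auto
    have C0: "0 \<le> C" unfolding C_def by (intro sum_nonneg nonneg)
    obtain N where N: "2 * C / e < real N" using reals_Archimedean2 by blast
    have "norm (a n / real n - c) < e" if "max 1 N \<le> n" for n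
    proof -
      have n: "0 < real n" "N \<le> n" using that by auto
      have "a n \<le> real (n div k) * a k + a (n mod k)"
        using mult[of "n div k" k "n mod k"] by simp
      also have "\<dots> \<le> real (n div k) * a k + C"
        using C[of "n mod k"] k(1) by simp
      also have "real (n div k) * a k \<le> (real n / real k) * a k"
      proof (rule mult_right_mono[OF _ nonneg])
        have "real (n div k * k) \<le> real n" by (simp only: of_nat_le_iff div_times_less_eq_dividend)
        then show "real (n div k) \<le> real n / real k" using k(1) by (simp add: pos_le_divide_eq)
      qed
      also have "\<dots> = real n * (a k / real k)" by simp
      also have "\<dots> \<le> real n * (c + e / 2)" using k(2) n by (intro mult_left_mono) auto
      finally have "a n \<le> real n * (c + e / 2) + C" by simp
      then have "a n / real n \<le> c + e / 2 + C / real n"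
        using n by (simp add: field_simps)
      moreover have "C / real n < e / 2"
      proof -
        have "2 * C < e * real N" using N e by (simp add: field_simps)
        also have "\<dots> \<le> e * real n" using n e by (intro mult_left_mono) auto
        finally show ?thesis using n by (simp add: field_simps)
      qed
      ultimately have "a n / real n < c + e" by linarith
      moreover have "c \<le> a n / real n" using ge[of n] that by simp
      ultimately show ?thesis unfolding real_norm_def using e by linarith
    qed
    then show "\<exists>no. \<forall>n\<ge>no. norm (a n / real n - c) < e" by blast
  qed
  then show ?thesis by (rule convergentI)
qed

text \<open>The inequality \<open>ln y \<le> y - 1\<close> at \<open>y = 1 / sqrt p\<close>. The
  bound increases with \<open>p\<close> and vanishes at 0, as needed for labels of small
  probability.\<close>

lemma entropy_summand_le: "- (p * ln p) \<le> 2 * sqrt p" if "0 \<le> p" for p :: real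
proof (cases "p = 0")
  case False
  then have p: "0 < p" using that by simp
  have "ln (1 / sqrt p) \<le> 1 / sqrt p - 1" using p by (intro ln_le_minus_one) simp
  then have "- ln p \<le> 2 / sqrt p"
    using p by (simp add: ln_div ln_sqrt)
  then have "p * (- ln p) \<le> p * (2 / sqrt p)" using p by (intro mult_left_mono) auto
  also have "p * (2 / sqrt p) = 2 * (p / sqrt p)" by simp
  also have "p / sqrt p = sqrt p" using p by (simp add: real_div_sqrt)
  finally show ?thesis by simp
qed simp

text \<open>The same inequality at \<open>y = 1 / p\<close>, useful for a label of probability close
  to 1.\<close>

lemma entropy_summand_le_compl: "- (p * ln p) \<le> 1 - p" if "0 \<le> p" for p :: real
proof (cases "p = 0")
  case False
  then have p: "0 < p" using that by simp
  have "ln (1 / p) \<le> 1 / p - 1" using p by (intro ln_le_minus_one) simp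
  then have "p * (- ln p) \<le> p * (1 / p - 1)" using p by (intro mult_left_mono) (auto simp: ln_div)
  also have "\<dots> = 1 - p" using p by (simp add: field_simps)
  finally show ?thesis by simp
qed simp

section \<open>Entropy of finite-valued labels\<close>

context prob_space
begin

text \<open>Partitions are handled as fibers of functions, so that joins become pairs and the
  inequalities for entropies of random variables apply.\<close>

definition label_partition :: "('a \<Rightarrow> 'b) \<Rightarrow> 'a set set" where
  "label_partition X = (\<lambda>l. X -` {l} \<inter> space M) ` (X ` space M)"

definition label_entropy :: "('a \<Rightarrow> 'b) \<Rightarrow> real" where
  "label_entropy X = - (\<Sum>l\<in>X ` space M. prob (X -` {l} \<inter> space M) * ln (prob (X -` {l} \<inter> space M)))"

lemma partition_entropy_label: "partition_entropy M (label_partition X) = label_entropy X"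
proof -
  have "inj_on (\<lambda>l. X -` {l} \<inter> space M) (X ` space M)"
    by (rule inj_onI) auto
  then show ?thesis
    unfolding partition_entropy_def label_partition_def label_entropy_def
    by (simp add: sum.reindex)
qed

lemma label_entropy_eq_sum:
  assumes "finite R" "X ` space M \<subseteq> R"
  shows "label_entropy X = (\<Sum>l\<in>R. - (prob (X -` {l} \<inter> space M) * ln (prob (X -` {l} \<inter> space M))))"
proof -
  have "X -` {l} \<inter> space M = {}" if "l \<notin> X ` space M" for l using that by auto
  then show ?thesis
    unfolding label_entropy_def sum_negf[symmetric]
    by (intro sum.mono_neutral_left assms) auto
qed

lemma label_entropy_nonneg: "0 \<le> label_entropy X"
  unfolding label_entropy_def sum_negf[symmetric]
proof (rule sum_nonneg)
  fix l
  let ?p = "prob (X -` {l} \<inter> space M)"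
  show "0 \<le> - (?p * ln ?p)"
  proof (cases "?p = 0")
    case False
    then have "0 < ?p" using measure_nonneg[of M "X -` {l} \<inter> space M"] by linarith
    then have "ln ?p \<le> 0" by (simp add: prob_le_1)
    then show ?thesis using \<open>0 < ?p\<close> by (simp add: mult_le_0_iff)
  qed simp
qed

text \<open>Base \<open>exp 1\<close> makes the information-theoretic entropy use the natural
  logarithm.\<close>

lemma information_space_exp: "information_space M (exp 1)"
  by unfold_locales simp

lemma label_entropy_eq:
  assumes "simple_function M X"
  shows "entropy (exp 1) (count_space (X ` space M)) X = label_entropy X"
proof -
  interpret information_space M "exp 1" by (rule information_space_exp)
  show ?thesis
    using entropy_simple_distributed[OF simple_distributedI[OF assms measure_nonneg refl]]
    by (simp add: label_entropy_def log_def)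
qed

lemma label_entropy_compose_le:
  assumes "simple_function M X"
  shows "label_entropy (f \<circ> X) \<le> label_entropy X"
proof -
  interpret information_space M "exp 1" by (rule information_space_exp)
  have "simple_function M (f \<circ> X)" using assms by (rule simple_function_compose)
  then show ?thesis
    using entropy_data_processing[OF assms, of f] by (simp only: label_entropy_eq assms)
qed

lemma label_entropy_cong:
  assumes "\<And>z. z \<in> space M \<Longrightarrow> X z = Y z"
  shows "label_entropy X = label_entropy Y"
proof -
  have "X ` space M = Y ` space M" using assms by (rule image_cong[OF refl])
  moreover have "X -` {l} \<inter> space M = Y -` {l} \<inter> space M" for l using assms by auto
  ultimately show ?thesis by (simp add: label_entropy_def)
qed

lemma label_entropy_determined_le:
  assumes "simple_function M X" "\<And>z. z \<in> space M \<Longrightarrow> Y z = f (X z)"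
  shows "label_entropy Y \<le> label_entropy X"
  using label_entropy_compose_le[OF assms(1), of f] label_entropy_cong[of Y "f \<circ> X"] assms(2) by simp

lemma label_entropy_pair_le:
  assumes "simple_function M X" "simple_function M Y"
  shows "label_entropy (\<lambda>z. (X z, Y z)) \<le> label_entropy X + label_entropy Y"
proof -
  interpret information_space M "exp 1" by (rule information_space_exp)
  show ?thesis
    using entropy_chain_rule[OF assms] conditional_entropy_less_eq_entropy[OF assms(2,1)]
    by (simp add: label_entropy_eq assms simple_function_Pair)
qed

lemma label_entropy_le_card:
  assumes "simple_function M X"
  shows "label_entropy X \<le> ln (card (X ` space M))"
proof -
  interpret information_space M "exp 1" by (rule information_space_exp)
  show ?thesis
    using entropy_le_card[OF simple_distributedI[OF assms measure_nonneg refl]]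
    by (simp add: label_entropy_eq assms log_def)
qed

text \<open>Each point is labelled by the cell that contains it.\<close>

lemma ex_label_partition:
  assumes "finite_partition M P"
  obtains X :: "'a \<Rightarrow> 'a set" where "simple_function M X" "P = label_partition X"
proof
  have P: "finite P" "P \<subseteq> sets M" "\<Union>P = space M" "disjoint P" "{} \<notin> P"
    using assms by (auto simp: finite_partition_def partition_on_def)
  define X where "X z = (THE A. A \<in> P \<and> z \<in> A)" for z
  have X: "X z = A" if "A \<in> P" "z \<in> A" for z A
    unfolding X_def using that P(4) by (intro the_equality) (auto simp: disjoint_def)
  have Xsp: "X ` space M = P"
  proof (intro equalityI subsetI)
    fix A assume "A \<in> X ` space M"
    then obtain z where "z \<in> space M" "A = X z" by auto
    moreover obtain A' where "A' \<in> P" "z \<in> A'" using \<open>z \<in> space M\<close> P(3) by auto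
    ultimately show "A \<in> P" using X by auto
  next
    fix A assume A: "A \<in> P"
    then have "A \<noteq> {}" using P(5) by auto
    then obtain z where "z \<in> A" by auto
    then show "A \<in> X ` space M" using X[OF A, of z] A P(3) by auto
  qed
  have v: "X -` {A} \<inter> space M = A" if "A \<in> P" for A
  proof (intro equalityI subsetI)
    fix z assume z: "z \<in> X -` {A} \<inter> space M"
    then obtain A' where "A' \<in> P" "z \<in> A'" using P(3) by auto
    then show "z \<in> A" using X[of A' z] z by auto
  next
    fix z assume "z \<in> A"
    then show "z \<in> X -` {A} \<inter> space M" using X[OF that, of z] that P(3) by auto
  qed
  show "simple_function M X"
    unfolding simple_function_def Xsp using P v by auto
  show "P = label_partition X"
    unfolding label_partition_def Xsp using v by simp
qed

lemma finite_partition_label: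
  assumes "simple_function M X"
  shows "finite_partition M (label_partition X)"
  using assms unfolding finite_partition_def label_partition_def partition_on_def simple_function_def
  by (auto simp: disjoint_def)

end

section \<open>Itineraries and entropy rates\<close>

context invariant_system
begin

lemma simple_function_iter:
  assumes "simple_function M X"
  shows "simple_function M (X \<circ> (T ^^ k))"
  unfolding simple_function_def
proof (intro conjI ballI)
  have "(X \<circ> (T ^^ k)) ` space M \<subseteq> X ` space M" using T_iter_space by auto
  then show "finite ((X \<circ> (T ^^ k)) ` space M)"
    using assms finite_subset by (auto simp: simple_function_def)
  fix l
  have "X -` {l} \<inter> space M \<in> sets M" using simple_functionD(2)[OF assms] .
  then have "(T ^^ k) -` (X -` {l} \<inter> space M) \<inter> space M \<in> sets M"
    by (rule measurable_sets[OF T_iter_measurable])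
  also have "(T ^^ k) -` (X -` {l} \<inter> space M) \<inter> space M = (X \<circ> (T ^^ k)) -` {l} \<inter> space M"
    using T_iter_space by auto
  finally show "(X \<circ> (T ^^ k)) -` {l} \<inter> space M \<in> sets M" .
qed

lemma label_entropy_iter:
  assumes "simple_function M X"
  shows "label_entropy (X \<circ> (T ^^ k)) = label_entropy X"
proof -
  have "finite (X ` space M)" using assms by (simp add: simple_function_def)
  moreover have "(X \<circ> (T ^^ k)) ` space M \<subseteq> X ` space M" using T_iter_space by auto
  moreover have "prob ((X \<circ> (T ^^ k)) -` {l} \<inter> space M) = prob (X -` {l} \<inter> space M)" for l
  proof -
    have "(X \<circ> (T ^^ k)) -` {l} \<inter> space M = (T ^^ k) -` (X -` {l} \<inter> space M) \<inter> space M"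
      using T_iter_space by auto
    then show ?thesis using measure_T_vimage[OF simple_functionD(2)[OF assms]] by simp
  qed
  ultimately show ?thesis
    by (simp only: label_entropy_eq_sum order_refl)
qed

definition itinerary :: "('a \<Rightarrow> 'b) \<Rightarrow> nat \<Rightarrow> 'a \<Rightarrow> 'b list" where
  "itinerary X n z = map (\<lambda>k. X ((T ^^ k) z)) [0..<n]"

lemma length_itinerary [simp]: "length (itinerary X n z) = n"
  by (simp add: itinerary_def)

lemma nth_itinerary [simp]: "k < n \<Longrightarrow> itinerary X n z ! k = X ((T ^^ k) z)"
  by (simp add: itinerary_def)

lemma itinerary_Suc: "itinerary X (Suc n) z = itinerary X n z @ [X ((T ^^ n) z)]"
  by (simp add: itinerary_def)

lemma itinerary_add: "itinerary X (m + n) z = itinerary X m z @ itinerary X n ((T ^^ m) z)"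
  by (rule nth_equalityI)
     (auto simp: nth_append funpow_add[symmetric, THEN fun_cong, unfolded o_def])

lemma simple_function_itinerary:
  assumes "simple_function M X"
  shows "simple_function M (itinerary X n)"
proof (induction n)
  case 0
  show ?case by (simp add: itinerary_def[abs_def])
next
  case (Suc n)
  have "itinerary X (Suc n) = (\<lambda>p. fst p @ [snd p]) \<circ> (\<lambda>z. (itinerary X n z, (X \<circ> (T ^^ n)) z))"
    by (simp add: fun_eq_iff itinerary_Suc)
  then show ?case
    by (simp only: simple_function_compose simple_function_Pair Suc simple_function_iter assms)
qed

text \<open>Nonempty cells of the join correspond to the itineraries that actually occur; the
  removal of the empty set in \<open>partition_join\<close> matches the restriction to attained
  labels.\<close>

lemma dynamical_partition_label:
  "dynamical_partition M T (label_partition X) n = label_partition (itinerary X n)"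
proof (induction n)
  case 0
  show ?case using not_empty by (auto simp: label_partition_def itinerary_def)
next
  case (Suc n)
  let ?Y = "itinerary X n"
  have "partition_join (label_partition ?Y) ((\<lambda>A. (T ^^ n) -` A \<inter> space M) ` label_partition X)
      = label_partition (itinerary X (Suc n))" (is "?L = ?R")
  proof (intro equalityI subsetI)
    fix C assume "C \<in> ?L"
    then obtain l l' where C: "C = (?Y -` {l} \<inter> space M) \<inter> ((T ^^ n) -` (X -` {l'} \<inter> space M) \<inter> space M)" "C \<noteq> {}"
      unfolding partition_join_def label_partition_def by blast
    then obtain z where z: "z \<in> C" by auto
    have "C = itinerary X (Suc n) -` {itinerary X (Suc n) z} \<inter> space M"
      using z C(1) T_iter_space by (auto simp: itinerary_Suc)
    then show "C \<in> ?R" using z C(1) unfolding label_partition_def by blast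
  next
    fix C assume "C \<in> ?R"
    then obtain z where z: "z \<in> space M" and C: "C = itinerary X (Suc n) -` {itinerary X (Suc n) z} \<inter> space M"
      by (auto simp: label_partition_def)
    have "C = (?Y -` {?Y z} \<inter> space M) \<inter> ((T ^^ n) -` (X -` {X ((T ^^ n) z)} \<inter> space M) \<inter> space M)"
      using C T_iter_space by (auto simp: itinerary_Suc)
    moreover have "?Y -` {?Y z} \<inter> space M \<in> label_partition ?Y"
      using z by (auto simp: label_partition_def)
    moreover have "X -` {X ((T ^^ n) z)} \<inter> space M \<in> label_partition X"
      using T_iter_space[OF z] by (auto simp: label_partition_def)
    moreover have "z \<in> C" using z C by simp
    ultimately show "C \<in> ?L" unfolding partition_join_def by blast
  qed
  then show ?case using Suc by simp
qed

text \<open>An itinerary of length \<open>m + n\<close> is a concatenation whose second part has, by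
  invariance, the entropy of an itinerary of length \<open>n\<close>. This gives subadditivity, so
  the \<open>lim\<close> in the definition is a genuine limit.\<close>

lemma entropy_wrt_label:
  assumes "simple_function M X"
  shows "(\<lambda>n. label_entropy (itinerary X n) / real n) \<longlonglongrightarrow> entropy_wrt_partition M T (label_partition X)"
proof -
  have "label_entropy (itinerary X (m + n)) \<le> label_entropy (itinerary X m) + label_entropy (itinerary X n)" for m n
  proof -
    let ?P = "\<lambda>z. (itinerary X m z, (itinerary X n \<circ> (T ^^ m)) z)"
    have s: "simple_function M (itinerary X m)" "simple_function M (itinerary X n \<circ> (T ^^ m))"
      by (intro simple_function_itinerary simple_function_iter assms)+
    have "label_entropy (itinerary X (m + n)) \<le> label_entropy ?P"
      by (rule label_entropy_determined_le[OF simple_function_Pair[OF s], where f="\<lambda>(u, v). u @ v"])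
         (simp add: itinerary_add)
    also have "\<dots> \<le> label_entropy (itinerary X m) + label_entropy (itinerary X n \<circ> (T ^^ m))"
      by (rule label_entropy_pair_le[OF s])
    finally show ?thesis by (simp only: label_entropy_iter[OF simple_function_itinerary[OF assms]])
  qed
  then have "convergent (\<lambda>n. label_entropy (itinerary X n) / real n)"
    by (rule subadditive_convergent) (rule label_entropy_nonneg)
  then show ?thesis
    by (simp add: entropy_wrt_partition_def dynamical_partition_label partition_entropy_label convergent_LIMSEQ_iff)
qed

lemma label_entropy_itinerary_le:
  assumes "simple_function M X"
  shows "label_entropy (itinerary X n) \<le> n * label_entropy X"
proof (induction n)
  case 0
  have "itinerary X 0 ` space M = {[]}" using not_empty by (auto simp: itinerary_def)
  moreover have "itinerary X 0 -` {[]} \<inter> space M = space M" by (auto simp: itinerary_def)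
  ultimately show ?case by (simp add: label_entropy_def prob_space)
next
  case (Suc n)
  let ?P = "\<lambda>z. (itinerary X n z, (X \<circ> (T ^^ n)) z)"
  have s: "simple_function M (itinerary X n)" "simple_function M (X \<circ> (T ^^ n))"
    by (intro simple_function_itinerary simple_function_iter assms)+
  have "label_entropy (itinerary X (Suc n)) \<le> label_entropy ?P"
    by (rule label_entropy_determined_le[OF simple_function_Pair[OF s], where f="\<lambda>(u, v). u @ [v]"])
       (simp add: itinerary_Suc)
  also have "\<dots> \<le> label_entropy (itinerary X n) + label_entropy (X \<circ> (T ^^ n))"
    by (rule label_entropy_pair_le[OF s])
  also have "\<dots> \<le> n * label_entropy X + label_entropy X"
    using Suc by (simp add: label_entropy_iter[OF assms])
  finally show ?case by (simp add: algebra_simps)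
qed

text \<open>The error label \<open>W\<close> marks the points where the guess \<open>h \<circ> Q\<close> of \<open>X\<close> is wrong.\<close>

lemma label_entropy_itinerary_le_guess:
  assumes X: "simple_function M X" and Q: "simple_function M Q"
    and wrong: "prob {z \<in> space M. h (Q z) \<noteq> X z} \<le> q"
  shows "label_entropy (itinerary X n) \<le> label_entropy (itinerary Q n) + n * (q + card (X ` space M) * (2 * sqrt q))"
proof -
  define W where "W z = (if h (Q z) = X z then None else Some (X z))" for z
  have XQ: "simple_function M (\<lambda>z. (X z, Q z))" by (rule simple_function_Pair[OF X Q])
  have "W = (\<lambda>(a, b). if h b = a then None else Some a) \<circ> (\<lambda>z. (X z, Q z))"
    by (auto simp: W_def fun_eq_iff)
  then have W: "simple_function M W" by (simp only: simple_function_compose XQ)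
  let ?R = "insert None (Some ` X ` space M)"
  have finX: "finite (X ` space M)" using X by (simp add: simple_function_def)
  have wm: "{z \<in> space M. h (Q z) \<noteq> X z} \<in> sets M"
  proof -
    have "{z \<in> space M. h (Q z) \<noteq> X z} = space M - (W -` {None} \<inter> space M)"
      by (auto simp: W_def split: if_splits)
    then show ?thesis using simple_functionD(2)[OF W, of "{None}"] by auto
  qed
  let ?p = "\<lambda>l. prob (W -` {l} \<inter> space M)"
  have "label_entropy W = (\<Sum>l\<in>?R. - (?p l * ln (?p l)))"
    by (rule label_entropy_eq_sum) (use finX in \<open>auto simp: W_def\<close>)
  also have "\<dots> = - (?p None * ln (?p None)) + (\<Sum>l\<in>X ` space M. - (?p (Some l) * ln (?p (Some l))))"
    using finX by (simp add: sum.reindex)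
  \<comment> \<open>A correct guess has probability at least \<open>1 - q\<close>, so its summand is
    at most \<open>q\<close>; each error label has probability at most \<open>q\<close> and is
    bounded through the square root.\<close>
  also have "\<dots> \<le> q + (\<Sum>l\<in>X ` space M. 2 * sqrt q)"
  proof (intro add_mono sum_mono)
    have "W -` {None} \<inter> space M = space M - {z \<in> space M. h (Q z) \<noteq> X z}"
      by (auto simp: W_def split: if_splits)
    then have "?p None = 1 - prob {z \<in> space M. h (Q z) \<noteq> X z}"
      by (simp only: prob_compl[OF wm])
    then show "- (?p None * ln (?p None)) \<le> q"
      using entropy_summand_le_compl[of "?p None"] wrong by simp
    fix l
    have "?p (Some l) \<le> prob {z \<in> space M. h (Q z) \<noteq> X z}"
      by (rule finite_measure_mono[OF _ wm]) (auto simp: W_def split: if_splits)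
    then have "sqrt (?p (Some l)) \<le> sqrt q" using wrong by simp
    then show "- (?p (Some l) * ln (?p (Some l))) \<le> 2 * sqrt q"
      using entropy_summand_le[OF measure_nonneg, of M "W -` {Some l} \<inter> space M"] by linarith
  qed
  finally have HW: "label_entropy W \<le> q + card (X ` space M) * (2 * sqrt q)" by simp
  let ?P = "\<lambda>z. (itinerary Q n z, itinerary W n z)"
  have s: "simple_function M (itinerary Q n)" "simple_function M (itinerary W n)"
    by (intro simple_function_itinerary Q W)+
  have "label_entropy (itinerary X n) \<le> label_entropy ?P"
  proof (rule label_entropy_determined_le[OF simple_function_Pair[OF s]])
    \<comment> \<open>The itinerary of \<open>X\<close> is decoded from the guesses, corrected
      wherever the error label is not \<open>None\<close>.\<close>
    fix z
    show "itinerary X n z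
        = (\<lambda>(u, v). map (\<lambda>k. case v ! k of None \<Rightarrow> h (u ! k) | Some l \<Rightarrow> l) [0..<n]) (itinerary Q n z, itinerary W n z)"
      by (rule nth_equalityI) (auto simp: W_def)
  qed
  also have "\<dots> \<le> label_entropy (itinerary Q n) + label_entropy (itinerary W n)"
    by (rule label_entropy_pair_le[OF s])
  also have "label_entropy (itinerary W n) \<le> n * label_entropy W"
    by (rule label_entropy_itinerary_le[OF W])
  also have "\<dots> \<le> n * (q + card (X ` space M) * (2 * sqrt q))"
    by (rule mult_left_mono[OF HW]) simp
  finally show ?thesis by simp
qed

end

lemma card_image_le_determined:
  assumes fin: "finite (c ` A)"
    and det: "\<And>z z'. z \<in> A \<Longrightarrow> z' \<in> A \<Longrightarrow> c z = c z' \<Longrightarrow> f z = f z'"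
  shows "card (f ` A) \<le> card (c ` A)"
proof -
  have "f z = f (inv_into A c (c z))" if "z \<in> A" for z
  proof (rule det[OF that])
    have "c z \<in> c ` A" using that by (rule imageI)
    then show "inv_into A c (c z) \<in> A" "c z = c (inv_into A c (c z))"
      by (rule inv_into_into, simp only: f_inv_into_f)
  qed
  then have "f ` A = (\<lambda>y. f (inv_into A c y)) ` c ` A"
    unfolding image_image by (rule image_cong[OF refl])
  then show ?thesis using card_image_le[OF fin] by metis
qed

text \<open>On \<open>U\<close> each \<open>D i\<close> is an initial or a final segment. After
  complementing those that are not initial, the traces form a chain of subsets of \<open>I\<close>,
  and a chain has at most one member of each cardinality from 0 to \<open>card I\<close>.\<close>

lemma card_traces_le:
  fixes D :: "'i \<Rightarrow> real set"
  assumes I: "finite I"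
    and mon: "\<And>i. i \<in> I \<Longrightarrow> (\<forall>s\<in>U. \<forall>t\<in>U. s \<le> t \<longrightarrow> t \<in> D i \<longrightarrow> s \<in> D i) \<or>
      (\<forall>s\<in>U. \<forall>t\<in>U. s \<le> t \<longrightarrow> s \<in> D i \<longrightarrow> t \<in> D i)"
  shows "card ((\<lambda>t. {i \<in> I. t \<in> D i}) ` U) \<le> card I + 1"
proof -
  define down where "down i \<longleftrightarrow> (\<forall>s\<in>U. \<forall>t\<in>U. s \<le> t \<longrightarrow> t \<in> D i \<longrightarrow> s \<in> D i)" for i
  define c where "c t = {i \<in> I. if down i then t \<in> D i else t \<notin> D i}" for t
  have anti: "c t \<subseteq> c s" if "s \<in> U" "t \<in> U" "s \<le> t" for s t
  proof
    fix i assume i: "i \<in> c t"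
    show "i \<in> c s"
    proof (cases "down i")
      case True
      then have "t \<in> D i \<longrightarrow> s \<in> D i" using that unfolding down_def by blast
      then show ?thesis using i True by (simp add: c_def)
    next
      case False
      then have "s \<in> D i \<longrightarrow> t \<in> D i" using that mon[of i] i unfolding c_def down_def by blast
      then show ?thesis using i False by (simp add: c_def)
    qed
  qed
  have fin: "finite (c t)" and sub: "c t \<subseteq> I" for t
    using I by (auto simp: c_def)
  have "inj_on card (c ` U)"
  proof (rule inj_onI, clarify)
    fix s t assume st: "s \<in> U" "t \<in> U" "card (c s) = card (c t)"
    have "c s \<subseteq> c t \<or> c t \<subseteq> c s" using anti st linear[of s t] by blast
    then show "c s = c t" using card_subset_eq[OF fin] st(3) by metis
  qed
  then have "card (c ` U) = card (card ` c ` U)" by (simp add: card_image)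
  also have "\<dots> \<le> card {..card I}"
    using card_mono[OF I sub] by (intro card_mono) auto
  finally have cU: "card (c ` U) \<le> card I + 1" by simp
  have eq: "(\<lambda>t. {i \<in> I. t \<in> D i}) ` U = (\<lambda>C. {i \<in> I. if down i then i \<in> C else i \<notin> C}) ` c ` U"
    unfolding image_image by (rule image_cong) (auto simp: c_def)
  have "finite (c ` U)" using finite_subset[of "c ` U" "Pow I"] sub I by auto
  then show ?thesis unfolding eq by (rule order_trans[OF card_image_le cU])
qed

section \<open>Counting orbit codes over monotone fiber maps\<close>

locale monotone_coded_system = coded_system +
  assumes g_monotone: "mono_on {0..1} (g i) \<or> antimono_on {0..1} (g i)"
begin

lemma step_iter_monotone:
  "mono_on {0..1} (\<lambda>t. snd ((step ^^ k) (\<omega>, t))) \<or> antimono_on {0..1} (\<lambda>t. snd ((step ^^ k) (\<omega>, t)))"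
proof (induction k)
  case 0
  show ?case by (simp add: monotone_on_def)
next
  case (Suc k)
  let ?G = "\<lambda>t. snd ((step ^^ k) (\<omega>, t))"
  have eq: "(\<lambda>t. snd ((step ^^ Suc k) (\<omega>, t))) = (\<lambda>t. g (\<omega> k) (?G t))"
    by (simp add: step_def step_iter_fst)
  have r: "?G t \<in> {0..1}" if "t \<in> {0..1}" for t
    using that g_range by (cases k) (auto simp: step_def)
  show ?case
    unfolding eq using Suc g_monotone[of "\<omega> k"] r
    by (elim disjE) (auto simp: monotone_on_def)
qed

text \<open>The range of times covers the window of radius \<open>m\<close> around every time
  \<open>k < n\<close>.\<close>

definition word :: "nat \<Rightarrow> nat \<Rightarrow> 'a \<Rightarrow> int \<Rightarrow> nat" where
  "word m n z = restrict (w z) {- int m..<int (n + m)}"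

definition bits :: "real set \<Rightarrow> nat \<Rightarrow> 'a \<Rightarrow> (nat \<times> real) set" where
  "bits E n z = {kq \<in> {..<n} \<times> E. x ((T ^^ fst kq) z) \<le> snd kq}"

lemma finite_word_card: "finite (word m n ` space M)" "card (word m n ` space M) \<le> 3 ^ (n + 2 * m)"
proof -
  let ?J = "{- int m..<int (n + m)}"
  have sub: "word m n ` space M \<subseteq> ?J \<rightarrow>\<^sub>E {0, 1, 2}"
    unfolding image_subset_iff word_def restrict_PiE_iff using w_range by blast
  have fin: "finite (?J \<rightarrow>\<^sub>E {0, 1, 2 :: nat})" by (intro finite_PiE) auto
  show "finite (word m n ` space M)" by (rule finite_subset[OF sub fin])
  have "card (word m n ` space M) \<le> card (?J \<rightarrow>\<^sub>E {0, 1, 2 :: nat})" by (rule card_mono[OF fin sub])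
  also have "\<dots> = 3 ^ card ?J" by (simp add: card_PiE numeral_3_eq_3)
  also have "card ?J = n + 2 * m" by (simp add: nat_add_distrib)
  finally show "card (word m n ` space M) \<le> 3 ^ (n + 2 * m)" .
qed

text \<open>Once the word is fixed, the fiber value at time \<open>k\<close> is a fixed monotone
  function of the initial one. Each of the \<open>n * card E\<close> threshold conditions therefore
  cuts out an initial or final segment of \<open>[0,1]\<close>.\<close>

lemma card_bits_word_le:
  assumes "finite E"
  shows "card (bits E n ` {z \<in> space M. word m n z = v}) \<le> n * card E + 1"
proof -
  let ?I = "{..<n} \<times> E"
  let ?D = "\<lambda>(k, q). {t. snd ((step ^^ k) ((\<lambda>i. v (int i)), t)) \<le> q}"
  have "bits E n z = {i \<in> ?I. x z \<in> ?D i}" if z: "z \<in> space M" "word m n z = v" for z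
  proof -
    have "x ((T ^^ k) z) = snd ((step ^^ k) ((\<lambda>i. v (int i)), x z))" if "k < n" for k
    proof -
      have "snd ((step ^^ k) (fut z)) = snd ((step ^^ k) ((\<lambda>i. v (int i)), x z))"
        unfolding fut_def using that z(2) by (intro step_iter_cong) (auto simp: word_def)
      then show ?thesis by (simp add: x_iter[OF z(1)])
    qed
    then show ?thesis by (auto simp: bits_def)
  qed
  then have "bits E n ` {z \<in> space M. word m n z = v} \<subseteq> (\<lambda>t. {i \<in> ?I. t \<in> ?D i}) ` {0..1}"
    using x_range by auto
  moreover have fin: "finite ((\<lambda>t. {i \<in> ?I. t \<in> ?D i}) ` {0..1})"
    by (rule finite_subset[of _ "Pow ?I"]) (use assms in auto)
  ultimately have "card (bits E n ` {z \<in> space M. word m n z = v}) \<le> card ((\<lambda>t. {i \<in> ?I. t \<in> ?D i}) ` {0..1})"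
    by (rule card_mono[rotated])
  also have "\<dots> \<le> card ?I + 1"
  proof (rule card_traces_le)
    show "finite ?I" using assms by simp
    fix i assume "i \<in> ?I"
    show "(\<forall>s\<in>{0..1}. \<forall>t\<in>{0..1}. s \<le> t \<longrightarrow> t \<in> ?D i \<longrightarrow> s \<in> ?D i) \<or>
        (\<forall>s\<in>{0..1}. \<forall>t\<in>{0..1}. s \<le> t \<longrightarrow> s \<in> ?D i \<longrightarrow> t \<in> ?D i)"
      using step_iter_monotone[of "fst i" "\<lambda>i. v (int i)"]
      by (cases i) (auto simp: monotone_on_def intro: order_trans)
  qed
  finally show ?thesis by (simp add: card_cartesian_product)
qed

lemma card_code_le:
  assumes E: "finite E"
  shows "finite ((\<lambda>z. (word m n z, bits E n z)) ` space M)"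
    and "card ((\<lambda>z. (word m n z, bits E n z)) ` space M) \<le> 3 ^ (n + 2 * m) * (n * card E + 1)"
proof -
  let ?B = "\<lambda>v. bits E n ` {z \<in> space M. word m n z = v}"
  have finB: "finite (?B v)" for v
    by (rule finite_subset[of _ "Pow ({..<n} \<times> E)"]) (use E in \<open>auto simp: bits_def\<close>)
  have sub: "(\<lambda>z. (word m n z, bits E n z)) ` space M \<subseteq> Sigma (word m n ` space M) ?B" by auto
  have fin: "finite (Sigma (word m n ` space M) ?B)"
    by (intro finite_SigmaI finite_word_card finB)
  show "finite ((\<lambda>z. (word m n z, bits E n z)) ` space M)" by (rule finite_subset[OF sub fin])
  have "card ((\<lambda>z. (word m n z, bits E n z)) ` space M) \<le> card (Sigma (word m n ` space M) ?B)"
    by (rule card_mono[OF fin sub])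
  also have "\<dots> = (\<Sum>v\<in>word m n ` space M. card (?B v))"
    by (rule card_SigmaI) (auto simp: finite_word_card finB)
  also have "\<dots> \<le> (\<Sum>v\<in>word m n ` space M. n * card E + 1)"
    by (intro sum_mono card_bits_word_le E)
  also have "\<dots> \<le> 3 ^ (n + 2 * m) * (n * card E + 1)"
    unfolding sum_constant by (intro mult_right_mono) (auto simp: finite_word_card)
  finally show "card ((\<lambda>z. (word m n z, bits E n z)) ` space M) \<le> 3 ^ (n + 2 * m) * (n * card E + 1)" .
qed

lemma cylinder_determined:
  assumes B: "B \<in> cylinders m E" and z: "z \<in> space M" "z' \<in> space M"
    and code: "word m n z = word m n z'" "bits E n z = bits E n z'" and k: "k < n"
  shows "(T ^^ k) z \<in> B \<longleftrightarrow> (T ^^ k) z' \<in> B"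
proof -
  obtain S where S: "cylindrical m E S" and B: "B = {z \<in> space M. x z \<in> S (w z)}"
    using B by (auto simp: cylinders_def)
  have wj: "w z j = w z' j" if "j \<in> {- int m..<int (n + m)}" for j
    using fun_cong[OF code(1), of j] that by (simp add: word_def)
  have "w z (j + int k) = w z' (j + int k)" if "\<bar>j\<bar> \<le> int m" for j
    by (rule wj) (use that k in auto)
  then have "S (w ((T ^^ k) z)) = S (w ((T ^^ k) z'))"
    by (intro cylindricalD(1)[OF S]) (simp add: w_iter z)
  moreover have "x ((T ^^ k) z) \<le> q \<longleftrightarrow> x ((T ^^ k) z') \<le> q" if "q \<in> E" for q
    using code(2) that k unfolding bits_def set_eq_iff by force
  then have "x ((T ^^ k) z) \<in> S (w ((T ^^ k) z')) \<longleftrightarrow> x ((T ^^ k) z') \<in> S (w ((T ^^ k) z'))"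
    by (rule cylindricalD(2)[OF S])
  ultimately show ?thesis using T_iter_space z by (simp add: B)
qed

text \<open>The cells of \<open>X\<close> are approximated by cylinders, and \<open>Q\<close>
  records which of these a point meets. The word and the threshold bits determine the itinerary of
  \<open>Q\<close>, so it takes at most \<open>3 ^ (n + 2 * m')\<close> times a linear factor many
  values, of exponential rate \<open>ln 3\<close>. Wrong guesses cost at most \<open>e\<close> per
  step.\<close>

lemma entropy_le_ln_3:
  fixes X :: "'a \<Rightarrow> 'l"
  assumes X: "simple_function M X"
  shows "entropy_wrt_partition M T (label_partition X) \<le> ln 3"
proof (rule field_le_epsilon)
  fix e :: real assume e: "0 < e"
  have finX: "finite (X ` space M)" using X by (simp add: simple_function_def)
  define r where "r = real (card (X ` space M))"
  \<comment> \<open>The cost per step of an error probability \<open>q\<close> tends to 0 with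
    \<open>q\<close>, so some \<open>q\<close> costs less than \<open>e\<close>.\<close>
  have "((\<lambda>q. q + r * (2 * sqrt q)) \<longlongrightarrow> 0 + r * (2 * sqrt 0)) (at_right 0)"
    by (intro tendsto_intros)
  then have "\<forall>\<^sub>F q in at_right 0. q + r * (2 * sqrt q) < e"
    using e by (intro order_tendstoD(2)[where y="0 + r * (2 * sqrt 0)"]) auto
  then obtain d where d: "0 < d" "\<And>q. 0 < q \<Longrightarrow> q < d \<Longrightarrow> q + r * (2 * sqrt q) < e"
    by (auto simp: eventually_at_right_field)
  define q where "q = d / 2"
  have q: "0 < q" "q + r * (2 * sqrt q) < e" using d by (auto simp: q_def)
  let ?A = "\<lambda>l. X -` {l} \<inter> space M"
  \<comment> \<open>The tolerance is chosen so that the errors of the \<open>r\<close> cells add up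
    to at most \<open>q\<close>; \<open>r + 1\<close> rules out a zero denominator.\<close>
  have "\<exists>m E B. finite E \<and> B \<in> cylinders m E \<and> prob (sym_diff (?A l) B) < q / (r + 1)" for l
  proof -
    have "0 < q / (r + 1)" using q(1) by (simp add: r_def add_nonneg_pos)
    then show ?thesis
      using cylinder_approximation[OF simple_functionD(2)[OF X, of "{l}"]] by metis
  qed
  then obtain m E B where B: "\<And>l. finite (E l)" "\<And>l. B l \<in> cylinders (m l) (E l)"
      "\<And>l. prob (sym_diff (?A l) (B l)) < q / (r + 1)" by metis
  define m' where "m' = Max (insert 0 (m ` X ` space M))"
  define E' where "E' = (\<Union>l\<in>X ` space M. E l)"
  have E': "finite E'" unfolding E'_def by (intro finite_UN_I finX B(1))
  have B': "B l \<in> cylinders m' E'" if "l \<in> X ` space M" for l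
  proof -
    have "m l \<le> m'" unfolding m'_def using finX that by (intro Max_ge) auto
    moreover have "E l \<subseteq> E'" unfolding E'_def using that by auto
    ultimately show ?thesis using B(2)[of l] cylinders_mono by blast
  qed
  have Bm: "B l \<in> sets M" for l by (rule cylinders_sets[OF B(2,1)])
  define Q where "Q z = {l \<in> X ` space M. z \<in> B l}" for z
  \<comment> \<open>Off the symmetric differences \<open>Q z\<close> is the singleton
    \<open>{X z}\<close>, where the choice is forced; elsewhere the guess is arbitrary.\<close>
  define h where "h C = (SOME l. l \<in> C)" for C :: "'l set"
  have Q: "simple_function M Q"
    unfolding simple_function_def
  proof (intro conjI ballI)
    have "Q ` space M \<subseteq> Pow (X ` space M)" by (auto simp: Q_def)
    then show "finite (Q ` space M)" by (rule finite_subset) (simp add: finX)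
    fix C
    have "Q z = C \<longleftrightarrow> C \<subseteq> X ` space M \<and> (\<forall>l\<in>X ` space M. z \<in> B l \<longleftrightarrow> l \<in> C)" for z
      unfolding Q_def set_eq_iff mem_Collect_eq subset_iff by meson
    then have "Q -` {C} \<inter> space M = {z \<in> space M. C \<subseteq> X ` space M \<and> (\<forall>l\<in>X ` space M. z \<in> B l \<longleftrightarrow> l \<in> C)}"
      by (simp only: vimage_def Int_def mem_Collect_eq singleton_iff conj_commute)
    also have "\<dots> \<in> sets M"
    proof (intro sets.sets_Collect_conj sets.sets_Collect_const sets.sets_Collect_finite_All[OF _ finX])
      fix l
      have "{z \<in> space M. z \<in> B l \<longleftrightarrow> l \<in> C} = (if l \<in> C then B l else space M - B l)"
        using sets.sets_into_space[OF Bm[of l]] by auto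
      then show "{z \<in> space M. z \<in> B l \<longleftrightarrow> l \<in> C} \<in> sets M" using Bm by simp
    qed
    finally show "Q -` {C} \<inter> space M \<in> sets M" .
  qed
  have "prob {z \<in> space M. h (Q z) \<noteq> X z} \<le> prob (\<Union>l\<in>X ` space M. sym_diff (?A l) (B l))"
  proof (rule finite_measure_mono)
    show "{z \<in> space M. h (Q z) \<noteq> X z} \<subseteq> (\<Union>l\<in>X ` space M. sym_diff (?A l) (B l))"
    proof (rule subsetI, rule ccontr)
      fix z assume z: "z \<in> {z \<in> space M. h (Q z) \<noteq> X z}" and "z \<notin> (\<Union>l\<in>X ` space M. sym_diff (?A l) (B l))"
      then have zs: "z \<in> space M" and iff: "\<And>l. l \<in> X ` space M \<Longrightarrow> X z = l \<longleftrightarrow> z \<in> B l" by blast+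
      have "Q z = {X z}"
      proof (intro equalityI subsetI)
        fix l assume "l \<in> Q z"
        then show "l \<in> {X z}" using iff[of l] by (simp add: Q_def)
      next
        fix l assume "l \<in> {X z}"
        then show "l \<in> Q z" using iff[of l] zs by (simp add: Q_def)
      qed
      then show False using z by (simp add: h_def)
    qed
    show "(\<Union>l\<in>X ` space M. sym_diff (?A l) (B l)) \<in> sets M"
      using finX Bm simple_functionD(2)[OF X] by (intro sets.finite_UN sets.Un sets.Diff) auto
  qed
  also have "\<dots> \<le> (\<Sum>l\<in>X ` space M. prob (sym_diff (?A l) (B l)))"
    using Bm simple_functionD(2)[OF X]
    by (intro finite_measure_subadditive_finite finX) (auto intro!: sets.Un sets.Diff)
  also have "\<dots> \<le> (\<Sum>l\<in>X ` space M. q / (r + 1))"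
    by (intro sum_mono less_imp_le B(3))
  also have "\<dots> = r * q / (r + 1)" by (simp add: r_def)
  also have "\<dots> \<le> q" using q(1) by (simp add: r_def field_simps)
  finally have wrong: "prob {z \<in> space M. h (Q z) \<noteq> X z} \<le> q" .
  have HQ: "label_entropy (itinerary Q n) \<le> (n + 2 * m') * ln 3 + ln (n * card E' + 1)" for n
  proof -
    let ?code = "\<lambda>z. (word m' n z, bits E' n z)"
    have det: "itinerary Q n z = itinerary Q n z'"
      if "z \<in> space M" "z' \<in> space M" "?code z = ?code z'" for z z'
    proof (rule nth_equalityI)
      fix k assume "k < length (itinerary Q n z)"
      then have k: "k < n" by simp
      have "(T ^^ k) z \<in> B l \<longleftrightarrow> (T ^^ k) z' \<in> B l" if "l \<in> X ` space M" for l
        by (rule cylinder_determined[OF B'[OF that] _ _ _ _ k]) (use \<open>z \<in> space M\<close> \<open>z' \<in> space M\<close> \<open>?code z = ?code z'\<close> in auto)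
      then show "itinerary Q n z ! k = itinerary Q n z' ! k" using k by (auto simp: Q_def)
    qed simp
    have "card (itinerary Q n ` space M) \<le> card (?code ` space M)"
      by (rule card_image_le_determined[OF card_code_le(1)[OF E'] det])
    also have "\<dots> \<le> 3 ^ (n + 2 * m') * (n * card E' + 1)" by (rule card_code_le(2)[OF E'])
    finally have c: "card (itinerary Q n ` space M) \<le> 3 ^ (n + 2 * m') * (n * card E' + 1)" .
    have "finite (itinerary Q n ` space M)" "itinerary Q n ` space M \<noteq> {}"
      using simple_function_itinerary[OF Q] not_empty by (auto simp: simple_function_def)
    then have pos: "0 < card (itinerary Q n ` space M)" by (simp add: card_gt_0_iff)
    have "label_entropy (itinerary Q n) \<le> ln (card (itinerary Q n ` space M))"
      by (rule label_entropy_le_card[OF simple_function_itinerary[OF Q]])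
    also have "\<dots> \<le> ln (real (3 ^ (n + 2 * m') * (n * card E' + 1)))"
    proof (rule ln_mono)
      show "0 < real (card (itinerary Q n ` space M))" using pos by simp
      show "real (card (itinerary Q n ` space M)) \<le> real (3 ^ (n + 2 * m') * (n * card E' + 1))"
        using c by (simp only: of_nat_le_iff)
    qed
    also have "\<dots> = (n + 2 * m') * ln 3 + ln (n * card E' + 1)"
    proof -
      have "ln (real (3 ^ k * N)) = real k * ln 3 + ln (real N)" if "0 < N" for k N :: nat
        using that by (simp add: ln_mult ln_realpow)
      from this[of "n * card E' + 1" "n + 2 * m'"] show ?thesis by (simp only: add_gr_0 zero_less_one simp_thms)
    qed
    finally show ?thesis .
  qed
  have "label_entropy (itinerary X n) / n \<le> ln 3 + 2 * m' * ln 3 / n + (ln n / n + ln (card E' + 1) / n) + e"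
    if n: "1 \<le> n" for n
  proof -
    have "label_entropy (itinerary X n) \<le> (n + 2 * m') * ln 3 + ln (n * card E' + 1) + n * (q + r * (2 * sqrt q))"
      using label_entropy_itinerary_le_guess[OF X Q wrong, of n] HQ[of n] by (simp add: r_def)
    also have "n * (q + r * (2 * sqrt q)) \<le> n * e" using q(2) by (intro mult_left_mono) auto
    \<comment> \<open>For \<open>n \<ge> 1\<close> the linear count is at most a product, whose
      logarithm splits into terms that vanish after division by \<open>n\<close>.\<close>
    also have "ln (n * card E' + 1) \<le> ln (real n * (card E' + 1))"
      using n by (intro ln_mono) (auto simp: algebra_simps add_pos_nonneg)
    also have "\<dots> = ln n + ln (card E' + 1)" using n by (simp add: ln_mult)
    finally have "label_entropy (itinerary X n) \<le> (n + 2 * m') * ln 3 + (ln n + ln (card E' + 1)) + n * e" by simp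
    then have "label_entropy (itinerary X n) / n \<le> ((n + 2 * m') * ln 3 + (ln n + ln (card E' + 1)) + n * e) / n"
      by (rule divide_right_mono) simp
    also have "\<dots> = ln 3 + 2 * m' * ln 3 / n + (ln n / n + ln (card E' + 1) / n) + e"
      using n by (simp add: field_simps)
    finally show ?thesis .
  qed
  moreover have "(\<lambda>n. ln 3 + 2 * m' * ln 3 / real n + (ln (real n) / real n + ln (card E' + 1) / real n) + e)
      \<longlonglongrightarrow> ln 3 + 0 + (0 + 0) + e"
    by (intro tendsto_add tendsto_const lim_ln_over_n lim_const_over_n)
  ultimately show "entropy_wrt_partition M T (label_partition X) \<le> ln 3 + e"
    using LIMSEQ_le[OF entropy_wrt_label[OF X]] by auto
qed

text \<open>The future symbols are Bernoulli by \<open>law\<close>, so every word of length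
  \<open>n\<close> that occurs has probability \<open>(1 / 3) ^ n\<close>, and the entropy of the
  \<open>n\<close>-word is exactly \<open>n * ln 3\<close>.\<close>

lemma entropy_symbol_partition:
  "simple_function M (\<lambda>z. w z 0)" "entropy_wrt_partition M T (label_partition (\<lambda>z. w z 0)) = ln 3"
proof -
  let ?X = "\<lambda>z. w z 0"
  show X: "simple_function M ?X"
    unfolding simple_function_def
  proof (intro conjI ballI)
    have "?X ` space M \<subseteq> {0, 1, 2}" by (rule image_subsetI) (rule w_range)
    then show "finite (?X ` space M)" by (rule finite_subset) simp
    show "?X -` {l} \<inter> space M \<in> sets M" for l by (rule measurable_sets[OF w_measurable]) simp
  qed
  have H: "label_entropy (itinerary ?X n) = n * ln 3" for n
  proof -
    let ?Y = "itinerary ?X n"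
    have p: "prob (?Y -` {l} \<inter> space M) = (1 / 3) ^ n" if l: "l \<in> ?Y ` space M" for l
    proof -
      obtain z where z: "z \<in> space M" and lz: "l = ?Y z" using l by auto
      have len: "length l = n" and sym: "k < n \<Longrightarrow> l ! k \<in> {0, 1, 2}" for k
        using w_range T_iter_space[OF z] by (simp_all add: lz)
      define C where "C = prod_emb UNIV (\<lambda>_. measure_pmf (pmf_of_set {0, 1, 2})) {..<n} (\<Pi>\<^sub>E k\<in>{..<n}. {l ! k})"
      have C_iff: "\<omega> \<in> C \<longleftrightarrow> (\<forall>k<n. \<omega> k = l ! k)" for \<omega>
        by (simp add: C_def prod_emb_iff PiE_iff Ball_def)
      have Cb: "C \<in> sets bern" unfolding bern_def C_def by (rule sets_PiM_I) auto
      have iff: "?Y z = l \<longleftrightarrow> fut z \<in> C \<times> space borel" if "z \<in> space M" for z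
        using that by (simp add: fut_def list_eq_iff_nth_eq len w_iter C_iff mem_Times_iff)
      have "?Y -` {l} \<inter> space M = {z \<in> space M. ?Y z = l}" by (rule set_eqI) (simp add: conj_commute)
      also have "\<dots> = {z \<in> space M. fut z \<in> C \<times> space borel}"
        by (rule Collect_cong, rule conj_cong[OF refl], rule iff)
      finally have "?Y -` {l} \<inter> space M = {z \<in> space M. fut z \<in> C \<times> space borel}" .
      then have "prob (?Y -` {l} \<inter> space M) = measure (bern \<Otimes>\<^sub>M \<nu>) (C \<times> space borel)"
        by (simp only: measure_fut[OF pair_measureI[OF Cb sets.top]])
      also have "\<dots> = measure bern C"
      proof -
        interpret \<nu>: real_distribution \<nu> by (rule real_distribution_\<nu>)
        have "emeasure (bern \<Otimes>\<^sub>M \<nu>) (C \<times> space \<nu>) = emeasure bern C * emeasure \<nu> (space \<nu>)"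
          by (rule \<nu>.emeasure_pair_measure_Times[OF Cb sets.top])
        then show ?thesis
          unfolding \<nu>.emeasure_space_1 by (simp only: measure_def mult_1_right \<nu>.space_eq_univ space_borel)
      qed
      also have "\<dots> = (\<Prod>k\<in>{..<n}. measure (measure_pmf (pmf_of_set {0, 1, 2})) {l ! k})"
        unfolding bern_def C_def by (rule bern.measure_PiM_emb) auto
      also have "\<dots> = (\<Prod>k\<in>{..<n}. 1 / 3)"
        using sym by (intro prod.cong) (auto simp: measure_pmf_single pmf_of_set indicator_def)
      finally show ?thesis by simp
    qed
    have s: "simple_function M ?Y" by (rule simple_function_itinerary[OF X])
    then have fin: "finite (?Y ` space M)" by (simp add: simple_function_def)
    have "(\<Union>l\<in>?Y ` space M. ?Y -` {l} \<inter> space M) = space M" by blast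
    then have "1 = prob (\<Union>l\<in>?Y ` space M. ?Y -` {l} \<inter> space M)"
      by (simp only: prob_space)
    also have "\<dots> = (\<Sum>l\<in>?Y ` space M. prob (?Y -` {l} \<inter> space M))"
      using simple_functionD(2)[OF s] by (intro finite_measure_finite_Union fin) (auto simp: disjoint_family_on_def)
    \<comment> \<open>The words need not be counted: the entropy sum is the total mass 1 times
      \<open>n * ln 3\<close>.\<close>
    finally have sum1: "(\<Sum>l\<in>?Y ` space M. (1 / 3) ^ n) = (1 :: real)" using p by simp
    have "label_entropy ?Y = (\<Sum>l\<in>?Y ` space M. (1 / 3) ^ n) * (n * ln 3)"
      unfolding label_entropy_def sum_negf[symmetric] sum_distrib_right
      by (rule sum.cong) (simp_all add: p ln_realpow ln_div)
    then show ?thesis by (simp only: sum1)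
  qed
  have "(\<lambda>n. label_entropy (itinerary ?X n) / real n) \<longlonglongrightarrow> ln 3"
  proof (rule Lim_transform_eventually[OF tendsto_const])
    show "\<forall>\<^sub>F n in sequentially. ln 3 = label_entropy (itinerary ?X n) / real n"
      using eventually_gt_at_top[of 0] by eventually_elim (simp add: H)
  qed
  then show "entropy_wrt_partition M T (label_partition ?X) = ln 3"
    using entropy_wrt_label[OF X] LIMSEQ_unique by blast
qed

lemma measure_entropy_eq_ln_3: "measure_entropy M T = ereal (ln 3)"
  unfolding measure_entropy_def
proof (rule antisym)
  show "(SUP P\<in>{P. finite_partition M P}. ereal (entropy_wrt_partition M T P)) \<le> ereal (ln 3)"
  proof (rule SUP_least)
    fix P assume "P \<in> {P. finite_partition M P}"
    then obtain X :: "'a \<Rightarrow> 'a set" where "simple_function M X" "P = label_partition X"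
      using ex_label_partition by blast
    then show "ereal (entropy_wrt_partition M T P) \<le> ereal (ln 3)"
      using entropy_le_ln_3 by simp
  qed
  show "ereal (ln 3) \<le> (SUP P\<in>{P. finite_partition M P}. ereal (entropy_wrt_partition M T P))"
    using finite_partition_label[OF entropy_symbol_partition(1)]
    by (intro SUP_upper2[of "label_partition (\<lambda>z. w z 0)"]) (simp_all add: entropy_symbol_partition(2))
qed

end

section \<open>Differentiable fiber maps\<close>

lemma integral_unit_uniform:
  fixes F :: "real \<Rightarrow> real"
  assumes [measurable]: "F \<in> borel_measurable borel" and c: "continuous_on {0..1} F"
  shows "(LINT t|unit_uniform. F t) = integral {0..1} F"
proof -
  have eq: "unit_uniform = density lborel (\<lambda>t. ennreal (indicator {0..1::real} t))"
    unfolding uniform_measure_def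
    by (intro density_cong AE_I2) (auto simp: indicator_def)
  have "(LINT t|unit_uniform. F t) = (LINT t|lborel. indicator {0..1} t *\<^sub>R F t)"
    unfolding eq by (rule integral_density) auto
  also have "\<dots> = (LINT t:{0..1}|lborel. F t)"
    by (simp add: set_lebesgue_integral_def)
  also have "\<dots> = integral {0..1} F"
    by (rule set_borel_integral_eq_integral(2)[OF borel_integrable_atLeastAtMost'[OF c]])
  finally show ?thesis .
qed

definition clamp01 :: "real \<Rightarrow> real" where
  "clamp01 t = max 0 (min 1 t)"

lemma clamp01_range: "clamp01 t \<in> {0..1}"
  by (simp add: clamp01_def)

lemma clamp01_id: "t \<in> {0..1} \<Longrightarrow> clamp01 t = t"
  by (simp add: clamp01_def)

lemma continuous_on_clamp01: "continuous_on UNIV clamp01"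
  unfolding clamp01_def[abs_def] by (intro continuous_intros)

lemma continuous_on_compose_clamp01:
  "continuous_on {0..1} F \<Longrightarrow> continuous_on UNIV (\<lambda>t. F (clamp01 t))"
  by (rule continuous_on_compose2[OF _ continuous_on_clamp01]) (use clamp01_range in auto)

lemma unit_deriv_DERIV:
  assumes "C1_injective_unit_map h" "t \<in> {0..1}"
  shows "(h has_real_derivative unit_deriv h t) (at t within {0..1})"
proof -
  have "h differentiable (at t within {0..1})"
    using assms by (auto simp: C1_injective_unit_map_def differentiable_on_def)
  then have "(h has_vector_derivative vector_derivative h (at t within {0..1})) (at t within {0..1})"
    by (simp add: vector_derivative_works)
  then show ?thesis
    by (simp add: unit_deriv_def has_real_derivative_iff_has_vector_derivative)
qed

lemma continuous_nonvanishing_sign: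
  fixes h :: "real \<Rightarrow> real"
  assumes c: "continuous_on {0..1} h" and nz: "\<And>t. t \<in> {0..1} \<Longrightarrow> h t \<noteq> 0"
  shows "\<exists>e\<in>{-1, 1}. \<forall>t\<in>{0..1}. e * h t = \<bar>h t\<bar>"
proof -
  have "connected (h ` {0..1})" by (rule connected_continuous_image[OF c]) simp
  then have conn: "0 \<in> h ` {0..1}" if "h s < 0" "0 < h t" "s \<in> {0..1}" "t \<in> {0..1}" for s t
    using that unfolding connected_iff_interval by (meson imageI less_imp_le)
  show ?thesis
  proof (cases "\<exists>s\<in>{0..1}. h s < 0")
    case True
    then have "h t < 0" if "t \<in> {0..1}" for t
      using conn[of _ t] nz that by (metis imageE linorder_neqE_linordered_idom)
    then show ?thesis by (intro bexI[of _ "-1"] ballI) (simp_all add: abs_of_neg)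
  next
    case False
    then show ?thesis by (intro bexI[of _ 1]) (auto simp: not_less)
  qed
qed

locale smooth_fibers =
  fixes f :: "nat \<Rightarrow> real \<Rightarrow> real"
  assumes C1: "i \<in> {0, 1, 2} \<Longrightarrow> C1_injective_unit_map (f i)"
    and nonvanishing: "i \<in> {0, 1, 2} \<Longrightarrow> t \<in> {0..1} \<Longrightarrow> unit_deriv (f i) t \<noteq> 0"
begin

text \<open>The values at symbols above \<open>2\<close> and outside \<open>[0,1]\<close> only serve to make \<open>g\<close> and \<open>l\<close> total and
  continuous.\<close>

definition g :: "nat \<Rightarrow> real \<Rightarrow> real" where
  "g i t = f (min i 2) (clamp01 t)"

definition l :: "nat \<Rightarrow> real \<Rightarrow> real" where
  "l i t = ln \<bar>unit_deriv (f (min i 2)) (clamp01 t)\<bar>"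

lemma min2: "min i 2 \<in> {0, 1, 2 :: nat}"
  by auto

lemma unit_deriv_cont: "i \<in> {0, 1, 2} \<Longrightarrow> continuous_on {0..1} (unit_deriv (f i))"
  using C1 by (simp add: C1_injective_unit_map_def)

lemma f_range: "i \<in> {0, 1, 2} \<Longrightarrow> t \<in> {0..1} \<Longrightarrow> f i t \<in> {0..1}"
  using C1[of i] unfolding C1_injective_unit_map_def by blast

sublocale fiber_system g
proof
  show "continuous_on UNIV (g i)" for i
    unfolding g_def[abs_def]
  proof (rule continuous_on_compose_clamp01)
    show "continuous_on {0..1} (f (min i 2))"
      using C1[OF min2] differentiable_imp_continuous_on unfolding C1_injective_unit_map_def by blast
  qed
  show "g i t \<in> {0..1}" for i t
    unfolding g_def by (rule f_range[OF min2 clamp01_range])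
qed

lemma l_cont: "continuous_on UNIV (l i)"
  unfolding l_def[abs_def]
proof (rule continuous_on_compose_clamp01)
  show "continuous_on {0..1} (\<lambda>t. ln \<bar>unit_deriv (f (min i 2)) t\<bar>)"
    using nonvanishing[OF min2] by (intro continuous_intros unit_deriv_cont min2) auto
qed

lemma l_bounded: "\<exists>B. \<forall>i t. \<bar>l i t\<bar> \<le> B"
proof -
  have "\<exists>B. \<forall>t. \<bar>l i t\<bar> \<le> B" for i
  proof -
    have "compact (l i ` {0..1})"
      by (intro compact_continuous_image continuous_on_subset[OF l_cont]) auto
    then obtain B where B: "\<forall>y\<in>l i ` {0..1}. norm y \<le> B"
      using compact_imp_bounded bounded_iff by blast
    have "l i t = l i (clamp01 t)" for t by (simp add: l_def clamp01_def)
    then show ?thesis using B clamp01_range by (metis imageI real_norm_def)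
  qed
  then obtain B where B: "\<And>i t. \<bar>l i t\<bar> \<le> B i" by metis
  have "\<bar>l i t\<bar> \<le> \<bar>B 0\<bar> + \<bar>B 1\<bar> + \<bar>B 2\<bar>" for i t
  proof -
    have "l i t = l (min i 2) t" by (simp add: l_def)
    moreover have "\<bar>l (min i 2) t\<bar> \<le> B (min i 2)" by (rule B)
    moreover have "min i 2 = 0 \<or> min i 2 = 1 \<or> min i 2 = 2" by auto
    ultimately show ?thesis by auto
  qed
  then show ?thesis by blast
qed

lemma ex_sign: "\<exists>e\<in>{-1, 1}. \<forall>t\<in>{0..1}. e * unit_deriv (f (min i 2)) t = exp (l i t)"
proof -
  obtain e where e: "e \<in> {-1, 1}" "\<And>t. t \<in> {0..1} \<Longrightarrow> e * unit_deriv (f (min i 2)) t = \<bar>unit_deriv (f (min i 2)) t\<bar>"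
    using continuous_nonvanishing_sign[OF unit_deriv_cont[OF min2[of i]] nonvanishing[OF min2[of i]]] by blast
  have "exp (l i t) = \<bar>unit_deriv (f (min i 2)) t\<bar>" if "t \<in> {0..1}" for t
    using nonvanishing[OF min2 that, of i] by (simp add: l_def clamp01_id[OF that])
  with e show ?thesis by (intro bexI[of _ e]) auto
qed

text \<open>The constant sign of the derivative of the \<open>i\<close>-th fiber map, which allows
  \<open>exp (l i t)\<close> to replace its absolute value.\<close>

definition e :: "nat \<Rightarrow> real" where
  "e i = (SOME c. c \<in> {-1, 1} \<and> (\<forall>t\<in>{0..1}. c * unit_deriv (f (min i 2)) t = exp (l i t)))"

lemma e: "e i \<in> {-1, 1}" "t \<in> {0..1} \<Longrightarrow> e i * unit_deriv (f (min i 2)) t = exp (l i t)"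
proof -
  have "e i \<in> {-1, 1} \<and> (\<forall>t\<in>{0..1}. e i * unit_deriv (f (min i 2)) t = exp (l i t))"
    unfolding e_def by (rule someI_ex) (use ex_sign[of i] in blast)
  then show "e i \<in> {-1, 1}" "t \<in> {0..1} \<Longrightarrow> e i * unit_deriv (f (min i 2)) t = exp (l i t)"
    by auto
qed

lemma unit_deriv_eq: "t \<in> {0..1} \<Longrightarrow> unit_deriv (f (min i 2)) t = e i * exp (l i t)"
  using e(1)[of i] e(2)[of t i] by auto

lemma g_DERIV:
  assumes "t \<in> {0..1}"
  shows "(g i has_real_derivative e i * exp (l i t)) (at t within {0..1})"
proof -
  have "(f (min i 2) has_real_derivative unit_deriv (f (min i 2)) t) (at t within {0..1})"
    by (rule unit_deriv_DERIV[OF C1[OF min2] assms])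
  then have "(g i has_real_derivative unit_deriv (f (min i 2)) t) (at t within {0..1})"
    by (rule has_field_derivative_transform_within[OF _ zero_less_one assms]) (simp add: g_def clamp01_id)
  then show ?thesis by (simp add: unit_deriv_eq[OF assms])
qed

lemma g_monotone: "mono_on {0..1} (g i) \<or> antimono_on {0..1} (g i)"
proof -
  have inc: "e i * g i s \<le> e i * g i t" if st: "s \<in> {0..1}" "t \<in> {0..1}" "s \<le> t" for s t
  proof -
    have "((\<lambda>r. e i * (e i * exp (l i r))) has_integral e i * g i t - e i * g i s) {s..t}"
    proof (rule fundamental_theorem_of_calculus[OF st(3)])
      fix r assume r: "r \<in> {s..t}"
      then have "r \<in> {0..1}" using st by auto
      then have "(g i has_real_derivative e i * exp (l i r)) (at r within {s..t})"
        using g_DERIV DERIV_subset st by (metis atLeastatMost_subset_iff atLeastAtMost_iff)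
      then have "((\<lambda>r. e i * g i r) has_real_derivative e i * (e i * exp (l i r))) (at r within {s..t})"
        by (rule DERIV_cmult)
      then show "((\<lambda>r. e i * g i r) has_vector_derivative e i * (e i * exp (l i r))) (at r within {s..t})"
        by (simp add: has_real_derivative_iff_has_vector_derivative)
    qed
    moreover have "0 \<le> e i * (e i * exp (l i r))" for r using e(1)[of i] by auto
    ultimately have "0 \<le> e i * g i t - e i * g i s" by (rule has_integral_nonneg)
    then show ?thesis by simp
  qed
  show ?thesis
    using e(1)[of i] inc by (auto simp: monotone_on_def)
qed

text \<open>Along the word, \<open>D n\<close> is the logarithm of the absolute derivative of the
  composition \<open>G n\<close> and \<open>c n\<close> is the sign of that derivative. The sign is
  the same on all of \<open>[0,1]\<close>, so the integral of \<open>exp (D n)\<close> is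
  \<open>c n * (G n 1 - G n 0)\<close>, a difference of two points of \<open>[0,1]\<close>.\<close>

lemma birkhoff_sum_nonpos:
  "(LINT t|unit_uniform. (\<Sum>k<n. l (\<omega> k) (snd ((step ^^ k) (\<omega>, t))))) \<le> 0"
proof -
  define G where "G k t = snd ((step ^^ k) (\<omega>, t))" for k t
  define D where "D k t = (\<Sum>j<k. l (\<omega> j) (G j t))" for k t
  define c where "c k = (\<Prod>j<k. e (\<omega> j))" for k
  have G_Suc: "G (Suc k) = (\<lambda>t. g (\<omega> k) (G k t))" for k
    by (simp add: G_def step_def step_iter_fst fun_eq_iff)
  have G_range: "G k t \<in> {0..1}" if "t \<in> {0..1}" for k t
    using that g_range by (cases k) (simp_all add: G_Suc, simp add: G_def)
  have c: "c k \<in> {-1, 1}" for k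
  proof (induction k)
    case (Suc k)
    then show ?case using e(1)[of "\<omega> k"] by (auto simp: c_def)
  qed (simp add: c_def)
  have G_borel: "G k \<in> borel_measurable borel" for k
  proof -
    have "(\<lambda>t. (\<omega>, t)) \<in> borel \<rightarrow>\<^sub>M bern \<Otimes>\<^sub>M borel" by (rule measurable_Pair1') simp
    then show ?thesis
      unfolding G_def
      by (rule measurable_compose[OF _ measurable_compose[OF step_iter_measurable measurable_snd]])
  qed
  have D_borel: "D k \<in> borel_measurable borel" for k
    unfolding D_def
    by (intro borel_measurable_sum measurable_compose[OF G_borel] borel_measurable_continuous_onI l_cont)
  have der: "(G k has_real_derivative c k * exp (D k t)) (at t within {0..1})" if t: "t \<in> {0..1}" for k t
  proof (induction k)
    case 0
    show ?case by (simp add: G_def c_def D_def)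
  next
    case (Suc k)
    have "(g (\<omega> k) has_real_derivative e (\<omega> k) * exp (l (\<omega> k) (G k t))) (at (G k t) within G k ` {0..1})"
      by (rule DERIV_subset[OF g_DERIV[OF G_range[OF t]]]) (use G_range in auto)
    from DERIV_image_chain[OF this Suc] show ?case
      by (simp add: G_Suc o_def c_def D_def exp_add algebra_simps)
  qed
  have G_cont: "continuous_on {0..1} (G k)" for k
    using der by (intro DERIV_continuous_on)
  have D_cont: "continuous_on {0..1} (D k)" for k
    unfolding D_def
    by (intro continuous_on_sum continuous_on_compose2[OF l_cont G_cont]) auto
  have hi: "((\<lambda>t. c n * exp (D n t)) has_integral G n 1 - G n 0) {0..1}"
    using der by (intro fundamental_theorem_of_calculus)
      (auto simp: has_real_derivative_iff_has_vector_derivative[symmetric])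
  \<comment> \<open>Since \<open>c n\<close> squares to 1, this integrand is
    \<open>exp (D n t) - 1\<close>, which dominates \<open>D n t\<close>.\<close>
  have "((\<lambda>t. c n * (c n * exp (D n t)) - 1) has_integral c n * (G n 1 - G n 0) - 1) {0..1}"
    using has_integral_diff[OF has_integral_mult_right[OF hi, of "c n"] has_integral_const_real[of 1 0 1]] by simp
  moreover have "D n t \<le> c n * (c n * exp (D n t)) - 1" for t
  proof -
    have "c n * (c n * exp (D n t)) = exp (D n t)" using c[of n] by auto
    then show ?thesis using exp_ge_add_one_self[of "D n t"] by linarith
  qed
  moreover have "(D n has_integral integral {0..1} (D n)) {0..1}"
    by (intro integrable_integral integrable_continuous_interval D_cont)
  ultimately have "integral {0..1} (D n) \<le> c n * (G n 1 - G n 0) - 1"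
    by (meson has_integral_le)
  also have "\<dots> \<le> 0"
    using c[of n] G_range[of 0 n] G_range[of 1 n] by auto
  finally have "integral {0..1} (D n) \<le> 0" .
  then show ?thesis
    using integral_unit_uniform[OF D_borel D_cont, of n] by (simp add: D_def G_def)
qed

definition B :: real where "B = (SOME B. \<forall>i t. \<bar>l i t\<bar> \<le> B)"

sublocale fiber_exponent g l B
proof
  show "continuous_on UNIV (l i)" for i by (rule l_cont)
  show "\<bar>l i t\<bar> \<le> B" for i t
    using someI_ex[OF l_bounded] unfolding B_def by blast
qed (rule birkhoff_sum_nonpos)

end

section \<open>The horseshoe\<close>

lemma distr_restrict_space_AE:
  assumes G: "G \<in> sets L" and ae: "AE y in L. y \<in> G" and h: "h \<in> L \<rightarrow>\<^sub>M N"
  shows "distr (restrict_space L G) N h = distr L N h"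
proof (rule measure_eqI)
  show "sets (distr (restrict_space L G) N h) = sets (distr L N h)" by simp
  fix A assume "A \<in> sets (distr (restrict_space L G) N h)"
  then have A: "A \<in> sets N" by simp
  have hG: "h \<in> restrict_space L G \<rightarrow>\<^sub>M N" by (rule measurable_restrict_space1[OF h])
  have Gsp: "G \<subseteq> space L" by (rule sets.sets_into_space[OF G])
  have "emeasure (distr (restrict_space L G) N h) A = emeasure (restrict_space L G) (h -` A \<inter> space (restrict_space L G))"
    by (rule emeasure_distr[OF hG A])
  also have "\<dots> = emeasure L (h -` A \<inter> space (restrict_space L G))"
    using G Gsp by (intro emeasure_restrict_space) (auto simp: space_restrict_space Int_absorb2)
  also have "\<dots> = emeasure L (h -` A \<inter> space L)"
  proof (rule emeasure_eq_AE)
    show "AE y in L. y \<in> h -` A \<inter> space (restrict_space L G) \<longleftrightarrow> y \<in> h -` A \<inter> space L"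
      using ae by eventually_elim (use Gsp in \<open>auto simp: space_restrict_space\<close>)
    show m: "h -` A \<inter> space L \<in> sets L" by (rule measurable_sets[OF h A])
    have "h -` A \<inter> space (restrict_space L G) = (h -` A \<inter> space L) \<inter> G"
      using Gsp by (auto simp: space_restrict_space)
    then show "h -` A \<inter> space (restrict_space L G) \<in> sets L" using sets.Int[OF m G] by simp
  qed
  also have "\<dots> = emeasure (distr L N h) A" by (rule emeasure_distr[OF h A, symmetric])
  finally show "emeasure (distr (restrict_space L G) N h) A = emeasure (distr L N h) A" .
qed

lemma maximal_invariant_set_image:
  assumes "X \<in> maximal_invariant_set T D"
  shows "X \<in> D" "T X \<in> maximal_invariant_set T D"
proof -
  obtain Y where Y: "Y 0 = X" "\<And>n. Y n \<in> D" "\<And>n :: int. Y (n + 1) = T (Y n)"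
    using assms by (auto simp: maximal_invariant_set_def)
  show "X \<in> D" using Y(2)[of 0] Y(1) by simp
  have "Y (0 + 1) = T X" using Y(1) Y(3)[of 0] by simp
  then show "T X \<in> maximal_invariant_set T D"
    unfolding maximal_invariant_set_def mem_Collect_eq
  proof (intro exI[of _ "\<lambda>n. Y (n + 1)"] conjI allI)
    show "Y (0 + 1) = T X" by fact
    show "Y (n + 1) \<in> D" "Y (n + 1 + 1) = T (Y (n + 1))" for n by (rule Y)+
  qed
qed

locale horseshoe_skew = smooth_fibers f
  for f :: "nat \<Rightarrow> real \<Rightarrow> real" +
  fixes \<Phi> :: "real \<times> real \<Rightarrow> real \<times> real"
    and R :: "nat \<Rightarrow> (real \<times> real) set"
    and \<Gamma> :: "(real \<times> real) set"
    and \<pi> :: "real \<times> real \<Rightarrow> int \<Rightarrow> nat"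
    and \<pi>' :: "(int \<Rightarrow> nat) \<Rightarrow> real \<times> real"
  assumes \<Phi>_cont: "continuous_on UNIV \<Phi>"
    and \<Gamma>_eq: "\<Gamma> = maximal_invariant_set \<Phi> (\<Union>i\<in>{0, 1, 2}. R i)"
    and homeo: "homeomorphism \<Gamma> Sigma3 \<pi> \<pi>'"
    and \<pi>_\<Phi>: "X \<in> \<Gamma> \<Longrightarrow> \<pi> (\<Phi> X) = shift (\<pi> X)"
    and R_iff: "X \<in> \<Gamma> \<Longrightarrow> i \<in> {0, 1, 2} \<Longrightarrow> X \<in> R i \<longleftrightarrow> \<pi> X 0 = i"
begin

abbreviation "F \<equiv> skew_product \<Phi> R f"
abbreviation "\<Lambda> \<equiv> skew_Lambda \<Phi> R f"

lemma \<pi>_range: "X \<in> \<Gamma> \<Longrightarrow> \<pi> X \<in> Sigma3"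
  using homeomorphism_image1[OF homeo] by blast

lemma \<pi>'_range: "\<omega> \<in> Sigma3 \<Longrightarrow> \<pi>' \<omega> \<in> \<Gamma>"
  using homeomorphism_image2[OF homeo] by blast

lemma \<pi>'_\<pi>: "X \<in> \<Gamma> \<Longrightarrow> \<pi>' (\<pi> X) = X" and \<pi>_\<pi>': "\<omega> \<in> Sigma3 \<Longrightarrow> \<pi> (\<pi>' \<omega>) = \<omega>"
  using homeo by (simp_all add: homeomorphism_apply1 homeomorphism_apply2)

lemma \<pi>_symbol: "X \<in> \<Gamma> \<Longrightarrow> \<pi> X n \<in> {0, 1, 2}"
  using \<pi>_range[of X] by (simp only: Sigma3_def mem_Collect_eq)

lemma \<Phi>_\<Gamma>: "X \<in> \<Gamma> \<Longrightarrow> \<Phi> X \<in> \<Gamma>"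
  unfolding \<Gamma>_eq by (rule maximal_invariant_set_image(2))

lemma \<Phi>_\<pi>': "\<omega> \<in> Sigma3 \<Longrightarrow> \<Phi> (\<pi>' \<omega>) = \<pi>' (shift \<omega>)"
  using \<pi>'_\<pi>[OF \<Phi>_\<Gamma>[OF \<pi>'_range]] \<pi>_\<Phi>[OF \<pi>'_range] \<pi>_\<pi>' by metis

lemma F_eq:
  assumes "p \<in> \<Gamma>"
  shows "F (p, t) = (\<Phi> p, f (\<pi> p 0) t)"
proof -
  have "(THE i. i \<in> {0, 1, 2} \<and> p \<in> R i) = \<pi> p 0"
  proof (rule the_equality)
    show "\<pi> p 0 \<in> {0, 1, 2} \<and> p \<in> R (\<pi> p 0)"
      using \<pi>_symbol[OF assms] R_iff[OF assms] by blast
    show "i = \<pi> p 0" if "i \<in> {0, 1, 2} \<and> p \<in> R i" for i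
      using R_iff[OF assms, of i] that by blast
  qed
  then show ?thesis by (simp add: skew_product_def)
qed

lemma \<Lambda>D:
  assumes "z \<in> \<Lambda>"
  shows "fst z \<in> \<Gamma>" "snd z \<in> {0..1}" "F z \<in> \<Lambda>"
proof -
  show "F z \<in> \<Lambda>" using assms unfolding skew_Lambda_def by (rule maximal_invariant_set_image(2))
  obtain Y where Y: "Y 0 = z" "\<And>n. Y n \<in> skew_domain R" "\<And>n :: int. Y (n + 1) = F (Y n)"
    using assms by (auto simp: skew_Lambda_def maximal_invariant_set_def)
  show "snd z \<in> {0..1}" using Y(2)[of 0] Y(1) unfolding skew_domain_def by auto
  have "fst (Y n) \<in> (\<Union>i\<in>{0, 1, 2}. R i)" for n using Y(2)[of n] unfolding skew_domain_def by auto
  moreover have "fst (Y (n + 1)) = \<Phi> (fst (Y n))" for n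
    unfolding Y(3) by (simp add: skew_product_def case_prod_beta)
  ultimately show "fst z \<in> \<Gamma>"
    unfolding \<Gamma>_eq maximal_invariant_set_def mem_Collect_eq using Y(1)
    by (intro exI[of _ "\<lambda>n. fst (Y n)"]) simp
qed

lemma F_\<Lambda>:
  assumes "z \<in> \<Lambda>"
  shows "F z = (\<Phi> (fst z), g (\<pi> (fst z) 0) (snd z))"
proof -
  have "min (\<pi> (fst z) 0) 2 = \<pi> (fst z) 0"
    using \<pi>_symbol[OF \<Lambda>D(1)[OF assms], of 0] by auto
  then show ?thesis
    using F_eq[OF \<Lambda>D(1)[OF assms], of "snd z"] by (simp add: g_def clamp01_id[OF \<Lambda>D(2)[OF assms]])
qed

section \<open>Measurability on \<open>\<Lambda>\<close>, and the lift of stationary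
  measures\<close>

abbreviation N where "N \<equiv> restrict_space (borel :: ((real \<times> real) \<times> real) measure) \<Lambda>"

lemma space_N: "space N = \<Lambda>"
  by (simp add: space_restrict_space)

lemma fst_measurable_N: "fst \<in> borel_measurable N"
  by (rule measurable_restrict_space1) (simp flip: borel_prod)

lemma snd_measurable_N: "snd \<in> borel_measurable N"
  by (rule measurable_restrict_space1) (simp flip: borel_prod)

lemma coding_measurable: "(\<lambda>z. \<pi> (fst z) n) \<in> N \<rightarrow>\<^sub>M count_space UNIV"
proof -
  have "\<pi> \<in> borel_measurable (restrict_space borel \<Gamma>)"
    by (rule borel_measurable_continuous_on_restrict) (rule homeomorphism_cont1[OF homeo])
  moreover have "fst \<in> N \<rightarrow>\<^sub>M restrict_space borel \<Gamma>"
    by (rule measurable_restrict_space2[OF _ fst_measurable_N]) (use \<Lambda>D(1) in \<open>auto simp: space_N\<close>)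
  ultimately have "(\<lambda>z. \<pi> (fst z)) \<in> borel_measurable N"
    by (rule measurable_compose[rotated])
  then have "(\<lambda>z. \<pi> (fst z) n) \<in> borel_measurable N"
    by (rule measurable_compose) (rule measurable_product_coordinates)
  then show ?thesis
    unfolding measurable_cong_sets[OF refl sets_borel_eq_count_space] .
qed

lemma F_measurable: "F \<in> N \<rightarrow>\<^sub>M N"
proof (rule measurable_restrict_space2)
  show "F \<in> space N \<rightarrow> \<Lambda>" using \<Lambda>D(3) by (simp add: space_N)
  have "(\<lambda>z. g (\<pi> (fst z) 0) (snd z)) \<in> borel_measurable N"
    by (rule measurable_compose_countable[where f="\<lambda>i z. g i (snd z)", OF _ coding_measurable])
       (rule measurable_compose[OF snd_measurable_N g_measurable])
  moreover have "(\<lambda>z. \<Phi> (fst z)) \<in> borel_measurable N"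
    by (rule measurable_compose[OF fst_measurable_N borel_measurable_continuous_onI[OF \<Phi>_cont]])
  ultimately have "(\<lambda>z. (\<Phi> (fst z), g (\<pi> (fst z) 0) (snd z))) \<in> borel_measurable N"
    by (rule borel_measurable_Pair[rotated])
  then show "F \<in> borel_measurable N"
    by (rule iffD2[OF measurable_cong, rotated]) (simp only: space_N F_\<Lambda>)
qed

lemma decode_measurable:
  assumes "\<And>n. (\<lambda>z. h z n) \<in> K \<rightarrow>\<^sub>M count_space UNIV" and "\<And>z. z \<in> space K \<Longrightarrow> h z \<in> Sigma3"
  shows "(\<lambda>z. \<pi>' (h z)) \<in> borel_measurable K"
proof -
  have "(\<lambda>z. h z n) \<in> borel_measurable K" for n
    using assms(1)[of n] unfolding measurable_cong_sets[OF refl sets_borel_eq_count_space] .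
  then have "h \<in> borel_measurable K" by (rule measurable_coordinatewise_then_product)
  then have "h \<in> K \<rightarrow>\<^sub>M restrict_space borel Sigma3"
    by (intro measurable_restrict_space2) (use assms(2) in auto)
  moreover have "\<pi>' \<in> borel_measurable (restrict_space borel Sigma3)"
    by (rule borel_measurable_continuous_on_restrict) (rule homeomorphism_cont2[OF homeo])
  ultimately show ?thesis by (rule measurable_compose)
qed

text \<open>The identity is measurable from the generated sigma-algebra to the Borel sets: the base
  point is recovered from its symbols through \<open>\<pi>'\<close>, the fiber coordinate from its
  sublevel sets.\<close>

lemma sets_N_generated:
  "sets N \<subseteq> sigma_sets \<Lambda> ({{z \<in> \<Lambda>. \<pi> (fst z) n = i} |n i. True} \<union> {{z \<in> \<Lambda>. snd z \<le> q} |q. True})"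
    (is "_ \<subseteq> sigma_sets \<Lambda> ?G")
proof
  let ?K = "sigma \<Lambda> ?G"
  have GP: "?G \<subseteq> Pow \<Lambda>" by auto
  have spK: "space ?K = \<Lambda>" and setsK: "sets ?K = sigma_sets \<Lambda> ?G"
    using GP by (simp_all add: space_measure_of sets_measure_of)
  have "(\<lambda>z. \<pi> (fst z) n) \<in> ?K \<rightarrow>\<^sub>M count_space UNIV" for n
  proof (subst measurable_count_space_eq2_countable; intro conjI ballI)
    fix i
    have "(\<lambda>z. \<pi> (fst z) n) -` {i} \<inter> space ?K = {z \<in> \<Lambda>. \<pi> (fst z) n = i}"
      unfolding spK by auto
    also have "\<dots> \<in> sets ?K" unfolding setsK by (rule sigma_sets.Basic) blast
    finally show "(\<lambda>z. \<pi> (fst z) n) -` {i} \<inter> space ?K \<in> sets ?K" .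
  qed auto
  then have "(\<lambda>z. \<pi>' (\<pi> (fst z))) \<in> borel_measurable ?K"
    by (rule decode_measurable) (use \<pi>_range \<Lambda>D(1) spK in auto)
  moreover have "\<pi>' (\<pi> (fst z)) = fst z" if "z \<in> space ?K" for z
    using \<pi>'_\<pi> \<Lambda>D(1) that spK by auto
  ultimately have f: "fst \<in> borel_measurable ?K"
    by (subst measurable_cong[where g="\<lambda>z. \<pi>' (\<pi> (fst z))"]) auto
  have s: "snd \<in> borel_measurable ?K"
  proof (rule borel_measurableI_le)
    fix q
    have "{z \<in> \<Lambda>. snd z \<le> q} \<in> sets ?K" unfolding setsK by (rule sigma_sets.Basic) blast
    then show "{z \<in> space ?K. snd z \<le> q} \<in> sets ?K" unfolding spK .
  qed
  have id: "(\<lambda>z. (fst z, snd z)) \<in> borel_measurable ?K"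
    by (rule borel_measurable_Pair[OF f s])
  fix A assume "A \<in> sets N"
  then obtain C where C: "C \<in> sets borel" "A = \<Lambda> \<inter> C" by (auto simp: sets_restrict_space)
  have "A = (\<lambda>z. (fst z, snd z)) -` C \<inter> space ?K" unfolding spK C(2) by auto
  also have "\<dots> \<in> sets ?K" by (rule measurable_sets[OF id C(1)])
  finally show "A \<in> sigma_sets \<Lambda> ?G" unfolding setsK .
qed

lemma central_exponent_integrand:
  assumes "z \<in> \<Lambda>"
  shows "ln (norm (vector_derivative (\<lambda>t. F (fst z, t)) (at (snd z) within {0..1}))) = l (\<pi> (fst z) 0) (snd z)"
proof -
  let ?i = "\<pi> (fst z) 0"
  have p: "fst z \<in> \<Gamma>" and x: "snd z \<in> {0..1}" using \<Lambda>D[OF assms] by auto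
  have i: "?i \<in> {0, 1, 2}" by (rule \<pi>_symbol[OF p])
  have "(f ?i has_vector_derivative unit_deriv (f ?i) (snd z)) (at (snd z) within {0..1})"
    using unit_deriv_DERIV[OF C1[OF i] x] by (simp add: has_real_derivative_iff_has_vector_derivative)
  then have "((\<lambda>t. (\<Phi> (fst z), f ?i t)) has_vector_derivative (0, unit_deriv (f ?i) (snd z))) (at (snd z) within {0..1})"
    by (intro has_vector_derivative_Pair has_vector_derivative_const)
  then have "vector_derivative (\<lambda>t. (\<Phi> (fst z), f ?i t)) (at (snd z) within {0..1}) = (0, unit_deriv (f ?i) (snd z))"
    by (rule vector_derivative_within_closed_interval[OF zero_less_one x])
  moreover have "min ?i 2 = ?i" using i by auto
  ultimately show ?thesis
    by (simp add: F_eq[OF p] l_def clamp01_id[OF x] norm_Pair)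
qed

text \<open>A sample of the natural extension is a bi-infinite \<open>step\<close>-orbit. Its
  successive zeroth symbols are decoded by \<open>\<pi>'\<close> to a base point, and its value at
  time 0 is the fiber coordinate. Shifting the sample corresponds to applying \<open>F\<close>, so
  invariance is inherited.\<close>

lemma ex_lifted_measure:
  assumes st: "stationary \<nu>"
  shows "\<exists>\<mu>. monotone_coded_system g \<mu> F (\<lambda>z. \<pi> (fst z)) snd \<nu> \<and> space \<mu> = \<Lambda> \<and> sets \<mu> = sets N"
proof -
  interpret \<nu>: real_distribution \<nu> using st by (simp add: stationary_def)
  obtain L :: "(int \<Rightarrow> (nat \<Rightarrow> nat) \<times> real) measure"
    where L: "prob_space L" and sL: "sets L = sets (\<Pi>\<^sub>M j\<in>UNIV. bern \<Otimes>\<^sub>M borel)"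
      and comp: "\<And>n. distr L (bern \<Otimes>\<^sub>M borel) (\<lambda>y. y n) = bern \<Otimes>\<^sub>M \<nu>"
      and orb: "\<And>n. AE y in L. y (n + 1) = step (y n)"
      and sh: "distr L L (\<lambda>y n. y (n + 1)) = L"
    apply (rule ex_natural_extension[OF st])
    subgoal premises that for L by (rule that(1)[OF that(2-6)])
    done
  interpret L: prob_space L by (rule L)
  have spL: "space L = UNIV"
    using sets_eq_imp_space_eq[OF sL] by (simp add: space_PiM space_pair_measure)
  have cm: "(\<lambda>y. y n) \<in> L \<rightarrow>\<^sub>M bern \<Otimes>\<^sub>M borel" for n
    unfolding measurable_cong_sets[OF sL refl] by (rule measurable_component_singleton) simp
  have shm: "(\<lambda>y n. y (n + 1)) \<in> L \<rightarrow>\<^sub>M L"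
    unfolding measurable_cong_sets[OF sL sL]
    by (rule measurable_PiM_single') (simp_all add: space_PiM space_pair_measure)
  have sym_m: "(\<lambda>y. fst (y n) k) \<in> L \<rightarrow>\<^sub>M count_space UNIV" for n k
    by (rule measurable_compose[OF measurable_compose[OF cm measurable_fst] measurable_bern_component])
  have val_m: "(\<lambda>y. snd (y n)) \<in> borel_measurable L" for n
    by (rule measurable_compose[OF cm measurable_snd])
  \<comment> \<open>The genuine orbits with admissible symbols and values: a set of full measure,
    invariant under all time shifts. Restricting to it makes \<open>\<Psi>\<close> below map every
    sample, not only almost every one, into \<open>\<Lambda>\<close>.\<close>
  define G where "G = {y \<in> space L. (\<forall>n. y (n + 1) = step (y n)) \<and> (\<forall>n k. fst (y n) k \<in> {0, 1, 2}) \<and> (\<forall>n. snd (y n) \<in> {0..1})}"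
  have G: "G \<in> sets L"
    unfolding G_def
  proof (intro sets.sets_Collect_conj sets.sets_Collect_countable_All)
    show "{y \<in> space L. y (n + 1) = step (y n)} \<in> sets L" for n
      by (rule sets_Collect_eq_bern_real[OF cm measurable_compose[OF cm step_measurable]])
    show "{y \<in> space L. fst (y n) k \<in> {0, 1, 2}} \<in> sets L" for n k
      using measurable_sets[OF sym_m, of "{0,1,2}" n k] by (simp add: vimage_def spL)
    show "{y \<in> space L. snd (y n) \<in> {0..1}} \<in> sets L" for n
      using measurable_sets[OF val_m, of "{0..1}" n] by (simp add: vimage_def spL)
  qed
  have ae: "AE y in L. y \<in> G"
  proof -
    have "AE y in L. \<forall>k. fst (y n) k \<in> {0, 1, 2}" for n
    proof -
      have "AE \<omega> in distr (bern \<Otimes>\<^sub>M \<nu>) bern fst. \<forall>k. \<omega> k \<in> {0, 1, 2}"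
        unfolding \<nu>.distr_pair_fst by (rule AE_bern)
      then have "AE q in bern \<Otimes>\<^sub>M \<nu>. \<forall>k. fst q k \<in> {0, 1, 2}"
        by (rule AE_distrD[OF measurable_fst])
      then have "AE q in distr L (bern \<Otimes>\<^sub>M borel) (\<lambda>y. y n). \<forall>k. fst q k \<in> {0, 1, 2}"
        unfolding comp .
      then show ?thesis by (rule AE_distrD[OF cm])
    qed
    moreover have "AE y in L. snd (y n) \<in> {0..1}" for n
    proof -
      \<comment> \<open>Each state is the image of its predecessor, and every image has its value in
        \<open>[0,1]\<close>.\<close>
      have "AE y in L. y ((n - 1) + 1) = step (y (n - 1))" by (rule orb)
      then show ?thesis by eventually_elim (use g_range in \<open>simp add: step_def\<close>)
    qed
    ultimately have "AE y in L. (\<forall>n. y (n + 1) = step (y n)) \<and> (\<forall>n. \<forall>k. fst (y n) k \<in> {0, 1, 2}) \<and> (\<forall>n. snd (y n) \<in> {0..1})"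
      using orb by (intro AE_conjI) (subst AE_all_countable, blast)+
    then show ?thesis by eventually_elim (simp add: G_def spL)
  qed
  define r where "r = restrict_space L G"
  have spr: "space r = G" by (simp add: r_def space_restrict_space spL)
  have r1: "h \<in> L \<rightarrow>\<^sub>M K \<Longrightarrow> h \<in> r \<rightarrow>\<^sub>M K" for h :: "_ \<Rightarrow> 'k" and K
    unfolding r_def by (rule measurable_restrict_space1)
  interpret r: prob_space r
  proof
    have "emeasure r (space r) = emeasure L G"
      unfolding spr unfolding r_def using G by (intro emeasure_restrict_space) (auto simp: spL)
    also have "\<dots> = 1" using L.emeasure_space_1 ae G by (subst emeasure_eq_AE[where B="space L"]) auto
    finally show "emeasure r (space r) = 1" .
  qed
  define code where "code y = (\<lambda>n. fst (y n) 0)" for y :: "int \<Rightarrow> (nat \<Rightarrow> nat) \<times> real"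
  define \<Psi> where "\<Psi> y = (\<pi>' (code y), snd (y 0))" for y
  have G_D: "y (n + 1) = step (y n)" "fst (y n) k \<in> {0, 1, 2}" "snd (y n) \<in> {0..1}"
    if "y \<in> G" for y n k
    using that unfolding G_def by blast+
  have shG': "(\<lambda>n. y (n + j)) \<in> G" if y: "y \<in> G" for y and j :: int
    unfolding G_def
  proof (intro CollectI conjI allI)
    show "(\<lambda>n. y (n + j)) \<in> space L" by (simp add: spL)
    show "y (n + 1 + j) = step (y (n + j))" for n
      using G_D(1)[OF y, of "n + j"] by (simp add: ac_simps)
    show "fst (y (n + j)) k \<in> {0, 1, 2}" "snd (y (n + j)) \<in> {0..1}" for n k
      by (rule G_D[OF y])+
  qed
  have shG: "(\<lambda>n. y (n + 1)) \<in> G" if "y \<in> G" for y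
    by (rule shG'[OF that])
  have code_Sigma: "code y \<in> Sigma3" if "y \<in> G" for y
    unfolding code_def Sigma3_def mem_Collect_eq by (intro allI G_D(2)[OF that])
  have code_eq: "fst (y n) k = code y (n + int k)" if "y \<in> G" for y n k
  proof (induction k arbitrary: n)
    case (Suc k)
    have "fst (y n) (Suc k) = fst (step (y n)) k" by (simp add: step_def)
    also have "\<dots> = fst (y (n + 1)) k" by (simp only: G_D(1)[OF that])
    finally show ?case by (simp add: Suc algebra_simps)
  qed (simp add: code_def)
  have \<Psi>_F: "F (\<Psi> y) = \<Psi> (\<lambda>n. y (n + 1))" if y: "y \<in> G" for y
  proof -
    have "F (\<Psi> y) = (\<Phi> (\<pi>' (code y)), f (\<pi> (\<pi>' (code y)) 0) (snd (y 0)))"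
      unfolding \<Psi>_def by (rule F_eq[OF \<pi>'_range[OF code_Sigma[OF y]]])
    also have "\<dots> = (\<pi>' (shift (code y)), f (fst (y 0) 0) (snd (y 0)))"
      unfolding \<Phi>_\<pi>'[OF code_Sigma[OF y]] \<pi>_\<pi>'[OF code_Sigma[OF y]] by (simp add: code_def)
    also have "shift (code y) = code (\<lambda>n. y (n + 1))" by (simp add: shift_def code_def)
    also have "f (fst (y 0) 0) (snd (y 0)) = g (fst (y 0) 0) (snd (y 0))"
    proof -
      have "min (fst (y 0) 0) 2 = fst (y 0) 0" using G_D(2)[OF y, of 0 0] by auto
      then show ?thesis by (simp only: g_def clamp01_id[OF G_D(3)[OF y]])
    qed
    also have "\<dots> = snd (y (0 + 1))" unfolding G_D(1)[OF y] by (simp add: step_def)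
    finally show ?thesis by (simp add: \<Psi>_def)
  qed
  have \<Psi>_\<Lambda>: "\<Psi> y \<in> \<Lambda>" if y: "y \<in> G" for y
    unfolding skew_Lambda_def maximal_invariant_set_def mem_Collect_eq
  proof (intro exI[of _ "\<lambda>n. \<Psi> (\<lambda>j. y (j + n))"] conjI allI)
    \<comment> \<open>The complete orbit required by \<open>\<Lambda>\<close> consists of the images
      under \<open>\<Psi>\<close> of all time shifts of \<open>y\<close>.\<close>
    show "\<Psi> (\<lambda>j. y (j + 0)) = \<Psi> y" by simp
    fix n
    have yn: "(\<lambda>j. y (j + n)) \<in> G" by (rule shG'[OF y])
    show "\<Psi> (\<lambda>j. y (j + (n + 1))) = F (\<Psi> (\<lambda>j. y (j + n)))"
      using \<Psi>_F[OF yn] by (simp add: add.assoc add.commute[of 1 n])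
    have p: "\<pi>' (code (\<lambda>j. y (j + n))) \<in> \<Gamma>" by (rule \<pi>'_range[OF code_Sigma[OF yn]])
    have "\<pi>' (code (\<lambda>j. y (j + n))) \<in> (\<Union>i\<in>{0, 1, 2}. R i)"
      using p unfolding \<Gamma>_eq by (rule maximal_invariant_set_image(1))
    moreover have "snd (y (0 + n)) \<in> {0..1}" by (rule G_D(3)[OF y])
    ultimately show "\<Psi> (\<lambda>j. y (j + n)) \<in> skew_domain R"
      unfolding \<Psi>_def skew_domain_def by blast
  qed
  have \<Psi>_m: "\<Psi> \<in> r \<rightarrow>\<^sub>M N"
  proof (rule measurable_restrict_space2)
    show "\<Psi> \<in> space r \<rightarrow> \<Lambda>" using \<Psi>_\<Lambda> by (simp add: spr)
    have "(\<lambda>y. \<pi>' (code y)) \<in> borel_measurable r"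
    proof (rule decode_measurable)
      show "(\<lambda>y. code y n) \<in> r \<rightarrow>\<^sub>M count_space UNIV" for n
        unfolding code_def by (rule r1[OF sym_m])
      show "code y \<in> Sigma3" if "y \<in> space r" for y
        using that unfolding spr by (rule code_Sigma)
    qed
    then show "\<Psi> \<in> borel_measurable r"
      unfolding \<Psi>_def[abs_def] by (rule borel_measurable_Pair[OF _ r1[OF val_m]])
  qed
  have shr: "(\<lambda>y n. y (n + 1)) \<in> r \<rightarrow>\<^sub>M r"
    unfolding r_def by (rule measurable_restrict_space2[OF _ measurable_restrict_space1[OF shm]])
      (use shG in \<open>simp add: space_restrict_space spL\<close>)
  have r_shift: "distr r r (\<lambda>y n. y (n + 1)) = r"
  proof (rule measure_eqI)
    fix A assume "A \<in> sets (distr r r (\<lambda>y n. y (n + 1)))"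
    then have Ar: "A \<in> sets r" by simp
    have AL: "A \<in> sets L" "A \<subseteq> G"
      using Ar G unfolding r_def by (auto simp: sets_restrict_space_iff spL)
    have "emeasure (distr r r (\<lambda>y n. y (n + 1))) A = emeasure (distr r L (\<lambda>y n. y (n + 1))) A"
      using emeasure_distr[OF shr Ar] emeasure_distr[OF r1[OF shm] AL(1)] by simp
    also have "distr r L (\<lambda>y n. y (n + 1)) = L"
      unfolding r_def distr_restrict_space_AE[OF G ae shm] by (rule sh)
    also have "emeasure L A = emeasure r A"
      unfolding r_def using G AL(2) by (intro emeasure_restrict_space[symmetric]) (auto simp: spL)
    finally show "emeasure (distr r r (\<lambda>y n. y (n + 1))) A = emeasure r A" .
  qed simp
  define \<mu> where "\<mu> = distr r N \<Psi>"
  have sp\<mu>: "space \<mu> = \<Lambda>" and s\<mu>: "sets \<mu> = sets N" by (simp_all add: \<mu>_def space_N)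
  have F_m: "F \<in> \<mu> \<rightarrow>\<^sub>M \<mu>" unfolding measurable_cong_sets[OF s\<mu> s\<mu>] by (rule F_measurable)
  have "monotone_coded_system g \<mu> F (\<lambda>z. \<pi> (fst z)) snd \<nu>"
  proof (intro monotone_coded_system.intro coded_system.intro invariant_system.intro
      monotone_coded_system_axioms.intro coded_system_axioms.intro invariant_system_axioms.intro)
    show "fiber_system g" by (rule fiber_system_axioms)
    show "prob_space \<mu>" unfolding \<mu>_def by (rule r.prob_space_distr[OF \<Psi>_m])
    show "F \<in> \<mu> \<rightarrow>\<^sub>M \<mu>" by (rule F_m)
    show "distr \<mu> \<mu> F = \<mu>"
    proof -
      have "distr \<mu> \<mu> F = distr \<mu> N F" by (rule distr_cong[OF refl s\<mu> refl])
      also have "\<dots> = distr r N (F \<circ> \<Psi>)" unfolding \<mu>_def by (rule distr_distr[OF F_measurable \<Psi>_m])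
      also have "\<dots> = distr r N (\<Psi> \<circ> (\<lambda>y n. y (n + 1)))"
        by (rule distr_cong[OF refl refl]) (simp add: \<Psi>_F spr)
      also have "\<dots> = distr (distr r r (\<lambda>y n. y (n + 1))) N \<Psi>" by (rule distr_distr[OF \<Psi>_m shr, symmetric])
      also have "\<dots> = \<mu>" unfolding r_shift \<mu>_def ..
      finally show ?thesis .
    qed
    show "\<pi> (fst (F z)) n = \<pi> (fst z) (n + 1)" if "z \<in> space \<mu>" for z n
      using that \<pi>_\<Phi>[OF \<Lambda>D(1)] by (simp add: sp\<mu> F_\<Lambda> shift_def)
    show "snd (F z) = g (\<pi> (fst z) 0) (snd z)" if "z \<in> space \<mu>" for z
      using that by (simp add: sp\<mu> F_\<Lambda>)
    show "\<pi> (fst z) n \<in> {0, 1, 2}" if "z \<in> space \<mu>" for z n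
      using that by (intro \<pi>_symbol \<Lambda>D(1)) (simp add: sp\<mu>)
    show "snd z \<in> {0..1}" if "z \<in> space \<mu>" for z
      using that by (intro \<Lambda>D(2)) (simp add: sp\<mu>)
    show "(\<lambda>z. \<pi> (fst z) n) \<in> \<mu> \<rightarrow>\<^sub>M count_space UNIV" for n
      unfolding measurable_cong_sets[OF s\<mu> refl] by (rule coding_measurable)
    show "snd \<in> borel_measurable \<mu>"
      unfolding measurable_cong_sets[OF s\<mu> refl] by (rule snd_measurable_N)
    show "sets \<mu> \<subseteq> sigma_sets (space \<mu>)
      ({{z \<in> space \<mu>. \<pi> (fst z) n = i} |n i. True} \<union> {{z \<in> space \<mu>. snd z \<le> q} |q. True})"
      unfolding sp\<mu> s\<mu> by (rule sets_N_generated)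
    show "stationary \<nu>" by (rule st)
    show "mono_on {0..1} (g i) \<or> antimono_on {0..1} (g i)" for i by (rule g_monotone)
    show "distr \<mu> (bern \<Otimes>\<^sub>M borel) (\<lambda>z. (\<lambda>n. \<pi> (fst z) (int n), snd z)) = bern \<Otimes>\<^sub>M \<nu>"
    proof -
      let ?h = "\<lambda>z. (\<lambda>n. \<pi> (fst z) (int n), snd z)"
      have hm: "?h \<in> N \<rightarrow>\<^sub>M bern \<Otimes>\<^sub>M borel"
        by (intro measurable_Pair measurable_bernI coding_measurable snd_measurable_N)
      have "distr \<mu> (bern \<Otimes>\<^sub>M borel) ?h = distr r (bern \<Otimes>\<^sub>M borel) (?h \<circ> \<Psi>)"
        unfolding \<mu>_def by (rule distr_distr[OF hm \<Psi>_m])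
      also have "\<dots> = distr r (bern \<Otimes>\<^sub>M borel) (\<lambda>y. y 0)"
      proof (rule distr_cong[OF refl refl])
        fix y assume "y \<in> space r"
        then have y: "y \<in> G" by (simp add: spr)
        \<comment> \<open>The state at time 0 already lists all future symbols, so the future of the
          lifted point is \<open>y 0\<close> itself, whose law is known.\<close>
        have "fst (y 0) = (\<lambda>n. code y (int n))" using code_eq[OF y, of 0] by (simp add: fun_eq_iff)
        then show "(?h \<circ> \<Psi>) y = y 0" by (simp add: \<Psi>_def \<pi>_\<pi>'[OF code_Sigma[OF y]] prod_eq_iff)
      qed
      also have "\<dots> = bern \<Otimes>\<^sub>M \<nu>"
        unfolding r_def distr_restrict_space_AE[OF G ae cm] by (rule comp)
      finally show ?thesis .
    qed
  qed
  then show ?thesis using sp\<mu> s\<mu> by blast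
qed

lemma ex_ergodic_measure:
  "\<exists>\<mu>. borel_probability_on \<Lambda> \<mu> \<and> ergodic_measure F \<mu> \<and>
    measure_entropy \<mu> F = ereal (ln 3) \<and> central_exponent \<mu> F \<le> 0"
proof -
  obtain \<nu> where st: "stationary \<nu>" and ext: "extremal \<nu>" and neg: "(LINT t|\<nu>. \<psi> t) \<le> 0"
    using ex_extremal_stationary_nonpos by blast
  obtain \<mu> where sys: "monotone_coded_system g \<mu> F (\<lambda>z. \<pi> (fst z)) snd \<nu>"
    and sp: "space \<mu> = \<Lambda>" and s: "sets \<mu> = sets N"
    using ex_lifted_measure[OF st] by blast
  interpret C: monotone_coded_system g \<mu> F "\<lambda>z. \<pi> (fst z)" snd \<nu> by (rule sys)
  have lm: "l i \<in> borel_measurable borel" for i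
    using l_cont by (rule borel_measurable_continuous_onI)
  have lM: "(\<lambda>q. l (fst q 0) (snd q)) \<in> borel_measurable (bern \<Otimes>\<^sub>M borel)"
    by (rule measurable_compose_countable[where f="\<lambda>i z. l i (snd z)" and g="\<lambda>z. fst z 0"])
       (use lm in measurable)
  have "central_exponent \<mu> F = (LINT z|\<mu>. l (\<pi> (fst z) 0) (snd z))"
    unfolding central_exponent_def
    by (rule Bochner_Integration.integral_cong[OF refl]) (simp add: sp central_exponent_integrand case_prod_beta)
  also have "\<dots> = (LINT z|\<mu>. (\<lambda>q. l (fst q 0) (snd q)) (C.fut z))"
    by (simp add: C.fut_def)
  also have "\<dots> = (LINT q|(distr \<mu> (bern \<Otimes>\<^sub>M borel) C.fut). l (fst q 0) (snd q))"
    by (rule integral_distr[OF C.fut_measurable lM, symmetric])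
  also have "\<dots> = (LINT t|\<nu>. \<psi> t)"
    unfolding C.distr_fut \<psi>_def
    by (rule integral_bern_first[where B=B]) (use st lm l_bdd in \<open>auto simp: stationary_def\<close>)
  finally have "central_exponent \<mu> F \<le> 0" using neg by simp
  moreover have "borel_probability_on \<Lambda> \<mu>"
    unfolding borel_probability_on_def using C.prob_space_axioms sp s by simp
  moreover have "ergodic_measure F \<mu>"
    unfolding ergodic_measure_def invariant_measure_def
    using C.T_measurable C.T_invariant C.ergodic_of_extremal[OF ext] by blast
  ultimately show ?thesis using C.measure_entropy_eq_ln_3 by blast
qed

end

theorem proposition5p8:
  fixes \<Phi> :: "real \<times> real \<Rightarrow> real \<times> real"
    and R :: "nat \<Rightarrow> (real \<times> real) set"
    and \<Gamma> :: "(real \<times> real) set"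
    and \<pi> :: "real \<times> real \<Rightarrow> int \<Rightarrow> nat"
    and s u :: "nat \<Rightarrow> real"
    and f :: "nat \<Rightarrow> real \<Rightarrow> real"
    and \<beta>\<^sub>0 lam\<^sub>0 \<gamma> \<beta>\<^sub>2 p\<^sub>2 :: real
  assumes base: "three_legged_horseshoe \<Phi> R \<Gamma> \<pi> s u"
    and fiber_maps: "\<And>i. i \<in> {0, 1, 2} \<Longrightarrow> C1_injective_unit_map (f i)"
    and domination: "\<And>i j x. i \<in> {0, 1, 2} \<Longrightarrow> j \<in> {0, 1, 2} \<Longrightarrow> x \<in> {0..1} \<Longrightarrow>
        \<bar>s j\<bar> < \<bar>unit_deriv (f i) x\<bar> \<and> \<bar>unit_deriv (f i) x\<bar> < \<bar>u j\<bar>"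
    and F0: "strict_mono_on {0..1} (f 0)"
        "{x \<in> {0..1}. f 0 x = x} = {0, 1}"
        "\<beta>\<^sub>0 = unit_deriv (f 0) 0" "1 < \<beta>\<^sub>0"
        "lam\<^sub>0 = unit_deriv (f 0) 1" "0 < lam\<^sub>0" "lam\<^sub>0 < 1"
        "\<And>x. x \<in> {0..1} \<Longrightarrow> lam\<^sub>0 \<le> unit_deriv (f 0) x"
    and F1: "\<And>x. x \<in> {0..1} \<Longrightarrow> f 1 x = \<gamma> * (1 - x)" "lam\<^sub>0 \<le> \<gamma>" "\<gamma> < 1"
    and F2: "strict_mono_on {0..1} (f 2)"
        "f 2 0 = 0" "\<beta>\<^sub>2 = unit_deriv (f 2) 0" "1 < \<beta>\<^sub>2"
        "0 < p\<^sub>2" "p\<^sub>2 < 1" "f 2 p\<^sub>2 = p\<^sub>2" "\<bar>unit_deriv (f 2) p\<^sub>2\<bar> < 1"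
    and F01: "antimono_on {0..1} (unit_deriv (f 0))"
        "\<gamma> * (lam\<^sub>0 ^ 3 * (1 - lam\<^sub>0) / (1 - inverse \<beta>\<^sub>0)) > 1"
  shows "\<exists>\<mu>. borel_probability_on (skew_Lambda \<Phi> R f) \<mu> \<and>
             ergodic_measure (skew_product \<Phi> R f) \<mu> \<and>
             measure_entropy \<mu> (skew_product \<Phi> R f) = ereal (ln 3) \<and>
             central_exponent \<mu> (skew_product \<Phi> R f) \<le> 0"
proof -
  note base' = base[unfolded three_legged_horseshoe_def]
  have \<Gamma>: "\<Gamma> = maximal_invariant_set \<Phi> (\<Union>i\<in>{0, 1, 2}. R i)"
    using base' by (elim conjE)
  have conj: "\<forall>X\<in>\<Gamma>. \<pi> (\<Phi> X) = shift (\<pi> X)"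
    using base' by (elim conjE)
  have symbol: "\<forall>X\<in>\<Gamma>. \<forall>i\<in>{0, 1, 2}. X \<in> R i \<longleftrightarrow> \<pi> X 0 = i"
    using base' by (elim conjE)
  have "C1_diffeomorphism \<Phi>"
    using base' by (elim conjE)
  moreover have "\<exists>\<pi>'. homeomorphism \<Gamma> Sigma3 \<pi> \<pi>'"
    using base' by (elim conjE)
  ultimately obtain \<pi>' where \<pi>': "homeomorphism \<Gamma> Sigma3 \<pi> \<pi>'" and "C1_map \<Phi>"
    by (auto simp: C1_diffeomorphism_def)
  have cont: "continuous_on UNIV \<Phi>"
    using \<open>C1_map \<Phi>\<close> has_derivative_continuous unfolding C1_map_def
    by (intro continuous_at_imp_continuous_on ballI) blast
  have "horseshoe_skew f \<Phi> R \<Gamma> \<pi> \<pi>'"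
  proof (intro horseshoe_skew.intro smooth_fibers.intro horseshoe_skew_axioms.intro)
    fix i :: nat assume i: "i \<in> {0, 1, 2}"
    show "C1_injective_unit_map (f i)" by (rule fiber_maps[OF i])
    show "unit_deriv (f i) t \<noteq> 0" if "t \<in> {0..1}" for t
      \<comment> \<open>The absolute derivative strictly exceeds a contraction rate of the base,
        which is nonnegative.\<close>
      using domination[OF i i that] by auto
    show "X \<in> R i \<longleftrightarrow> \<pi> X 0 = i" if "X \<in> \<Gamma>" for X by (rule symbol[THEN bspec, THEN bspec, OF that i])
  next
    show "\<pi> (\<Phi> X) = shift (\<pi> X)" if "X \<in> \<Gamma>" for X using conj that by (rule bspec)
  qed (rule cont \<Gamma> \<pi>')+
  then show ?thesis by (rule horseshoe_skew.ex_ergodic_measure)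
qed

end
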